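(* Let $\Sigma$ be a fixed finite alphabet (its size is a constant). There is an algorithm that, given a word $x$ of length $m$ and a word $y$ of length $n$ over $\Sigma$, computes $$\mathsf{LW}(\mathcal{M}_{\tilde{x}},\mathcal{M}_{\tilde{y}})=\sum_{w\in \mathcal{M}_{\tilde{x}} \bigtriangleup \mathcal{M}_{\tilde{y}}}\frac{1}{|w|^2}$$ in $\mathcal{O}(m+n)$ time and $\mathcal{O}(m+n)$ space, where $\tilde{x},\tilde{y}$ are the circularizations of $x,y$ and $\mathcal{M}_{\tilde{x}},\mathcal{M}_{\tilde{y}}$ are their sets of minimal absent words.
   Context: For a word $x$ of length $m$, its rotations are $x^{\langle i\rangle}=x[i\,..\,m-1]x[0\,..\,i-1]$, $0\le i<m$; the circularization $\tilde{x}$ is the class of all rotations of $x$. For a factorial language $L\subseteq\Sigma^*$, $\mathcal{M}_L=\{aub\mid a,b\in\Sigma,\ u\in\Sigma^*,\ aub\notin L,\ au\in L,\ ub\in L\}$. Let $\mathcal{F}_{\tilde{x}^*}$ be the set of all factors of words in $x^*=\{x^k\mid k\ge0\}$ (independent of the chosen rotation). The set of minimal absent words of the circular word $\tilde{x}$ is $\mathcal{M}_{\tilde{x}}=\mathcal{M}_{\mathcal{F}_{\tilde{x}^*}}$. $\bigtriangleup$ denotes symmetric difference. The model of computation is the standard word RAM with the alphabet size treated as a constant.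
   Formalization: The exact value of LW can need Θ(m+n) bits and fits in no constant number of machine words, so the word RAM is given a constant number of rational registers with unit-cost + − × ÷ (not counted as space), which cannot influence words or control flow; word length is at least log(m+n)+O(1). *)

theory Defs
  imports Complex_Main "HOL-Library.Sublist" "HOL-Library.Landau_Symbols"
begin

section \<open>Minimal absent words of circular words\<close>

definition minimal_absent_words :: "'a set \<Rightarrow> 'a list set \<Rightarrow> 'a list set" where
  "minimal_absent_words \<Sigma> L =
     {a # u @ [b] | a u b. a \<in> \<Sigma> \<and> b \<in> \<Sigma> \<and> u \<in> lists \<Sigma> \<and>
        a # u @ [b] \<notin> L \<and> a # u \<in> L \<and> u @ [b] \<in> L}"

definition circ_factors :: "'a list \<Rightarrow> 'a list set" where
  "circ_factors x = {u. \<exists>k. sublist u (concat (replicate k x))}"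

definition circ_maws :: "'a set \<Rightarrow> 'a list \<Rightarrow> 'a list set" where
  "circ_maws \<Sigma> x = minimal_absent_words \<Sigma> (circ_factors x)"

definition LW :: "'a list set \<Rightarrow> 'a list set \<Rightarrow> rat" where
  "LW A B = (\<Sum>w\<in>sym_diff A B. 1 / (of_nat (length w))\<^sup>2)"

text \<open>
  The language of factors depends only on the circularization, i.e. on the class of rotations,
  and the sets of minimal absent words are finite, so that the sum above is a genuine one.
\<close>

lemma concat_replicate_rotate:
  "u @ concat (replicate k (v @ u)) @ v = concat (replicate (Suc k) (u @ v))"
  by (induction k) simp_all

lemma circ_factors_append_subset: "circ_factors (v @ u) \<subseteq> circ_factors (u @ v)"
proof
  fix z assume "z \<in> circ_factors (v @ u)"
  then obtain k where "sublist z (concat (replicate k (v @ u)))"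
    by (auto simp: circ_factors_def)
  moreover have "sublist (concat (replicate k (v @ u))) (concat (replicate (Suc k) (u @ v)))"
    unfolding concat_replicate_rotate[symmetric] sublist_def by blast
  ultimately show "z \<in> circ_factors (u @ v)"
    unfolding circ_factors_def using sublist_order.order_trans by blast
qed

lemma circ_factors_rotate: "circ_factors (rotate i x) = circ_factors x"
proof -
  let ?j = "i mod length x"
  have "circ_factors (drop ?j x @ take ?j x) = circ_factors (take ?j x @ drop ?j x)"
    by (intro equalityI circ_factors_append_subset)
  then show ?thesis by (simp add: rotate_drop_take)
qed

lemma length_concat_replicate: "length (concat (replicate k x)) = k * length x"
  by (induction k) auto

lemma nth_concat_replicate:
  "i < k * length x \<Longrightarrow> concat (replicate k x) ! i = x ! (i mod length x)"
  by (induction k arbitrary: i) (auto simp: nth_append le_mod_geq)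

lemma circ_factors_period:
  assumes "v \<in> circ_factors x" "i + length x < length v"
  shows "v ! (i + length x) = v ! i"
proof -
  obtain k p s where eq: "concat (replicate k x) = p @ v @ s"
    using assms(1) by (auto simp: circ_factors_def sublist_def)
  then have len: "k * length x = length p + length v + length s"
    using length_concat_replicate[of k x] by simp
  have *: "v ! j = x ! ((length p + j) mod length x)" if "j < length v" for j
  proof -
    have "concat (replicate k x) ! (length p + j) = v ! j"
      using that by (simp add: eq nth_append)
    then show ?thesis using nth_concat_replicate[of "length p + j" k x] that len by simp
  qed
  show ?thesis using assms(2) by (simp add: * add.assoc[symmetric])
qed

lemma set_circ_factors: "v \<in> circ_factors x \<Longrightarrow> set v \<subseteq> set x"
  by (auto simp: circ_factors_def dest!: set_mono_sublist split: if_splits)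

lemma circ_maws_length_le:
  assumes "z \<in> circ_maws \<Sigma> x"
  shows "set z \<subseteq> set x \<and> length z \<le> Suc (length x)"
proof -
  obtain a u b where z: "z = a # u @ [b]" and nin: "a # u @ [b] \<notin> circ_factors x"
    and au: "a # u \<in> circ_factors x" and ub: "u @ [b] \<in> circ_factors x"
    using assms by (auto simp: circ_maws_def minimal_absent_words_def)
  have sub: "set z \<subseteq> set x" using set_circ_factors[OF au] set_circ_factors[OF ub] z by auto
  have "length u < length x"
  proof (rule ccontr)
    assume "\<not> length u < length x"
    then have le: "length x \<le> length u" by simp
    obtain k p s where eq: "concat (replicate k x) = p @ (a # u) @ s"
      using au by (auto simp: circ_factors_def sublist_def)
    have ne: "s @ x \<noteq> []" using set_circ_factors[OF au] by auto
    obtain c s' where c: "s @ x = c # s'" using ne by (cases "s @ x") auto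
    have "concat (replicate (Suc k) x) = concat (replicate k x) @ x"
      by (induction k) auto
    also have "\<dots> = p @ (a # u @ [c]) @ s'" using eq c by simp
    finally have auc: "a # u @ [c] \<in> circ_factors x"
      unfolding circ_factors_def sublist_def by blast
    then obtain k' where "sublist (a # u @ [c]) (concat (replicate k' x))"
      by (auto simp: circ_factors_def)
    moreover have "sublist (u @ [c]) (a # u @ [c])" by (simp add: sublist_Cons_right)
    ultimately have uc: "u @ [c] \<in> circ_factors x"
      unfolding circ_factors_def using sublist_order.order_trans by blast
    have x: "length x > 0" using ne set_circ_factors[OF au] by auto
    then have lt: "length u - length x < length u" using le by linarith
    have "(u @ [d]) ! length u = (u @ [d]) ! (length u - length x)"
      if "u @ [d] \<in> circ_factors x" for d
      using circ_factors_period[OF that, of "length u - length x"] le by simp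
    from this[OF ub] this[OF uc] have "b = c"
      using lt by (simp add: nth_append)
    with auc nin show False by simp
  qed
  with sub z show ?thesis by simp
qed

lemma finite_circ_maws: "finite (circ_maws \<Sigma> x)"
proof (rule finite_subset)
  show "circ_maws \<Sigma> x \<subseteq> {z. set z \<subseteq> set x \<and> length z \<le> Suc (length x)}"
    using circ_maws_length_le by blast
qed (simp add: finite_lists_length_le)


section \<open>The word RAM\<close>

text \<open>
  Word registers and memory cells hold \<open>b\<close>-bit words, modelled as naturals below \<open>2 ^ b\<close>.  The
  word length \<open>b\<close> is a parameter of the semantics, not of the program, which is thus uniform.

  An exact value of \<open>LW\<close> does not fit into a constant number of words.  As usual for such sums,
  arithmetic on the numbers being summed has unit cost; to this end there are registers for
  rationals.  The flow of information is one-way: a word can be turned into a rational, but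
  rationals influence neither words nor control flow, so that all combinatorial work
  has to be done on words.
\<close>

datatype word_op = WAdd | WSub | WMul | WDiv | WMod | WAnd | WOr | WXor | WShl | WShr

datatype rat_op = QAdd | QSub | QMul | QDiv

datatype instr =
    Const nat nat                   \<comment> \<open>\<open>r\<^sub>d := c\<close>\<close>
  | WordOp word_op nat nat nat      \<comment> \<open>\<open>r\<^sub>d := r\<^sub>i op r\<^sub>j\<close>\<close>
  | Load nat nat                    \<comment> \<open>\<open>r\<^sub>d := mem[r\<^sub>i]\<close>\<close>
  | Store nat nat                   \<comment> \<open>\<open>mem[r\<^sub>i] := r\<^sub>j\<close>\<close>
  | Jump nat                        \<comment> \<open>\<open>goto l\<close>\<close>
  | JumpLess nat nat nat            \<comment> \<open>\<open>if r\<^sub>i < r\<^sub>j goto l\<close>\<close>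
  | JumpEq nat nat nat              \<comment> \<open>\<open>if r\<^sub>i = r\<^sub>j goto l\<close>\<close>
  | RatOfWord nat nat               \<comment> \<open>\<open>q\<^sub>d := r\<^sub>i\<close>\<close>
  | RatOp rat_op nat nat nat        \<comment> \<open>\<open>q\<^sub>d := q\<^sub>i op q\<^sub>j\<close>\<close>

type_synonym program = "instr list"

record ram_state =
  pc :: nat
  reg :: "nat \<Rightarrow> nat"
  mem :: "nat \<Rightarrow> nat"
  qreg :: "nat \<Rightarrow> rat"

text \<open>Operations wrap around modulo \<open>2 ^ b\<close>; division by zero follows the HOL conventions.\<close>

fun apply_word_op :: "nat \<Rightarrow> word_op \<Rightarrow> nat \<Rightarrow> nat \<Rightarrow> nat" where
  "apply_word_op b WAdd m n = (m + n) mod 2 ^ b"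
| "apply_word_op b WSub m n = (m + (2 ^ b - n)) mod 2 ^ b"
| "apply_word_op b WMul m n = (m * n) mod 2 ^ b"
| "apply_word_op b WDiv m n = m div n"
| "apply_word_op b WMod m n = m mod n"
| "apply_word_op b WAnd m n = and m n"
| "apply_word_op b WOr m n = or m n"
| "apply_word_op b WXor m n = xor m n"
| "apply_word_op b WShl m n = (m * 2 ^ n) mod 2 ^ b"
| "apply_word_op b WShr m n = m div 2 ^ n"

fun apply_rat_op :: "rat_op \<Rightarrow> rat \<Rightarrow> rat \<Rightarrow> rat" where
  "apply_rat_op QAdd p q = p + q"
| "apply_rat_op QSub p q = p - q"
| "apply_rat_op QMul p q = p * q"
| "apply_rat_op QDiv p q = p / q"

fun exec_instr :: "nat \<Rightarrow> instr \<Rightarrow> ram_state \<Rightarrow> ram_state" where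
  "exec_instr b (Const d c) s =
     s\<lparr>pc := Suc (pc s), reg := (reg s)(d := c mod 2 ^ b)\<rparr>"
| "exec_instr b (WordOp f d i j) s =
     s\<lparr>pc := Suc (pc s), reg := (reg s)(d := apply_word_op b f (reg s i) (reg s j))\<rparr>"
| "exec_instr b (Load d i) s =
     s\<lparr>pc := Suc (pc s), reg := (reg s)(d := mem s (reg s i))\<rparr>"
| "exec_instr b (Store i j) s =
     s\<lparr>pc := Suc (pc s), mem := (mem s)(reg s i := reg s j)\<rparr>"
| "exec_instr b (Jump l) s = s\<lparr>pc := l\<rparr>"
| "exec_instr b (JumpLess i j l) s =
     s\<lparr>pc := (if reg s i < reg s j then l else Suc (pc s))\<rparr>"
| "exec_instr b (JumpEq i j l) s =
     s\<lparr>pc := (if reg s i = reg s j then l else Suc (pc s))\<rparr>"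
| "exec_instr b (RatOfWord d i) s =
     s\<lparr>pc := Suc (pc s), qreg := (qreg s)(d := of_nat (reg s i))\<rparr>"
| "exec_instr b (RatOp f d i j) s =
     s\<lparr>pc := Suc (pc s), qreg := (qreg s)(d := apply_rat_op f (qreg s i) (qreg s j))\<rparr>"

definition halted :: "program \<Rightarrow> ram_state \<Rightarrow> bool" where
  "halted P s \<longleftrightarrow> length P \<le> pc s"

definition step :: "nat \<Rightarrow> program \<Rightarrow> ram_state \<Rightarrow> ram_state" where
  "step b P s = (if halted P s then s else exec_instr b (P ! pc s) s)"

definition accessed :: "program \<Rightarrow> ram_state \<Rightarrow> nat set" where
  "accessed P s =
     (if halted P s then {}
      else case P ! pc s of Load d i \<Rightarrow> {reg s i} | Store i j \<Rightarrow> {reg s i} | _ \<Rightarrow> {})"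

text \<open>
  Time is the number of executed instructions.  Space is the size of the initial segment of the
  memory in which all accesses take place; a program mentions only a constant number of registers.
  The result is delivered in the rational register 0.
\<close>

definition ram_computes ::
  "nat \<Rightarrow> program \<Rightarrow> ram_state \<Rightarrow> nat \<Rightarrow> nat \<Rightarrow> rat \<Rightarrow> bool" where
  "ram_computes b P s time space v \<longleftrightarrow>
     (\<exists>t\<le>time. halted P ((step b P ^^ t) s) \<and>
        (\<forall>i<t. accessed P ((step b P ^^ i) s) \<subseteq> {..<space}) \<and>
        qreg ((step b P ^^ t) s) 0 = v)"

text \<open>The memory initially contains \<open>|x|, |y|\<close>, the letters of \<open>x\<close>, those of \<open>y\<close>, and then zeros.\<close>

definition input_cells :: "('a \<Rightarrow> nat) \<Rightarrow> 'a list \<Rightarrow> 'a list \<Rightarrow> nat list" where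
  "input_cells code x y = [length x, length y] @ map code x @ map code y"

definition initial_state :: "('a \<Rightarrow> nat) \<Rightarrow> 'a list \<Rightarrow> 'a list \<Rightarrow> ram_state" where
  "initial_state code x y =
     \<lparr>pc = 0, reg = (\<lambda>_. 0),
      mem = (\<lambda>i. if i < length (input_cells code x y) then input_cells code x y ! i else 0),
      qreg = (\<lambda>_. 0)\<rparr>"

end

theory Submission
  imports Defs
begin

text \<open>
  Write \<open>F(v)\<close> for the factors of \<open>v\<close>. As \<open>x x\<close> contains every factor of length at most \<open>|x| + 1\<close> of
  the powers of \<open>x\<close>, the minimal absent words of the circular word are those of \<open>F(x x)\<close> of length at
  most \<open>|x| + 1\<close>. Build the suffix automaton of \<open>w = x x $ y y\<close> online; its states are the classes of
  factors with the same end positions, and the longest words of the classes are the prefixes of \<open>w\<close> and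
  the left special factors. If \<open>a u b\<close> is a minimal absent word of \<open>F(x x)\<close> or \<open>F(y y)\<close>, then \<open>u\<close> and
  \<open>a u\<close> lie in different classes, so \<open>a u\<close> is the shortest word of its class \<open>p\<close> and \<open>u\<close> the longest
  word of the suffix link of \<open>p\<close>. Hence the minimal absent words of both words are found by inspecting
  the pairs of a state and a letter, once it is known which states occur in \<open>x x\<close> and in \<open>y y\<close>; that is
  found by reading these words and marking states upwards along suffix links.

  The construction takes linear time since the sum of the lengths of the first two suffix links of the
  last state grows by at most a constant with each letter and pays for all traversed links.
\<close>

section \<open>Nodes: prefixes and left special factors\<close>

definition nodes :: "'a list \<Rightarrow> 'a list set" where
  "nodes w = {u. sublist u w \<and> (prefix u w \<or> (\<exists>a b. a \<noteq> b \<and> sublist (a # u) w \<and> sublist (b # u) w))}"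

definition class_top :: "'a list \<Rightarrow> 'a list \<Rightarrow> 'a list \<Rightarrow> bool" where
  "class_top w u v \<longleftrightarrow> v \<in> nodes w \<and> suffix u v \<and> (\<forall>v'\<in>nodes w. suffix u v' \<longrightarrow> suffix v v')"

definition parent :: "'a list \<Rightarrow> 'a list \<Rightarrow> 'a list \<Rightarrow> bool" where
  "parent w u v \<longleftrightarrow> v \<in> nodes w \<and> strict_suffix v u \<and> (\<forall>v'\<in>nodes w. strict_suffix v' u \<longrightarrow> suffix v' v)"

lemma sublist_suffixD: "sublist v w \<Longrightarrow> suffix u v \<Longrightarrow> sublist u w"
  by (meson sublist_order.order_trans suffix_imp_sublist)

lemma sublist_prefixD: "sublist v w \<Longrightarrow> prefix u v \<Longrightarrow> sublist u w"
  by (meson sublist_order.order_trans prefix_imp_sublist)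

lemma sublist_snocD: "sublist (u @ [a]) w \<Longrightarrow> sublist u w"
  by (rule sublist_prefixD) auto

lemma sublist_snoc_iff: "sublist u (w @ [c]) \<longleftrightarrow> sublist u w \<or> suffix u (w @ [c])"
  by (metis sublist_snoc)

lemma sublist_obtain_prefix:
  assumes "sublist (u @ s) w"
  obtains p where "prefix (p @ u) w" "prefix (p @ u @ s) w"
proof -
  from assms obtain p r where "w = p @ (u @ s) @ r" by (auto simp: sublist_def)
  then show thesis using that[of p] by simp
qed

lemma suffix_append_self [simp]: "suffix u (p @ u)"
  by (rule suffixI) simp

lemma suffix_shorter: "suffix u w \<Longrightarrow> suffix v w \<Longrightarrow> length u \<le> length v \<Longrightarrow> suffix u v"
  by (meson suffix_length_suffix)

lemma suffix_same_length: "suffix u w \<Longrightarrow> suffix v w \<Longrightarrow> length u = length v \<Longrightarrow> u = v"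
  by (metis suffix_shorter suffix_length_le suffix_order.antisym order_refl)

lemma strict_suffix_length: "strict_suffix u v \<Longrightarrow> length u < length v"
  by (auto simp: strict_suffix_def suffix_def)

lemma strict_suffix_obtain:
  assumes "strict_suffix v u" obtains a where "suffix (a # v) u"
proof -
  from assms obtain p where "u = p @ v" "p \<noteq> []" by (auto simp: strict_suffix_def suffix_def)
  then show thesis using that[of "last p"] by (metis append_butlast_last_id append.assoc append_Cons append_Nil suffixI)
qed

lemma prefix_in_nodes: "prefix u w \<Longrightarrow> u \<in> nodes w"
  by (simp add: nodes_def prefix_imp_sublist)

lemma Nil_in_nodes [simp]: "[] \<in> nodes w"
  by (simp add: prefix_in_nodes)

lemma self_in_nodes [simp]: "w \<in> nodes w"
  by (simp add: prefix_in_nodes)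

lemma nodes_sublist: "u \<in> nodes w \<Longrightarrow> sublist u w"
  by (simp add: nodes_def)

lemma nodes_prefixD:
  assumes "u @ s \<in> nodes w" shows "u \<in> nodes w"
proof -
  have "sublist u w" using nodes_sublist[OF assms] by (rule sublist_prefixD) simp
  moreover have "prefix u w \<or> (\<exists>a b. a \<noteq> b \<and> sublist (a # u) w \<and> sublist (b # u) w)"
    using assms unfolding nodes_def mem_Collect_eq
    by (metis append_prefixD append_Cons sublist_prefixD prefixI)
  ultimately show ?thesis by (simp add: nodes_def)
qed

lemma suffix_fork:
  assumes "suffix u v" "suffix u v'" "\<not> suffix v v'" "\<not> suffix v' v"
  obtains a b t where "a \<noteq> b" "suffix (a # t) v" "suffix (b # t) v'" "suffix u t"
proof -
  have "rev v \<parallel> rev v'" using assms(3,4) by (auto simp: suffix_to_prefix)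
  then obtain as b bs c cs where *: "b \<noteq> c" "rev v = as @ b # bs" "rev v' = as @ c # cs"
    using parallel_decomp by blast
  have v: "v = rev bs @ b # rev as" using *(2) by (metis rev_rev_ident rev_append rev.simps(2) append.assoc append_Cons append_Nil)
  have v': "v' = rev cs @ c # rev as" using *(3) by (metis rev_rev_ident rev_append rev.simps(2) append.assoc append_Cons append_Nil)
  have s: "suffix (b # rev as) v" "suffix (c # rev as) v'" by (simp_all add: v v' suffixI)
  have "suffix u (rev as)"
  proof (rule ccontr)
    assume n: "\<not> suffix u (rev as)"
    have "suffix u (rev as) \<or> length u > length as"
      using suffix_shorter[OF assms(1) suffix_ConsD[OF s(1)]] by (cases "length u \<le> length as") auto
    then have l: "length u \<ge> length (b # rev as)" using n by auto
    have "suffix (b # rev as) u" "suffix (c # rev as) u"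
      using suffix_shorter[OF s(1) assms(1)] suffix_shorter[OF s(2) assms(2)] l by simp_all
    from suffix_same_length[OF this] show False using *(1) by simp
  qed
  then show thesis using that[OF *(1) s] by blast
qed

lemma class_top_unique: "class_top w u v \<Longrightarrow> class_top w u v' \<Longrightarrow> v = v'"
  unfolding class_top_def by (meson suffix_order.antisym)

lemma class_top_exists:
  assumes "sublist u w" shows "\<exists>v. class_top w u v"
proof -
  obtain p where "prefix (p @ u) w" using sublist_obtain_prefix[of u "[]" w] assms by auto
  then have "p @ u \<in> nodes w \<and> suffix u (p @ u)" by (simp add: prefix_in_nodes)
  then obtain v where v: "v \<in> nodes w" "suffix u v"
    and least: "\<And>v'. v' \<in> nodes w \<and> suffix u v' \<Longrightarrow> length v \<le> length v'"
    using ex_has_least_nat[of "\<lambda>v. v \<in> nodes w \<and> suffix u v" "p @ u" length] by auto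
  have "suffix v v'" if v': "v' \<in> nodes w" "suffix u v'" for v'
  proof (rule ccontr)
    assume n: "\<not> suffix v v'"
    then have "\<not> suffix v' v" using least[of v'] v' suffix_length_le suffix_same_length
      by (metis le_antisym suffix_order.refl)
    with n v v' obtain a b t where t: "a \<noteq> b" "suffix (a # t) v" "suffix (b # t) v'" "suffix u t"
      using suffix_fork by metis
    have "sublist (a # t) w" "sublist (b # t) w"
      using t v v' nodes_sublist sublist_suffixD by metis+
    moreover from this have "sublist t w" by (auto intro: sublist_suffixD simp: suffix_ConsI)
    ultimately have "t \<in> nodes w" using t(1) unfolding nodes_def by blast
    from least[of t] this t(4) have "length v \<le> length t" by simp
    with suffix_length_le[OF t(2)] show False by simp
  qed
  with v show ?thesis unfolding class_top_def by blast
qed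

lemma class_top_refl: "u \<in> nodes w \<Longrightarrow> class_top w u u"
  by (simp add: class_top_def)

lemma class_top_sublist': "class_top w u v \<Longrightarrow> sublist u w"
  by (meson class_top_def nodes_sublist sublist_suffixD)

lemma class_top_append_sublist:
  assumes "class_top w u v" "sublist (u @ s) w" shows "sublist (v @ s) w"
proof -
  obtain p where p: "prefix (p @ u) w" "prefix (p @ u @ s) w"
    using sublist_obtain_prefix[OF assms(2)] .
  have "suffix v (p @ u)" using assms(1) prefix_in_nodes[OF p(1)] unfolding class_top_def by simp
  then have "suffix (v @ s) (p @ u @ s)" by (auto simp: suffix_def)
  then show ?thesis using p(2) by (meson prefix_imp_sublist sublist_suffixD)
qed

lemma class_top_append_sublist_iff:
  assumes "class_top w u v" shows "sublist (v @ s) w \<longleftrightarrow> sublist (u @ s) w"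
proof
  assume "sublist (v @ s) w"
  moreover have "suffix (u @ s) (v @ s)" using assms by (auto simp: class_top_def suffix_def)
  ultimately show "sublist (u @ s) w" by (rule sublist_suffixD)
qed (rule class_top_append_sublist[OF assms])

lemma class_top_append:
  assumes "class_top w u v" shows "class_top w (u @ s) x \<longleftrightarrow> class_top w (v @ s) x"
proof -
  have "suffix (u @ s) x' \<longleftrightarrow> suffix (v @ s) x'" if x': "x' \<in> nodes w" for x'
  proof
    assume "suffix (u @ s) x'"
    then obtain y where y: "x' = y @ u @ s" by (auto simp: suffix_def)
    then have "y @ u \<in> nodes w" using x' nodes_prefixD[of "y @ u" s w] by simp
    then have "suffix v (y @ u)" using assms by (simp add: class_top_def)
    then show "suffix (v @ s) x'" by (auto simp: y suffix_def)
  next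
    assume "suffix (v @ s) x'"
    then show "suffix (u @ s) x'" using assms by (auto simp: class_top_def suffix_def)
  qed
  then show ?thesis unfolding class_top_def by blast
qed

lemma class_top_between:
  assumes "class_top w u v" "suffix u x" "suffix x v" shows "class_top w x v"
  using assms unfolding class_top_def by (meson suffix_order.trans)

text \<open>The only factor of \<open>w\<close> that can become left special when \<open>c\<close> is appended.\<close>

definition longest_old_suffix :: "'a list \<Rightarrow> 'a \<Rightarrow> 'a list \<Rightarrow> bool" where
  "longest_old_suffix w c z \<longleftrightarrow> suffix z (w @ [c]) \<and> sublist z w \<and>
     (\<forall>v. suffix v (w @ [c]) \<longrightarrow> sublist v w \<longrightarrow> suffix v z)"

lemma snoc_not_sublist: "\<not> sublist (w @ [c]) w"
  using sublist_length_le by fastforce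

lemma longest_old_suffix_new:
  assumes "longest_old_suffix w c z"
  obtains d where "suffix (d # z) (w @ [c])" "\<not> sublist (d # z) w"
proof -
  have "strict_suffix z (w @ [c])"
    using assms snoc_not_sublist by (metis longest_old_suffix_def strict_suffix_def)
  then obtain d where d: "suffix (d # z) (w @ [c])" using strict_suffix_obtain by metis
  then have "\<not> sublist (d # z) w"
    using assms suffix_length_le[of "d # z" z] by (auto simp: longest_old_suffix_def)
  with d that show thesis by blast
qed

lemma nodes_mono_snoc: "nodes w \<subseteq> nodes (w @ [c])"
  unfolding nodes_def by (auto simp: sublist_snoc_iff)

lemma nodes_snoc:
  assumes z: "longest_old_suffix w c z"
  shows "nodes (w @ [c]) = insert (w @ [c]) (insert z (nodes w))"
proof (intro equalityI subsetI)
  fix u assume u: "u \<in> nodes (w @ [c])"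
  show "u \<in> insert (w @ [c]) (insert z (nodes w))"
  proof (rule ccontr)
    assume n: "u \<notin> insert (w @ [c]) (insert z (nodes w))"
    then have "\<not> prefix u (w @ [c])" using prefix_in_nodes[of u w] by auto
    then obtain a b where ab: "a \<noteq> b" "sublist (a # u) (w @ [c])" "sublist (b # u) (w @ [c])"
      using u unfolding nodes_def by blast
    have not_both: "\<not> (suffix (a # u) (w @ [c]) \<and> suffix (b # u) (w @ [c]))"
      using ab(1) suffix_same_length[of "a # u" "w @ [c]" "b # u"] by auto
    then have uw: "sublist u w" using ab(2,3)
      by (metis sublist_snoc_iff sublist_suffixD suffix_ConsI suffix_order.refl)
    have *: "sublist (e # u) w" if e: "sublist (e # u) (w @ [c])" for e
    proof (rule ccontr)
      assume ne: "\<not> sublist (e # u) w"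
      then have s: "suffix (e # u) (w @ [c])" using e by (simp add: sublist_snoc_iff)
      then have "suffix u (w @ [c])" by (metis suffix_ConsD)
      then have uz: "suffix u z" using z uw unfolding longest_old_suffix_def by blast
      then have "length u < length z" using n
        by (metis insertI1 insertI2 suffix_length_le le_neq_implies_less suffix_same_length suffix_order.refl)
      then have "suffix (e # u) z"
        using s z suffix_shorter[of "e # u" "w @ [c]" z] by (auto simp: longest_old_suffix_def)
      then show False using ne z sublist_suffixD[of z w] by (auto simp: longest_old_suffix_def)
    qed
    have "u \<in> nodes w" using *[OF ab(2)] *[OF ab(3)] ab(1) uw unfolding nodes_def by blast
    with n show False by simp
  qed
next
  fix u assume "u \<in> insert (w @ [c]) (insert z (nodes w))"
  then consider "u = w @ [c]" | "u = z" | "u \<in> nodes w" by blast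
  then show "u \<in> nodes (w @ [c])"
  proof cases
    case 2
    obtain d where d: "suffix (d # z) (w @ [c])" "\<not> sublist (d # z) w"
      using longest_old_suffix_new[OF z] .
    have zw: "sublist z w" using z by (simp add: longest_old_suffix_def)
    obtain p where p: "prefix (p @ z) w" using sublist_obtain_prefix[of z "[]" w] zw by auto
    show ?thesis
    proof (cases p rule: rev_cases)
      case Nil
      then show ?thesis using p 2 by (simp add: prefix_in_nodes)
    next
      case (snoc p' e)
      then have "prefix (p' @ e # z) w" using p by simp
      then have e: "sublist (e # z) w" by (meson prefix_imp_sublist sublist_suffixD suffixI)
      then have "e \<noteq> d" using d by auto
      moreover have "sublist (e # z) (w @ [c])" "sublist (d # z) (w @ [c])" "sublist z (w @ [c])"
        using e d zw by (auto simp: sublist_snoc_iff)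
      ultimately show ?thesis unfolding 2 nodes_def by blast
    qed
  qed (use nodes_mono_snoc[of w c] in auto)
qed

lemma longest_old_suffix_butlast_node:
  assumes "longest_old_suffix w c z" "z = v @ [c]"
  shows "v \<in> nodes w"
proof -
  obtain d where d: "suffix (d # z) (w @ [c])" "\<not> sublist (d # z) w"
    using longest_old_suffix_new[OF assms(1)] .
  have zw: "sublist (v @ [c]) w" using assms by (simp add: longest_old_suffix_def)
  have dv: "suffix (d # v) w" using d(1) assms(2) by (simp flip: append_Cons)
  obtain p where p: "prefix (p @ v @ [c]) w" using sublist_obtain_prefix[OF zw] .
  show ?thesis
  proof (cases p rule: rev_cases)
    case Nil
    then show ?thesis using p by (auto intro: prefix_in_nodes append_prefixD)
  next
    case (snoc p' e)
    then have "prefix (p' @ e # v @ [c]) w" using p by simp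
    then have e: "sublist (e # v @ [c]) w" by (meson prefix_imp_sublist sublist_suffixD suffixI)
    then have "e \<noteq> d" using d assms(2) by auto
    moreover have "sublist (e # v) w" using e sublist_prefixD[of "e # v @ [c]"] by simp
    moreover have "sublist (d # v) w" using dv by (rule suffix_imp_sublist)
    moreover have "sublist v w" using zw by (rule sublist_snocD)
    ultimately show ?thesis unfolding nodes_def by blast
  qed
qed

section \<open>The suffix automaton and its online extension\<close>

lemma longest_old_suffix_exists: "\<exists>z. longest_old_suffix w c z"
proof -
  let ?P = "\<lambda>v. suffix v (w @ [c]) \<and> sublist v w"
  have "?P []" by simp
  moreover have "\<forall>v. ?P v \<longrightarrow> length v < Suc (length w)" using sublist_length_le less_Suc_eq_le by blast
  ultimately obtain z where z: "?P z" "\<forall>v. ?P v \<longrightarrow> length v \<le> length z"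
    using ex_has_greatest_nat[of ?P "[]" length "Suc (length w)"] by blast
  then have "suffix v z" if "?P v" for v
    using that suffix_shorter[of v "w @ [c]" z] by blast
  with z(1) show ?thesis unfolding longest_old_suffix_def by blast
qed

lemma longest_old_suffix_Nil_or: "longest_old_suffix w c z \<Longrightarrow> z = [] \<or> (\<exists>v. z = v @ [c] \<and> suffix v w)"
  by (auto simp: longest_old_suffix_def)

context
  fixes w :: "'a list" and c z
  assumes z: "longest_old_suffix w c z"
begin

lemma class_top_snoc_keep:
  assumes "class_top w u v" "suffix u z \<Longrightarrow> suffix v z"
  shows "class_top (w @ [c]) u v"
proof -
  have zw: "suffix z (w @ [c])" and max: "\<And>v. suffix v (w @ [c]) \<Longrightarrow> sublist v w \<Longrightarrow> suffix v z"
    using z unfolding longest_old_suffix_def by blast+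
  have "suffix v v'" if v': "v' \<in> nodes (w @ [c])" "suffix u v'" for v'
  proof -
    consider "v' = w @ [c]" | "v' = z" | "v' \<in> nodes w" using v'(1) nodes_snoc[OF z] by blast
    then show ?thesis
    proof cases
      case 1
      then have "suffix u z" using v'(2) max class_top_sublist'[OF assms(1)] by simp
      then show ?thesis using assms(2) zw 1 suffix_order.trans by blast
    qed (use v' assms in \<open>auto simp: class_top_def\<close>)
  qed
  then show ?thesis using assms(1) nodes_mono_snoc[of w c] unfolding class_top_def by blast
qed

lemma class_top_snoc_keep_node:
  assumes "z \<in> nodes w" "class_top w u v" shows "class_top (w @ [c]) u v"
  by (rule class_top_snoc_keep[OF assms(2)]) (use assms in \<open>simp add: class_top_def\<close>)

lemma class_top_snoc_keep_other:
  assumes "class_top w z q" "class_top w u v" "v \<noteq> q" shows "class_top (w @ [c]) u v"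
proof (rule class_top_snoc_keep[OF assms(2)])
  assume uz: "suffix u z"
  have vq: "suffix v q" using uz assms(1,2) unfolding class_top_def by (meson suffix_order.trans)
  have zq: "suffix z q" using assms(1) by (simp add: class_top_def)
  show "suffix v z"
  proof (rule ccontr)
    assume "\<not> suffix v z"
    then have "suffix z v" using suffix_same_cases[OF vq zq] by blast
    then have "suffix q v" using assms(1,2) by (simp add: class_top_def)
    with vq assms(3) show False by (meson suffix_order.antisym)
  qed
qed

lemma class_top_snoc_split:
  assumes "class_top w u q" "class_top w z q" "suffix u z" shows "class_top (w @ [c]) u z"
proof -
  have "suffix z v'" if v': "v' \<in> nodes (w @ [c])" "suffix u v'" for v'
  proof -
    consider "v' = w @ [c]" | "v' = z" | "v' \<in> nodes w" using v'(1) nodes_snoc[OF z] by blast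
    then show ?thesis
    proof cases
      case 1 then show ?thesis using z by (simp only: longest_old_suffix_def)
    next
      case 3
      then show ?thesis using assms v'(2) unfolding class_top_def by (meson suffix_order.trans)
    qed auto
  qed
  then show ?thesis using assms(3) nodes_snoc[OF z] unfolding class_top_def by blast
qed

lemma class_top_snoc_new:
  assumes "suffix u (w @ [c])" "\<not> sublist u w" shows "class_top (w @ [c]) u (w @ [c])"
proof -
  have "v' = w @ [c]" if v': "v' \<in> nodes (w @ [c])" "suffix u v'" for v'
  proof (rule ccontr)
    assume "v' \<noteq> w @ [c]"
    then have "sublist v' w" using v'(1) nodes_snoc[OF z] z
      by (auto simp: longest_old_suffix_def nodes_sublist)
    then show False using v'(2) assms(2) sublist_suffixD by blast
  qed
  then show ?thesis using assms(1) unfolding class_top_def by auto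
qed

lemma parent_snoc_new: "parent (w @ [c]) (w @ [c]) z"
proof -
  have "strict_suffix z (w @ [c])"
    using z snoc_not_sublist[of w c] by (metis longest_old_suffix_def strict_suffix_def)
  moreover have "suffix v' z" if v': "v' \<in> nodes (w @ [c])" "strict_suffix v' (w @ [c])" for v'
  proof -
    have "sublist v' w" using v' nodes_snoc[OF z] z
      by (auto simp: longest_old_suffix_def nodes_sublist strict_suffix_def)
    then show ?thesis using z v'(2) unfolding longest_old_suffix_def strict_suffix_def by blast
  qed
  ultimately show ?thesis using nodes_snoc[OF z] unfolding parent_def by blast
qed

lemma not_strict_suffix_of_node: "u \<in> nodes w \<Longrightarrow> \<not> strict_suffix (w @ [c]) u"
  using sublist_length_le[OF nodes_sublist, of u w] strict_suffix_length[of "w @ [c]" u] by auto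

lemma parent_snoc_keep_node:
  assumes "z \<in> nodes w" "u \<in> nodes w" "parent w u v" shows "parent (w @ [c]) u v"
  using assms not_strict_suffix_of_node[OF assms(2)] nodes_snoc[OF z] unfolding parent_def by auto

lemma parent_snoc_keep_other:
  assumes "class_top w z q" "u \<in> nodes w" "u \<noteq> q" "parent w u v" shows "parent (w @ [c]) u v"
proof -
  have "suffix z v" if "strict_suffix z u"
  proof -
    have "strict_suffix q u"
      using that assms unfolding class_top_def strict_suffix_def by blast
    then have "suffix q v" using assms(1,4) unfolding class_top_def parent_def by blast
    then show ?thesis using assms(1) unfolding class_top_def by (meson suffix_order.trans)
  qed
  then show ?thesis
    using assms not_strict_suffix_of_node[OF assms(2)] nodes_snoc[OF z] unfolding parent_def by auto
qed

context
  fixes q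
  assumes q: "class_top w z q" and zn: "z \<notin> nodes w"
begin

lemma strict_suffix_split_node:
  assumes "v \<in> nodes w" "strict_suffix v q" shows "strict_suffix v z"
proof -
  have zq: "suffix z q" using q by (simp add: class_top_def)
  have "suffix v z"
  proof (rule ccontr)
    assume "\<not> suffix v z"
    then have "suffix z v" using suffix_same_cases[OF _ zq, of v] assms(2) by (auto simp: strict_suffix_def)
    then have "suffix q v" using q assms(1) by (simp add: class_top_def)
    with assms(2) show False by (meson suffix_order.less_le_not_le)
  qed
  then show ?thesis using assms(1) zn by (auto simp: strict_suffix_def)
qed

lemma parent_snoc_split_top: "parent (w @ [c]) q z"
proof -
  have qn: "q \<in> nodes w" using q by (simp add: class_top_def)
  then have "strict_suffix z q" using q zn by (auto simp: class_top_def strict_suffix_def)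
  moreover have "suffix v' z" if v': "v' \<in> nodes (w @ [c])" "strict_suffix v' q" for v'
    using v' not_strict_suffix_of_node[OF qn] nodes_snoc[OF z] strict_suffix_split_node[of v']
    by (auto simp: strict_suffix_def)
  ultimately show ?thesis using nodes_snoc[OF z] unfolding parent_def by blast
qed

lemma parent_snoc_split_bottom:
  assumes "parent w q v" shows "parent (w @ [c]) z v"
proof -
  have v: "v \<in> nodes w" "strict_suffix v q" using assms by (simp_all add: parent_def)
  have "suffix v' v" if v': "v' \<in> nodes (w @ [c])" "strict_suffix v' z" for v'
  proof -
    have zq: "suffix z q" using q by (simp add: class_top_def)
    then have s: "strict_suffix v' q" using v'(2) by (meson suffix_order.less_le_trans)
    have "v' \<noteq> w @ [c]" using s not_strict_suffix_of_node[of q] q by (auto simp: class_top_def)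
    then have "v' \<in> nodes w" using v' nodes_snoc[OF z] by auto
    then show ?thesis using assms s by (simp add: parent_def)
  qed
  then show ?thesis using v nodes_snoc[OF z] strict_suffix_split_node[OF v] unfolding parent_def by blast
qed

end

end

text \<open>State \<open>0\<close> is a sentinel above the root \<open>1\<close>, with a transition to the root for every letter and
  also serving as the undefined target. State \<open>p > 0\<close> has longest word \<open>S p\<close>, and \<open>len\<close> is shifted
  by one so that the sentinel has length \<open>0\<close>.\<close>

locale suffix_automaton =
  fixes A :: nat and w :: "nat list" and n lst :: nat
    and S :: "nat \<Rightarrow> nat list" and lnk len :: "nat \<Rightarrow> nat" and \<delta> :: "nat \<Rightarrow> nat \<Rightarrow> nat"
  assumes bij: "bij_betw S {1..<n} (nodes w)" and n_gt: "1 < n" and S_root: "S 1 = []"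
    and lst: "lst \<in> {1..<n}" and S_lst: "S lst = w"
    and len: "p \<in> {1..<n} \<Longrightarrow> len p = Suc (length (S p))" and len_0: "len 0 = 0"
    and lnk_0: "lnk 0 = 0" and lnk_root: "lnk 1 = 0"
    and lnk: "p \<in> {2..<n} \<Longrightarrow> lnk p \<in> {1..<n} \<and> parent w (S p) (S (lnk p))"
    and delta_0: "a < A \<Longrightarrow> \<delta> 0 a = 1"
    and delta: "p \<in> {1..<n} \<Longrightarrow> a < A \<Longrightarrow> sublist (S p @ [a]) w \<Longrightarrow>
      \<delta> p a \<in> {1..<n} \<and> class_top w (S p @ [a]) (S (\<delta> p a))"
    and delta_undef: "p \<in> {1..<n} \<Longrightarrow> a < A \<Longrightarrow> \<not> sublist (S p @ [a]) w \<Longrightarrow> \<delta> p a = 0"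
begin

lemma S_node: "p \<in> {1..<n} \<Longrightarrow> S p \<in> nodes w"
  using bij by (auto simp: bij_betw_def)

lemma S_inj: "p \<in> {1..<n} \<Longrightarrow> q \<in> {1..<n} \<Longrightarrow> S p = S q \<longleftrightarrow> p = q"
  using bij by (auto simp: bij_betw_def inj_on_def)

lemma S_surj: "u \<in> nodes w \<Longrightarrow> \<exists>p\<in>{1..<n}. S p = u"
  using bij by (metis bij_betw_def imageE)

lemma lnk_less: "p < n \<Longrightarrow> lnk p < n"
  using lnk[of p] lnk_0 lnk_root n_gt by (cases "p = 0"; cases "p = 1") auto

lemma lnk_pos: "p \<in> {1..<n} \<Longrightarrow> lnk p \<noteq> 0 \<Longrightarrow> p \<in> {2..<n} \<and> lnk p \<in> {1..<n} \<and> parent w (S p) (S (lnk p))"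
  using lnk[of p] lnk_root by (cases "p = 1") auto

lemma len_lnk_less: assumes "p \<in> {1..<n}" shows "len (lnk p) < len p"
proof (cases "lnk p = 0")
  case False
  then have "strict_suffix (S (lnk p)) (S p)" "lnk p \<in> {1..<n}"
    using lnk_pos[OF assms] by (auto simp: parent_def)
  then show ?thesis using strict_suffix_length assms by (simp add: len)
qed (use assms len in \<open>simp add: len_0\<close>)

lemma suffix_lnk: "p \<in> {1..<n} \<Longrightarrow> lnk p \<noteq> 0 \<Longrightarrow> suffix (S (lnk p)) (S p)"
  using lnk_pos by (auto simp: parent_def strict_suffix_def)

lemma suffix_len_le: "p \<in> {1..<n} \<Longrightarrow> q \<in> {1..<n} \<Longrightarrow> suffix (S p) x \<Longrightarrow> suffix (S q) x \<Longrightarrow>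
   suffix (S p) (S q) \<longleftrightarrow> len p \<le> len q"
  using suffix_shorter[of "S p" x "S q"] suffix_length_le[of "S p" "S q"] by (auto simp: len)

lemma strict_suffix_lnk:
  assumes "p \<in> {1..<n}" "q \<in> {1..<n}" "suffix (S p) (S q)" "p \<noteq> q"
  shows "lnk q \<in> {1..<n}" "suffix (S p) (S (lnk q))" "len p \<le> len (lnk q)"
proof -
  have s: "strict_suffix (S p) (S q)" using assms S_inj by (auto simp: strict_suffix_def)
  then have "q \<noteq> 1" using S_root by (auto simp: strict_suffix_def)
  then have q: "lnk q \<in> {1..<n}" "parent w (S q) (S (lnk q))" using lnk[of q] assms(2) by auto
  then show "lnk q \<in> {1..<n}" "suffix (S p) (S (lnk q))"
    using s S_node[OF assms(1)] by (auto simp: parent_def)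
  then show "len p \<le> len (lnk q)" using suffix_length_le assms(1) by (auto simp: len)
qed

lemma chain_step:
  assumes "p \<in> {1..<n}" "u \<in> {1..<n}" "suffix (S p) x" "suffix (S u) x" "len (lnk p) < len u"
  shows "u = p \<or> len p < len u"
proof (rule ccontr)
  assume n: "\<not> (u = p \<or> len p < len u)"
  then have "suffix (S u) (S p)" using suffix_len_le[of u p x] assms by simp
  then have "len u \<le> len (lnk p)" using strict_suffix_lnk(3)[of u p] assms n by simp
  with assms(5) show False by simp
qed

lemma len_lnk_mono:
  assumes "p \<in> {1..<n}" "q \<in> {1..<n}" "suffix (S p) (S q)" shows "len (lnk p) \<le> len (lnk q)"
  using strict_suffix_lnk(3)[OF assms] len_lnk_less[OF assms(1)] by (cases "p = q") auto

end

locale suffix_automaton_extend = suffix_automaton +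
  fixes c p :: nat
  assumes c: "c < A" and p_less: "p < n"
    and p_suffix: "p \<noteq> 0 \<Longrightarrow> suffix (S p) w \<and> sublist (S p @ [c]) w"
    and above_p: "u \<in> {1..<n} \<Longrightarrow> suffix (S u) w \<Longrightarrow> len p < len u \<Longrightarrow> \<not> sublist (S u @ [c]) w"
begin

definition z where "z = (if p = 0 then [] else S p @ [c])"
definition q where "q = \<delta> p c"
definition \<delta>1 where "\<delta>1 u a = (if a = c \<and> 1 \<le> u \<and> u < n \<and> suffix (S u) w \<and> len p < len u then n else \<delta> u a)"

lemma z: "longest_old_suffix w c z"
proof -
  obtain z0 where z0: "longest_old_suffix w c z0" using longest_old_suffix_exists[of w c] by blast
  have max: "suffix (S p @ [c]) z0" if "p \<noteq> 0"
    using p_suffix[OF that] z0 by (simp add: longest_old_suffix_def)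
  have "z = z0"
    using longest_old_suffix_Nil_or[OF z0]
  proof (elim disjE exE conjE)
    assume "z0 = []" then show ?thesis using max by (auto simp: z_def)
  next
    fix v assume v: "z0 = v @ [c]" "suffix v w"
    then have "v \<in> nodes w" using longest_old_suffix_butlast_node[OF z0] by simp
    then obtain u where u: "u \<in> {1..<n}" "S u = v" using S_surj by blast
    have "sublist (v @ [c]) w" using z0 v(1) by (simp add: longest_old_suffix_def)
    then have le: "len u \<le> len p" using above_p[of u] u v by (meson not_le)
    then have p: "p \<noteq> 0" using len_0 len[OF u(1)] by (cases "p = 0") auto
    have "length (S p) \<le> length v" using max[OF p] suffix_length_le v(1) by force
    moreover have "length v \<le> length (S p)" using le u p p_less by (simp add: len)
    ultimately have "v = S p" using suffix_same_length[of v w "S p"] v(2) p_suffix[OF p] by auto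
    then show ?thesis using p v by (simp add: z_def)
  qed
  with z0 show ?thesis by simp
qed

lemma length_z: "length z = len p"
  using len[of p] len_0 p_less by (auto simp: z_def)

lemma q: "q \<in> {1..<n}" "class_top w z (S q)"
proof -
  have "q \<in> {1..<n} \<and> class_top w z (S q)"
  proof (cases "p = 0")
    case True
    then have "q = 1" "z = []" using delta_0 c unfolding q_def z_def by simp_all
    then show ?thesis using n_gt S_root class_top_refl[of "[]" w] by simp
  next
    case False
    then show ?thesis using delta[of p c] p_suffix c p_less unfolding q_def z_def by simp
  qed
  then show "q \<in> {1..<n}" "class_top w z (S q)" by blast+
qed

lemma suffix_z_S_q: "suffix z (S q)"
  using q(2) by (simp add: class_top_def)

lemma S_q_eq_iff: "S q = z \<longleftrightarrow> len q = Suc (len p)"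
  using suffix_same_length[OF suffix_z_S_q suffix_order.refl] length_z len[OF q(1)] by auto

lemma S_q_node_iff: "z \<in> nodes w \<longleftrightarrow> S q = z"
  using q class_top_unique class_top_refl S_node[OF q(1)] by metis

lemma len_p_less_q: "len p < len q"
  using suffix_length_le[OF suffix_z_S_q] length_z len[OF q(1)] by simp

lemma snoc_fresh: "w @ [c] \<notin> nodes w"
  using snoc_not_sublist[of w c] nodes_sublist[of "w @ [c]" w] by blast

lemma z_neq_snoc: "z \<noteq> w @ [c]"
  using z snoc_not_sublist[of w c] by (auto simp: longest_old_suffix_def)

lemma len_above: assumes "u \<in> {1..<n}" "suffix (S u) w" "\<not> sublist (S u @ [c]) w" shows "len p < len u"
proof (rule ccontr)
  assume "\<not> len p < len u"
  then have le: "len u \<le> len p" by simp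
  then have p: "p \<in> {1..<n}" using len_0 len[OF assms(1)] p_less by (cases "p = 0") auto
  then have "suffix (S u) (S p)" using le suffix_len_le[OF assms(1) p assms(2)] p_suffix by simp
  then have "suffix (S u @ [c]) (S p @ [c])" by simp
  then show False using sublist_suffixD[of "S p @ [c]" w] p_suffix p assms(3) by auto
qed

lemma delta1_old: "u \<in> {1..<n} \<Longrightarrow> sublist (S u @ [a]) w \<Longrightarrow> \<delta>1 u a = \<delta> u a"
  using above_p[of u] by (auto simp: \<delta>1_def)

lemma delta1_new: "u \<in> {1..<n} \<Longrightarrow> \<not> sublist (S u @ [a]) w \<Longrightarrow> suffix (S u @ [a]) (w @ [c]) \<Longrightarrow> \<delta>1 u a = n"
  using len_above[of u] by (auto simp: \<delta>1_def)

lemma delta1_undef: "u \<in> {1..<n} \<Longrightarrow> a < A \<Longrightarrow> \<not> sublist (S u @ [a]) (w @ [c]) \<Longrightarrow> \<delta>1 u a = 0"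
  using delta_undef[of u a] by (auto simp: \<delta>1_def sublist_snoc_iff)

lemma p_le_lnk_lst: "p \<noteq> 0 \<Longrightarrow> lnk lst \<in> {1..<n} \<and> suffix (S p) (S (lnk lst))" "len p \<le> len (lnk lst)"
proof -
  have *: "lnk lst \<in> {1..<n} \<and> suffix (S p) (S (lnk lst))" "len p \<le> len (lnk lst)" if "p \<noteq> 0"
  proof -
    have "p \<noteq> lst" using p_suffix[OF that] S_lst snoc_not_sublist[of w c] by auto
    then show "lnk lst \<in> {1..<n} \<and> suffix (S p) (S (lnk lst))" "len p \<le> len (lnk lst)"
      using strict_suffix_lnk[of p lst] p_suffix[OF that] S_lst lst that p_less by auto
  qed
  then show "p \<noteq> 0 \<Longrightarrow> lnk lst \<in> {1..<n} \<and> suffix (S p) (S (lnk lst))" by blast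
  show "len p \<le> len (lnk lst)" using * len_0 by (cases "p = 0") auto
qed

lemma len_lnk_q_obtain:
  obtains "len (lnk q) \<le> 1" | u where "u \<in> {1..<n}" "suffix (S u) (S p)" "u \<noteq> p" "p \<noteq> 0"
    "len (lnk q) = Suc (len u)" "S (lnk q) = S u @ [c]" "lnk q \<in> {1..<n}"
proof (cases "lnk q = 0 \<or> S (lnk q) = []")
  case True
  then have "len (lnk q) \<le> 1" using len_0 len[of "lnk q"] lnk_less[of q] q(1) by (cases "lnk q = 0") auto
  then show ?thesis using that(1) by blast
next
  case False
  then have y: "lnk q \<in> {1..<n}" "parent w (S q) (S (lnk q))" using lnk_pos[OF q(1)] by auto
  have yn: "S (lnk q) \<in> nodes w" "strict_suffix (S (lnk q)) (S q)" using y(2) by (auto simp: parent_def)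
  have yz: "strict_suffix (S (lnk q)) z"
    using strict_suffix_split_node[OF z q(2) _ yn] yn S_q_node_iff by (cases "S q = z") auto
  then have "z \<noteq> []" by (auto simp: strict_suffix_def)
  then have p: "p \<noteq> 0" by (metis z_def)
  then have "suffix (S (lnk q)) (S p @ [c])" using yz by (auto simp: z_def strict_suffix_def)
  then obtain v where v: "S (lnk q) = v @ [c]" "suffix v (S p)" using False by auto
  then have "v \<in> nodes w" using yn nodes_prefixD by metis
  then obtain u where u: "u \<in> {1..<n}" "S u = v" using S_surj by blast
  have "u \<noteq> p" using yz v(1) u p by (auto simp: z_def)
  then show ?thesis using that(2)[of u] u v p y(1) by (simp add: len)
qed

lemma len_lnk_q_le: "len (lnk q) \<le> Suc (len (lnk (lnk lst)))"
proof (rule len_lnk_q_obtain)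
  fix u assume u: "u \<in> {1..<n}" "suffix (S u) (S p)" "u \<noteq> p" "p \<noteq> 0" "len (lnk q) = Suc (len u)"
  have p: "p \<in> {1..<n}" using u p_less by auto
  have "len u \<le> len (lnk p)" using strict_suffix_lnk(3)[OF u(1) p u(2,3)] .
  also have "\<dots> \<le> len (lnk (lnk lst))" using len_lnk_mono[OF p, of "lnk lst"] p_le_lnk_lst(1) u(4) by blast
  finally show ?thesis using u(5) by simp
qed simp

lemma extend_solid:
  assumes eq: "len q = Suc (len p)"
    and S': "\<And>u. u \<in> {1..<n} \<Longrightarrow> S' u = S u" "S' n = w @ [c]"
    and len': "\<And>u. u < n \<Longrightarrow> len' u = len u" "len' n = Suc (len lst)"
    and lnk': "\<And>u. u < n \<Longrightarrow> lnk' u = lnk u" "lnk' n = q"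
    and \<delta>': "\<And>u a. u < n \<Longrightarrow> a < A \<Longrightarrow> \<delta>' u a = \<delta>1 u a" "\<And>a. a < A \<Longrightarrow> \<delta>' n a = 0"
  shows "suffix_automaton A (w @ [c]) (Suc n) n S' lnk' len' \<delta>'"
proof -
  have Sq: "S q = z" and zn: "z \<in> nodes w" using eq S_q_eq_iff S_q_node_iff by auto
  have nodes': "nodes (w @ [c]) = insert (w @ [c]) (nodes w)" using nodes_snoc[OF z] zn by auto
  have below: "u < n \<or> u = n" if "u \<in> {k..<Suc n}" for u k using that by auto
  show ?thesis
  proof
    have "bij_betw S' {1..<n} (nodes w)" using bij bij_betw_cong[of "{1..<n}" S' S] S'(1) by blast
    then have "bij_betw S' ({1..<n} \<union> {n}) (nodes w \<union> {w @ [c]})"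
      by (rule bij_betw_combine) (use S'(2) snoc_fresh in \<open>auto simp: bij_betw_def\<close>)
    moreover have "{1..<n} \<union> {n} = {1..<Suc n}" using n_gt by auto
    ultimately show "bij_betw S' {1..<Suc n} (nodes (w @ [c]))" by (simp add: nodes')
    show "len' u = Suc (length (S' u))" if "u \<in> {1..<Suc n}" for u
      using below[OF that] that len' S' len[of u] len[OF lst] S_lst by auto
    show "lnk' u \<in> {1..<Suc n} \<and> parent (w @ [c]) (S' u) (S' (lnk' u))" if u: "u \<in> {2..<Suc n}" for u
    proof (cases "u = n")
      case True then show ?thesis using parent_snoc_new[OF z] lnk' S' q Sq by auto
    next
      case False
      then have "lnk u \<in> {1..<n}" "parent w (S u) (S (lnk u))" "u \<in> {1..<n}" using u lnk[of u] by auto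
      then show ?thesis using parent_snoc_keep_node[OF z zn S_node] lnk' S' by auto
    qed
    show "\<delta>' u a \<in> {1..<Suc n} \<and> class_top (w @ [c]) (S' u @ [a]) (S' (\<delta>' u a))"
      if u: "u \<in> {1..<Suc n}" "a < A" and sub: "sublist (S' u @ [a]) (w @ [c])" for u a
    proof (cases "u = n")
      case True then show ?thesis using sub S' sublist_length_le by fastforce
    next
      case False
      then have un: "u \<in> {1..<n}" using u by auto
      show ?thesis
      proof (cases "sublist (S u @ [a]) w")
        case True
        have "\<delta>' u a = \<delta> u a" using delta1_old[OF un True] \<delta>'(1) un u(2) by simp
        moreover have "\<delta> u a \<in> {1..<n}" "class_top (w @ [c]) (S u @ [a]) (S (\<delta> u a))"
          using delta[OF un u(2) True] class_top_snoc_keep_node[OF z zn] by blast+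
        ultimately show ?thesis using S'(1)[OF un] S'(1)[of "\<delta> u a"] by simp
      next
        case nw: False
        then have s: "suffix (S u @ [a]) (w @ [c])" using sub S'(1)[OF un] by (metis sublist_snoc_iff)
        then show ?thesis using delta1_new[OF un nw s] class_top_snoc_new[OF z s nw] un u S' \<delta>' n_gt by auto
      qed
    qed
    show "\<delta>' u a = 0" if u: "u \<in> {1..<Suc n}" "a < A" and sub: "\<not> sublist (S' u @ [a]) (w @ [c])" for u a
    proof (cases "u = n")
      case False
      then have "u \<in> {1..<n}" using u by auto
      then show ?thesis using delta1_undef[of u a] sub S'(1)[of u] \<delta>'(1)[of u a] u(2) by simp
    qed (use \<delta>'(2) u(2) in simp)
    show "\<delta>' 0 a = 1" if "a < A" for a using that \<delta>'(1)[of 0 a] n_gt delta_0 by (simp add: \<delta>1_def)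
    show "1 < Suc n" "n \<in> {1..<Suc n}" "S' n = w @ [c]" using n_gt S'(2) by auto
    show "S' 1 = []" using S'(1)[of 1] n_gt S_root by simp
    show "len' 0 = 0" "lnk' 0 = 0" "lnk' 1 = 0"
      using len'(1)[of 0] lnk'(1)[of 0] lnk'(1)[of 1] n_gt len_0 lnk_0 lnk_root by simp_all
  qed
qed

end

locale suffix_automaton_split = suffix_automaton_extend +
  fixes p2 :: nat
  assumes split: "len q \<noteq> Suc (len p)" and p2_less: "p2 < n"
    and p2_suffix: "p2 \<noteq> 0 \<Longrightarrow> suffix (S p2) (S p)" and p2_end: "\<delta> p2 c \<noteq> q"
    and above_p2: "u \<in> {1..<n} \<Longrightarrow> suffix (S u) (S p) \<Longrightarrow> len p2 < len u \<Longrightarrow> \<delta> u c = q"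
begin

definition \<delta>2 where
  "\<delta>2 u a = (if a = c \<and> 1 \<le> u \<and> u < n \<and> suffix (S u) (S p) \<and> len p2 < len u then Suc n else \<delta>1 u a)"

lemma z_not_node: "z \<notin> nodes w"
  using split S_q_eq_iff S_q_node_iff by auto

lemma p_pos: "p \<in> {1..<n}"
proof -
  have "z \<noteq> []" using z_not_node by auto
  then have "p \<noteq> 0" by (metis z_def)
  then show ?thesis using p_less by simp
qed

lemma z_eq: "z = S p @ [c]"
  using p_pos by (simp add: z_def)

lemma q_ge_2: "q \<in> {2..<n}"
proof -
  have "S q \<noteq> []" using suffix_z_S_q z_eq by auto
  then have "q \<noteq> 1" using S_root by auto
  then show ?thesis using q(1) by auto
qed

lemma delta_eq_q_iff:
  assumes "u \<in> {1..<n}" "suffix (S u) (S p)" shows "\<delta> u c = q \<longleftrightarrow> len p2 < len u"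
proof
  assume uq: "\<delta> u c = q"
  show "len p2 < len u"
  proof (rule ccontr)
    assume "\<not> len p2 < len u"
    then have p2: "p2 \<in> {1..<n}" and le: "len u \<le> len p2"
      using len_0 len[OF assms(1)] p2_less by (cases "p2 = 0"; auto)+
    have s2: "suffix (S p2) (S p)" using p2_suffix p2 by simp
    have sub: "sublist (S u @ [c]) w" "sublist (S p2 @ [c]) w"
      using p_suffix p_pos assms(2) s2 sublist_suffixD[of "S p @ [c]" w] by auto
    have "class_top w (S u @ [c]) (S q)" using delta[OF assms(1) c sub(1)] uq by simp
    moreover have "suffix (S u) (S p2)" using le suffix_len_le[OF assms(1) p2 assms(2) s2] by simp
    moreover have "suffix (S p2 @ [c]) (S q)"
    proof (rule suffix_order.trans[OF _ suffix_z_S_q])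
      show "suffix (S p2 @ [c]) z" using s2 z_eq by simp
    qed
    ultimately have "class_top w (S p2 @ [c]) (S q)" using class_top_between[of w "S u @ [c]" "S q" "S p2 @ [c]"] by simp
    then have "S (\<delta> p2 c) = S q" using delta[OF p2 c sub(2)] class_top_unique by blast
    then show False using p2_end S_inj[OF _ q(1)] delta[OF p2 c sub(2)] by blast
  qed
qed (use above_p2 assms in blast)

lemma len_lnk_q_le': "len (lnk q) \<le> Suc (len p2)"
proof (rule len_lnk_q_obtain)
  fix u assume u: "u \<in> {1..<n}" "suffix (S u) (S p)" "len (lnk q) = Suc (len u)"
    "S (lnk q) = S u @ [c]" "lnk q \<in> {1..<n}"
  have sub: "sublist (S u @ [c]) w" using S_node[OF u(5)] u(4) nodes_sublist by auto
  have "class_top w (S u @ [c]) (S (lnk q))" using class_top_refl[OF S_node[OF u(5)]] u(4) by simp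
  then have "\<delta> u c = lnk q" using delta[OF u(1) c sub] class_top_unique S_inj[OF _ u(5)] by metis
  then have "\<delta> u c \<noteq> q" using len_lnk_less[OF q(1)] by auto
  then show ?thesis using delta_eq_q_iff[OF u(1,2)] u(3) by simp
qed simp

lemma extend_split:
  assumes S': "\<And>u. u \<in> {1..<n} \<Longrightarrow> S' u = S u" "S' n = w @ [c]" "S' (Suc n) = z"
    and len': "\<And>u. u < n \<Longrightarrow> len' u = len u" "len' n = Suc (len lst)" "len' (Suc n) = Suc (len p)"
    and lnk': "\<And>u. u < n \<Longrightarrow> u \<noteq> q \<Longrightarrow> lnk' u = lnk u" "lnk' n = Suc n" "lnk' q = Suc n" "lnk' (Suc n) = lnk q"
    and \<delta>': "\<And>u a. u < n \<Longrightarrow> a < A \<Longrightarrow> \<delta>' u a = \<delta>2 u a" "\<And>a. a < A \<Longrightarrow> \<delta>' n a = 0"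
      "\<And>a. a < A \<Longrightarrow> \<delta>' (Suc n) a = \<delta>1 q a"
  shows "suffix_automaton A (w @ [c]) (Suc (Suc n)) n S' lnk' len' \<delta>'"
proof -
  have below: "u < n \<or> u = n \<or> u = Suc n" if "u \<in> {k..<Suc (Suc n)}" for u k using that by auto
  have qn: "q < n" using q by simp
  show ?thesis
  proof
    have "bij_betw S' {1..<n} (nodes w)" using bij bij_betw_cong[of "{1..<n}" S' S] S'(1) by blast
    then have "bij_betw S' ({1..<n} \<union> {n, Suc n}) (nodes w \<union> {w @ [c], z})"
      by (rule bij_betw_combine)
        (use S'(2,3) snoc_fresh z_not_node z_neq_snoc in \<open>auto simp: bij_betw_def\<close>)
    moreover have "{1..<n} \<union> {n, Suc n} = {1..<Suc (Suc n)}" using n_gt by auto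
    ultimately show "bij_betw S' {1..<Suc (Suc n)} (nodes (w @ [c]))"
      using nodes_snoc[OF z] by (simp add: insert_commute)
    show "len' u = Suc (length (S' u))" if "u \<in> {1..<Suc (Suc n)}" for u
      using below[OF that] that len' S' len[of u] len[OF lst] S_lst length_z by auto
    show "lnk' u \<in> {1..<Suc (Suc n)} \<and> parent (w @ [c]) (S' u) (S' (lnk' u))" if u: "u \<in> {2..<Suc (Suc n)}" for u
    proof -
      have lq: "lnk q \<in> {1..<n}" "parent w (S q) (S (lnk q))" using lnk[OF q_ge_2] by auto
      consider "u = n" | "u = Suc n" | "u = q" | "u \<in> {2..<n}" "u \<noteq> q" using below[OF u] u by fastforce
      then show ?thesis
      proof cases
        case 1 then show ?thesis using parent_snoc_new[OF z] lnk' S' by simp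
      next
        case 2 then show ?thesis using parent_snoc_split_bottom[OF z q(2) z_not_node lq(2)] lq lnk' S' by auto
      next
        case 3 then show ?thesis using parent_snoc_split_top[OF z q(2) z_not_node] q(1) lnk' S' by auto
      next
        case 4
        then have l: "lnk u \<in> {1..<n}" "parent w (S u) (S (lnk u))" "u \<in> {1..<n}" using lnk[of u] by auto
        then have "parent (w @ [c]) (S u) (S (lnk u))"
          using parent_snoc_keep_other[OF z q(2) S_node] 4 S_inj[OF _ q(1)] by blast
        then show ?thesis using l 4 lnk' S' by auto
      qed
    qed
    show "\<delta>' u a \<in> {1..<Suc (Suc n)} \<and> class_top (w @ [c]) (S' u @ [a]) (S' (\<delta>' u a))"
      if u: "u \<in> {1..<Suc (Suc n)}" "a < A" and sub: "sublist (S' u @ [a]) (w @ [c])" for u a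
    proof -
      consider "u = n" | "u = Suc n" | "u \<in> {1..<n}" using below[OF u(1)] u by fastforce
      then show ?thesis
      proof cases
        case 1 then show ?thesis using sub S' sublist_length_le by fastforce
      next
        case 2
        then have za: "sublist (z @ [a]) (w @ [c])" using sub S' by simp
        show ?thesis
        proof (cases "sublist (z @ [a]) w")
          case True
          then have qa: "sublist (S q @ [a]) w" using class_top_append_sublist[OF q(2)] by blast
          have d: "\<delta> q a \<in> {1..<n}" "class_top w (S q @ [a]) (S (\<delta> q a))" using delta[OF q(1) u(2) qa] by auto
          then have "class_top w (z @ [a]) (S (\<delta> q a))" using class_top_append[OF q(2)] by blast
          then have "class_top (w @ [c]) (z @ [a]) (S (\<delta> q a))"
            by (rule class_top_snoc_keep[OF z]) (use suffix_length_le[of "z @ [a]" z] in auto)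
          then show ?thesis using 2 d delta1_old[OF q(1) qa] S' \<delta>' u(2) by auto
        next
          case False
          then have s: "suffix (z @ [a]) (w @ [c])" using za by (metis sublist_snoc_iff)
          then have ac: "a = c" "suffix z w" by auto
          have qa: "\<not> sublist (S q @ [a]) w" using False class_top_append_sublist_iff[OF q(2)] by blast
          have "suffix (S q) w" using q(2) ac(2) by (simp add: class_top_def)
          then have "\<delta>1 q a = n" using delta1_new[OF q(1) qa] ac(1) by simp
          then show ?thesis using 2 class_top_snoc_new[OF z s False] S' \<delta>' u(2) n_gt by auto
        qed
      next
        case 3
        then have un: "u < n" by simp
        show ?thesis
        proof (cases "sublist (S u @ [a]) w")
          case True
          then have d: "\<delta> u a \<in> {1..<n}" "class_top w (S u @ [a]) (S (\<delta> u a))" using delta[OF 3 u(2) True] by auto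
          show ?thesis
          proof (cases "a = c \<and> suffix (S u) (S p) \<and> len p2 < len u")
            case r: True
            then have "\<delta> u a = q" using delta_eq_q_iff[OF 3] by simp
            then have "class_top (w @ [c]) (S u @ [a]) z"
              using class_top_snoc_split[OF z _ q(2)] d r z_eq by simp
            moreover have "\<delta>' u a = Suc n" using r 3 \<delta>'(1)[OF un u(2)] by (simp add: \<delta>2_def)
            ultimately show ?thesis using S' 3 by simp
          next
            case r: False
            have "class_top (w @ [c]) (S u @ [a]) (S (\<delta> u a))"
            proof (cases "a = c \<and> suffix (S u) (S p)")
              case True
              then have "\<delta> u a \<noteq> q" using delta_eq_q_iff[OF 3] r by simp
              then show ?thesis using class_top_snoc_keep_other[OF z q(2) d(2)] S_inj[OF d(1) q(1)] by simp
            next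
              case False
              show ?thesis by (rule class_top_snoc_keep[OF z d(2)]) (use False z_eq in auto)
            qed
            moreover have "\<delta>' u a = \<delta> u a" using r \<delta>'(1)[OF un u(2)] delta1_old[OF 3 True] by (auto simp: \<delta>2_def)
            ultimately show ?thesis using S' 3 d(1) by auto
          qed
        next
          case nw: False
          then have s: "suffix (S u @ [a]) (w @ [c])" using sub S'(1)[OF 3] by (metis sublist_snoc_iff)
          have "\<not> (a = c \<and> suffix (S u) (S p))"
            using nw sublist_suffixD[of "S p @ [c]" w "S u @ [a]"] p_suffix p_pos by auto
          then have "\<delta>' u a = n" using delta1_new[OF 3 nw s] \<delta>'(1)[OF un u(2)] by (auto simp: \<delta>2_def)
          then show ?thesis using class_top_snoc_new[OF z s nw] 3 S' n_gt by auto
        qed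
      qed
    qed
    show "\<delta>' u a = 0" if u: "u \<in> {1..<Suc (Suc n)}" "a < A" and sub: "\<not> sublist (S' u @ [a]) (w @ [c])" for u a
    proof -
      consider "u = n" | "u = Suc n" | "u \<in> {1..<n}" using below[OF u(1)] u by fastforce
      then show ?thesis
      proof cases
        case 1 then show ?thesis using \<delta>' u by simp
      next
        case 2
        then have "\<not> sublist (z @ [a]) (w @ [c])" using sub S' by simp
        then have "\<not> sublist (S q @ [a]) (w @ [c])"
          using sublist_suffixD[of "S q @ [a]" _ "z @ [a]"] suffix_z_S_q by auto
        then show ?thesis using delta1_undef[OF q(1) u(2)] 2 \<delta>' u by simp
      next
        case 3
        then have ns: "\<not> sublist (S u @ [a]) (w @ [c])" using sub S' by simp
        then have "\<not> (a = c \<and> suffix (S u) (S p))"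
          using sublist_suffixD[of "S p @ [c]" w "S u @ [a]"] p_suffix p_pos sublist_snoc_iff[of "S u @ [a]" w c] by auto
        then show ?thesis using delta1_undef[OF 3 u(2) ns] \<delta>'(1)[of u a] 3 u(2) by (auto simp: \<delta>2_def)
      qed
    qed
    show "\<delta>' 0 a = 1" if "a < A" for a using that \<delta>'(1)[of 0 a] n_gt delta_0 by (simp add: \<delta>1_def \<delta>2_def)
    show "1 < Suc (Suc n)" "n \<in> {1..<Suc (Suc n)}" "S' n = w @ [c]" using n_gt S'(2) by auto
    show "S' 1 = []" using S'(1)[of 1] n_gt S_root by simp
    show "len' 0 = 0" "lnk' 0 = 0" "lnk' 1 = 0"
      using len'(1)[of 0] lnk'(1)[of 0] lnk'(1)[of 1] n_gt len_0 lnk_0 lnk_root q_ge_2 by simp_all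
  qed
qed

end

section \<open>Minimal absent words read off the automaton\<close>

context suffix_automaton
begin

definition shortest :: "nat \<Rightarrow> nat list" where "shortest p = drop (length (S p) - len (lnk p)) (S p)"

lemma length_shortest: "p \<in> {1..<n} \<Longrightarrow> length (shortest p) = len (lnk p)"
  using len_lnk_less[of p] len[of p] by (simp add: shortest_def)

lemma suffix_shortest: "suffix (shortest p) (S p)"
  by (simp add: shortest_def suffix_drop)

lemma shortest_root: "shortest 1 = []"
  using S_root by (simp add: shortest_def)

lemma suffix_shortest_if_class_top:
  assumes p: "p \<in> {1..<n}" and v: "class_top w v (S p)" shows "suffix (shortest p) v"
proof (rule ccontr)
  assume n: "\<not> suffix (shortest p) v"
  have vp: "suffix v (S p)" using v by (simp add: class_top_def)
  have "length v < length (shortest p)" using n suffix_shorter[OF suffix_shortest vp] by force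
  then have l: "length v < len (lnk p)" using length_shortest[OF p] by simp
  then have l0: "lnk p \<noteq> 0" using len_0 by (metis not_less0)
  note lp = lnk_pos[OF p l0]
  then have "length v \<le> length (S (lnk p))" using l len[of "lnk p"] by simp
  then have "suffix v (S (lnk p))" using suffix_shorter[OF vp suffix_lnk[OF p l0]] by blast
  then have "suffix (S p) (S (lnk p))" using v S_node[of "lnk p"] lp by (simp add: class_top_def)
  moreover have "strict_suffix (S (lnk p)) (S p)" using lp by (simp add: parent_def)
  ultimately show False using suffix_length_le strict_suffix_length by fastforce
qed

lemma class_top_shortest: assumes p: "p \<in> {1..<n}" shows "class_top w (shortest p) (S p)"
proof -
  have sub: "sublist (shortest p) w" by (rule sublist_suffixD[OF nodes_sublist[OF S_node[OF p]] suffix_shortest])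
  obtain v where v: "class_top w (shortest p) v" using class_top_exists[OF sub] by blast
  then obtain p' where p': "p' \<in> {1..<n}" "S p' = v" using S_surj[of v] unfolding class_top_def by blast
  have vp: "suffix v (S p)" using v S_node[OF p] suffix_shortest by (simp add: class_top_def)
  show ?thesis
  proof (cases "p' = p")
    case False
    have "len p' \<le> len (lnk p)" using strict_suffix_lnk(3)[OF p'(1) p] vp p' False by auto
    moreover have "length (shortest p) \<le> length v" using v suffix_length_le by (auto simp: class_top_def)
    ultimately show ?thesis using length_shortest[OF p] len[OF p'(1)] p'(2) by simp
  qed (use v p' in simp)
qed

lemma shortest_inj: "p \<in> {1..<n} \<Longrightarrow> q \<in> {1..<n} \<Longrightarrow> shortest p = shortest q \<Longrightarrow> p = q"
  using class_top_shortest[of p] class_top_shortest[of q] class_top_unique[of w "shortest p" "S p" "S q"] S_inj[of p q] by simp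

lemma delta_class_top:
  assumes "p \<in> {1..<n}" "class_top w v (S p)" "a < A" "sublist (v @ [a]) w"
  shows "\<delta> p a \<in> {1..<n}" "class_top w (v @ [a]) (S (\<delta> p a))"
  using delta[OF assms(1,3)] class_top_append_sublist[OF assms(2,4)] class_top_append[OF assms(2)] by auto

lemma delta_class_top_undef:
  assumes "p \<in> {1..<n}" "class_top w v (S p)" "a < A" "\<not> sublist (v @ [a]) w"
  shows "\<delta> p a = 0"
  using delta_undef[OF assms(1,3)] class_top_append_sublist_iff[OF assms(2)] assms(4) by blast

definition occurs_in :: "nat list \<Rightarrow> nat \<Rightarrow> bool" where
  "occurs_in X p \<longleftrightarrow> p \<in> {1..<n} \<and> sublist (shortest p) X"

definition maw_at :: "nat list \<Rightarrow> nat \<Rightarrow> nat \<Rightarrow> bool" where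
  "maw_at X p b \<longleftrightarrow> occurs_in X p \<and> occurs_in X (\<delta> (lnk p) b) \<and> \<not> occurs_in X (\<delta> p b)"

end

locale automaton_block = suffix_automaton +
  fixes \<alpha> X \<beta> :: "nat list" and d :: nat
  assumes w: "w = \<alpha> @ X @ \<beta>" and d: "d \<notin> set X" and \<alpha>: "\<alpha> = [] \<or> last \<alpha> = d"
begin

lemma sublist_block: "sublist u X \<Longrightarrow> sublist u w"
  unfolding w by (metis sublist_appendI sublist_order.order_trans)

lemma sublist_block_notin: "sublist u X \<Longrightarrow> d \<notin> set u"
  using d set_mono_sublist[of u X] by blast

lemma block_extend_left:
  assumes top: "class_top w u v" and u: "sublist u X" and v': "suffix v' v" and dv': "d \<notin> set v'"
  shows "sublist v' X"
proof -
  obtain p r where X: "X = p @ u @ r" using u by (auto simp: sublist_def)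
  have "prefix (\<alpha> @ p @ u) w" unfolding w X by simp
  then have "suffix v (\<alpha> @ p @ u)" using top prefix_in_nodes[of "\<alpha> @ p @ u" w] unfolding class_top_def by (metis append.assoc suffix_append_self)
  then have s: "suffix v' (\<alpha> @ p @ u)" using v' suffix_order.trans by blast
  have "length v' \<le> length (p @ u)"
  proof (rule ccontr)
    assume l: "\<not> length v' \<le> length (p @ u)"
    then have "\<alpha> \<noteq> []" using suffix_length_le[OF s] by auto
    then obtain \<alpha>' where "\<alpha> = \<alpha>' @ [d]" using \<alpha> by (metis append_butlast_last_id)
    then have "suffix (d # p @ u) (\<alpha> @ p @ u)" by simp
    then have "suffix (d # p @ u) v'" using suffix_shorter[OF _ s] l by simp
    then show False using dv' set_mono_suffix by fastforce
  qed
  then have "suffix v' (p @ u)" using suffix_shorter[OF s, of "p @ u"] by simp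
  moreover have "sublist (p @ u) X" unfolding X by (metis append.assoc prefix_imp_sublist prefixI)
  ultimately show ?thesis using sublist_suffixD by blast
qed

lemma sublist_snoc_iff_occurs:
  assumes p: "p \<in> {1..<n}" and v: "class_top w v (S p)" and b: "b < A" "b \<noteq> d" "d \<notin> set v"
  shows "sublist (v @ [b]) X \<longleftrightarrow> occurs_in X (\<delta> p b)"
proof
  assume sub: "sublist (v @ [b]) X"
  note q = delta_class_top[OF p v b(1) sublist_block[OF sub]]
  then have "suffix (shortest (\<delta> p b)) (v @ [b])" using suffix_shortest_if_class_top by blast
  then show "occurs_in X (\<delta> p b)" using sub q(1) sublist_suffixD unfolding occurs_in_def by blast
next
  assume oc: "occurs_in X (\<delta> p b)"
  then have q: "\<delta> p b \<in> {1..<n}" "sublist (shortest (\<delta> p b)) X" by (auto simp: occurs_in_def)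
  have sub: "sublist (v @ [b]) w" using delta_class_top_undef[OF p v b(1)] q(1) by force
  have "suffix (v @ [b]) (S (\<delta> p b))" using delta_class_top[OF p v b(1) sub] by (simp add: class_top_def)
  then show "sublist (v @ [b]) X" using block_extend_left[OF class_top_shortest[OF q(1)] q(2)] b by auto
qed

lemma maw_at_iff:
  assumes p: "p \<in> {2..<n}" and b: "b < A" "b \<noteq> d"
  shows "maw_at X p b \<longleftrightarrow> sublist (shortest p) X \<and> sublist (S (lnk p) @ [b]) X \<and> \<not> sublist (shortest p @ [b]) X"
proof (cases "sublist (shortest p) X")
  case True
  have p1: "p \<in> {1..<n}" and l: "lnk p \<in> {1..<n}" "parent w (S p) (S (lnk p))" using p lnk[OF p] by auto
  have dn: "d \<notin> set (shortest p)" using sublist_block_notin[OF True] .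
  have "suffix (S (lnk p)) (shortest p)"
    using suffix_shorter[OF _ suffix_shortest, of "S (lnk p)" p] l length_shortest[OF p1] len[OF l(1)]
    by (auto simp: parent_def strict_suffix_def)
  then have "d \<notin> set (S (lnk p))" using dn set_mono_suffix by blast
  then show ?thesis
    using sublist_snoc_iff_occurs[OF p1 class_top_shortest[OF p1] b dn]
      sublist_snoc_iff_occurs[OF l(1) class_top_refl[OF S_node[OF l(1)]] b] True p1
    by (auto simp: maw_at_def occurs_in_def)
qed (simp add: maw_at_def occurs_in_def)

lemma shortest_eq_Cons:
  assumes p: "p \<in> {2..<n}" shows "\<exists>a. shortest p = a # S (lnk p)"
proof -
  have p1: "p \<in> {1..<n}" and l: "lnk p \<in> {1..<n}" "parent w (S p) (S (lnk p))" using p lnk[OF p] by auto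
  have "suffix (S (lnk p)) (shortest p)"
    using suffix_shorter[OF _ suffix_shortest, of "S (lnk p)" p] l length_shortest[OF p1] len[OF l(1)]
    by (auto simp: parent_def strict_suffix_def)
  then obtain z where z: "shortest p = z @ S (lnk p)" by (auto simp: suffix_def)
  then have "length z = 1" using length_shortest[OF p1] len[OF l(1)] by simp
  then show ?thesis using z by (auto simp: length_Suc_conv)
qed

lemma maws_block:
  assumes letters: "set X \<subseteq> {..<A}"
  shows "{a # u @ [b] | a u b. sublist (a # u) X \<and> sublist (u @ [b]) X \<and> \<not> sublist (a # u @ [b]) X}
    = (\<lambda>(p, b). shortest p @ [b]) ` {(p, b). p \<in> {2..<n} \<and> b < A \<and> b \<noteq> d \<and> maw_at X p b}"
proof (intro equalityI subsetI)
  fix v assume "v \<in> {a # u @ [b] | a u b. sublist (a # u) X \<and> sublist (u @ [b]) X \<and> \<not> sublist (a # u @ [b]) X}"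
  then obtain a u b where v: "v = a # u @ [b]" "sublist (a # u) X" "sublist (u @ [b]) X" "\<not> sublist (a # u @ [b]) X"
    by blast
  have b: "b < A" "b \<noteq> d" using letters set_mono_sublist[OF v(3)] d by auto
  obtain s where s: "prefix (s @ u @ [b]) X" using sublist_obtain_prefix[OF v(3)] .
  then have pre: "prefix (\<alpha> @ s @ u @ [b]) w" unfolding w by (auto simp: prefix_def)
  have au: "sublist (a # u) w" using sublist_block[OF v(2)] .
  have u: "u \<in> nodes w"
  proof (cases "\<alpha> @ s" rule: rev_cases)
    case Nil
    then have "prefix u w" using pre by (auto dest: append_prefixD)
    then show ?thesis by (rule prefix_in_nodes)
  next
    case (snoc y e)
    have "prefix (y @ e # u @ [b]) w" using pre snoc by (metis append.assoc append_Cons append_Nil)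
    then have eub: "sublist (e # u @ [b]) w" by (meson prefix_imp_sublist sublist_suffixD suffixI)
    have eu: "sublist (e # u) w" using sublist_prefixD[OF eub] by simp
    have "e \<noteq> a"
    proof (cases s rule: rev_cases)
      case Nil
      then have "e = d" using snoc \<alpha> by auto
      then show ?thesis using sublist_block_notin[OF v(2)] by auto
    next
      case (snoc s' e')
      then have "e' = e" using \<open>\<alpha> @ s = y @ [e]\<close> by simp
      then have "prefix (s' @ e # u @ [b]) X" using s snoc by simp
      then have "sublist (e # u @ [b]) X" by (meson prefix_imp_sublist sublist_suffixD suffixI)
      then show ?thesis using v(4) by auto
    qed
    then show ?thesis using eu au sublist_suffixD[OF au, of u] unfolding nodes_def by (auto simp: suffix_ConsI)
  qed
  obtain t where t: "class_top w (a # u) t" using class_top_exists[OF au] by blast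
  then obtain p where p: "p \<in> {1..<n}" "S p = t" using S_surj[of t] unfolding class_top_def by blast
  obtain pu where pu: "pu \<in> {1..<n}" "S pu = u" using S_surj[OF u] by blast
  have aup: "suffix (a # u) (S p)" using t p by (simp add: class_top_def)
  then have up: "suffix u (S p)" by (rule suffix_ConsD)
  have "pu \<noteq> p" using aup pu suffix_length_le by force
  note l = strict_suffix_lnk[OF pu(1) p(1) _ this]
  have p2: "p \<in> {2..<n}" using l(1) up pu lnk_pos[OF p(1)] by auto
  have ul: "suffix u (S (lnk p))" "lnk p \<in> {1..<n}" using l up pu by auto
  have shu: "suffix (shortest p) (a # u)" using suffix_shortest_if_class_top[OF p(1)] t p by blast
  have "length u \<le> length (S (lnk p))" using suffix_length_le[OF ul(1)] .
  moreover have "length (shortest p) = Suc (length (S (lnk p)))" using length_shortest[OF p(1)] len[OF ul(2)] by simp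
  moreover have "length (shortest p) \<le> Suc (length u)" using suffix_length_le[OF shu] by simp
  ultimately have len: "length (shortest p) = length (a # u)" "length (S (lnk p)) = length u" by auto
  have shortest: "shortest p = a # u" using suffix_same_length[OF shu suffix_order.refl len(1)] .
  have lu: "S (lnk p) = u" using suffix_same_length[OF ul(1) suffix_order.refl] len(2) by simp
  have "maw_at X p b" using maw_at_iff[OF p2 b] v shortest lu by simp
  then show "v \<in> (\<lambda>(p, b). shortest p @ [b]) ` {(p, b). p \<in> {2..<n} \<and> b < A \<and> b \<noteq> d \<and> maw_at X p b}"
    using v(1) shortest p2 b by (auto intro!: image_eqI[of _ _ "(p, b)"])
next
  fix v assume "v \<in> (\<lambda>(p, b). shortest p @ [b]) ` {(p, b). p \<in> {2..<n} \<and> b < A \<and> b \<noteq> d \<and> maw_at X p b}"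
  then obtain p b where v: "v = shortest p @ [b]" "p \<in> {2..<n}" "b < A" "b \<noteq> d" "maw_at X p b" by auto
  obtain a where a: "shortest p = a # S (lnk p)" using shortest_eq_Cons[OF v(2)] by blast
  have "sublist (a # S (lnk p)) X \<and> sublist (S (lnk p) @ [b]) X \<and> \<not> sublist (a # S (lnk p) @ [b]) X"
    using v maw_at_iff[OF v(2-4)] a by simp
  moreover have "v = a # S (lnk p) @ [b]" using v(1) a by simp
  ultimately show "v \<in> {a # u @ [b] | a u b. sublist (a # u) X \<and> sublist (u @ [b]) X \<and> \<not> sublist (a # u @ [b]) X}"
    by blast
qed

end

lemma circ_factors_iff_sublist:
  assumes "length u \<le> Suc (length x)" shows "u \<in> circ_factors x \<longleftrightarrow> sublist u (x @ x)"
proof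
  assume "sublist u (x @ x)"
  then have "sublist u (concat (replicate 2 x))" by (simp add: numeral_2_eq_2)
  then show "u \<in> circ_factors x" unfolding circ_factors_def by blast
next
  assume "u \<in> circ_factors x"
  then obtain k p s where eq: "concat (replicate k x) = p @ u @ s"
    by (auto simp: circ_factors_def sublist_def)
  then have l: "k * length x = length p + length u + length s"
    using length_concat_replicate[of k x] by simp
  show "sublist u (x @ x)"
  proof (cases "x = []")
    case False
    define i where "i = length p mod length x"
    have i: "i < length x" using False by (simp add: i_def)
    have "u = take (length u) (drop i (x @ x))"
    proof (rule nth_equalityI)
      show "length u = length (take (length u) (drop i (x @ x)))" using i assms by simp
      fix j assume j: "j < length u"
      have "u ! j = concat (replicate k x) ! (length p + j)" using j by (simp add: eq nth_append)
      also have "\<dots> = x ! ((length p + j) mod length x)"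
        using nth_concat_replicate[of "length p + j" k x] j l by simp
      also have "(length p + j) mod length x = (i + j) mod length x" by (simp add: i_def mod_add_left_eq)
      also have "x ! ((i + j) mod length x) = (x @ x) ! (i + j)"
        using i j assms by (auto simp: nth_append le_mod_geq)
      also have "\<dots> = take (length u) (drop i (x @ x)) ! j" using i j assms by (simp del: take_append drop_append)
      finally show "u ! j = take (length u) (drop i (x @ x)) ! j" .
    qed
    then show ?thesis by (metis sublist_take sublist_drop sublist_order.order_trans)
  qed (use eq in auto)
qed

lemma circ_maws_eq:
  assumes "set x \<subseteq> \<Sigma>"
  shows "circ_maws \<Sigma> x = {z \<in> {a # u @ [b] | a u b. sublist (a # u) (x @ x) \<and> sublist (u @ [b]) (x @ x) \<and>
    \<not> sublist (a # u @ [b]) (x @ x)}. length z \<le> Suc (length x)}" (is "?L = ?R")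
proof (intro equalityI subsetI)
  fix z assume "z \<in> ?L"
  moreover from this have "length z \<le> Suc (length x)" using circ_maws_length_le by blast
  ultimately obtain a u b where z: "z = a # u @ [b]" "a # u @ [b] \<notin> circ_factors x"
    "a # u \<in> circ_factors x" "u @ [b] \<in> circ_factors x" "length (a # u @ [b]) \<le> Suc (length x)"
    unfolding circ_maws_def minimal_absent_words_def by blast
  then show "z \<in> ?R"
    using circ_factors_iff_sublist[of "a # u" x] circ_factors_iff_sublist[of "u @ [b]" x]
      circ_factors_iff_sublist[of "a # u @ [b]" x] by simp
next
  fix z assume "z \<in> ?R"
  then obtain a u b where z: "z = a # u @ [b]" "sublist (a # u) (x @ x)" "sublist (u @ [b]) (x @ x)"
    "\<not> sublist (a # u @ [b]) (x @ x)" "length z \<le> Suc (length x)" by blast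
  have "set (a # u @ [b]) \<subseteq> \<Sigma>" using set_mono_sublist[OF z(2)] set_mono_sublist[OF z(3)] assms by auto
  then show "z \<in> ?L" unfolding circ_maws_def minimal_absent_words_def
    using z circ_factors_iff_sublist[of "a # u" x] circ_factors_iff_sublist[of "u @ [b]" x]
      circ_factors_iff_sublist[of "a # u @ [b]" x] by auto
qed

lemma circ_factors_map: "circ_factors (map f x) = map f ` circ_factors x"
proof (intro equalityI subsetI)
  have m: "concat (replicate k (map f x)) = map f (concat (replicate k x))" for k
    by (induction k) auto
  fix u assume "u \<in> circ_factors (map f x)"
  then obtain k where "sublist u (map f (concat (replicate k x)))"
    by (auto simp: circ_factors_def m)
  then obtain u' where "sublist u' (concat (replicate k x))" "u = map f u'"
    using sublist_map_rightE by blast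
  then show "u \<in> map f ` circ_factors x" unfolding circ_factors_def by blast
next
  have m: "concat (replicate k (map f x)) = map f (concat (replicate k x))" for k
    by (induction k) auto
  fix u assume "u \<in> map f ` circ_factors x"
  then obtain k u' where "sublist u' (concat (replicate k x))" "u = map f u'" by (auto simp: circ_factors_def)
  then have "sublist u (concat (replicate k (map f x)))" unfolding m by (simp add: map_mono_sublist)
  then show "u \<in> circ_factors (map f x)" unfolding circ_factors_def by blast
qed

lemma circ_maws_map:
  assumes inj: "inj_on f \<Sigma>" and x: "set x \<subseteq> \<Sigma>"
  shows "circ_maws (f ` \<Sigma>) (map f x) = map f ` circ_maws \<Sigma> x"
proof -
  have mem: "map f u \<in> circ_factors (map f x) \<longleftrightarrow> u \<in> circ_factors x" if "set u \<subseteq> \<Sigma>" for u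
  proof
    assume "map f u \<in> circ_factors (map f x)"
    then obtain u' where u': "u' \<in> circ_factors x" "map f u = map f u'" by (auto simp: circ_factors_map)
    then have "set u' \<subseteq> \<Sigma>" using set_circ_factors x by blast
    then have "u = u'" using u'(2) that inj by (meson inj_on_map_eq_map inj_on_subset le_sup_iff)
    then show "u \<in> circ_factors x" using u' by simp
  qed (simp add: circ_factors_map)
  show ?thesis
  proof (intro equalityI subsetI)
    fix z assume "z \<in> circ_maws (f ` \<Sigma>) (map f x)"
    then obtain a u b where z: "z = a # u @ [b]" "a \<in> f ` \<Sigma>" "b \<in> f ` \<Sigma>" "u \<in> lists (f ` \<Sigma>)"
      "a # u @ [b] \<notin> circ_factors (map f x)" "a # u \<in> circ_factors (map f x)" "u @ [b] \<in> circ_factors (map f x)"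
      unfolding circ_maws_def minimal_absent_words_def by blast
    obtain a' b' u' where p: "a = f a'" "b = f b'" "u = map f u'" "a' \<in> \<Sigma>" "b' \<in> \<Sigma>" "set u' \<subseteq> \<Sigma>"
      using z(2-4) by (auto simp: lists_image)
    have "a' # u' @ [b'] \<in> circ_maws \<Sigma> x"
      using z(5-7) p mem[of "a' # u' @ [b']"] mem[of "a' # u'"] mem[of "u' @ [b']"]
      unfolding circ_maws_def minimal_absent_words_def by auto
    then show "z \<in> map f ` circ_maws \<Sigma> x" using z(1) p by (auto intro!: image_eqI[of _ _ "a' # u' @ [b']"])
  next
    fix z assume "z \<in> map f ` circ_maws \<Sigma> x"
    then obtain z' where z': "z = map f z'" "z' \<in> circ_maws \<Sigma> x" by blast
    then obtain a u b where z: "z = map f (a # u @ [b])" "a \<in> \<Sigma>" "b \<in> \<Sigma>" "set u \<subseteq> \<Sigma>"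
      "a # u @ [b] \<notin> circ_factors x" "a # u \<in> circ_factors x" "u @ [b] \<in> circ_factors x"
      unfolding circ_maws_def minimal_absent_words_def lists_eq_set by blast
    then show "z \<in> circ_maws (f ` \<Sigma>) (map f x)"
      using mem[of "a # u @ [b]"] mem[of "a # u"] mem[of "u @ [b]"]
      unfolding circ_maws_def minimal_absent_words_def by (auto simp: lists_image)
  qed
qed

lemma LW_map:
  assumes inj: "inj_on f \<Sigma>" and x: "set x \<subseteq> \<Sigma>" "set y \<subseteq> \<Sigma>"
  shows "LW (circ_maws (f ` \<Sigma>) (map f x)) (circ_maws (f ` \<Sigma>) (map f y)) = LW (circ_maws \<Sigma> x) (circ_maws \<Sigma> y)"
proof -
  have sub: "circ_maws \<Sigma> x \<subseteq> lists \<Sigma>" "circ_maws \<Sigma> y \<subseteq> lists \<Sigma>"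
    using x circ_maws_length_le unfolding lists_eq_set by blast+
  have inj': "inj_on (map f) (lists \<Sigma>)" using inj by (rule inj_on_mapI[OF inj_on_subset]) auto
  have "sym_diff (map f ` circ_maws \<Sigma> x) (map f ` circ_maws \<Sigma> y) = map f ` sym_diff (circ_maws \<Sigma> x) (circ_maws \<Sigma> y)"
    using sub inj' by (simp add: image_Un inj_on_image_set_diff[of _ "lists \<Sigma>"] subset_iff)
  moreover have "inj_on (map f) (sym_diff (circ_maws \<Sigma> x) (circ_maws \<Sigma> y))"
    using sub by (auto intro: inj_on_subset[OF inj'])
  ultimately show ?thesis using circ_maws_map[OF inj x(1)] circ_maws_map[OF inj x(2)]
    by (simp add: LW_def sum.reindex)
qed

lemma (in suffix_automaton) circ_maws_automaton:
  assumes A: "A = Suc \<sigma>" and x: "set x \<subseteq> {..<\<sigma>}" and w: "w = \<alpha> @ (x @ x) @ \<beta>" and \<alpha>: "\<alpha> = [] \<or> last \<alpha> = \<sigma>"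
  shows "circ_maws {..<\<sigma>} x = (\<lambda>(p, b). shortest p @ [b]) `
    {(p, b) \<in> {2..<n} \<times> {..<\<sigma>}. maw_at (x @ x) p b \<and> len (lnk p) \<le> length x}"
proof -
  interpret automaton_block A w n lst S lnk len \<delta> \<alpha> "x @ x" \<beta> \<sigma>
    by unfold_locales (use x w \<alpha> in auto)
  let ?f = "\<lambda>(p, b). shortest p @ [b]"
  let ?D = "{(p, b). p \<in> {2..<n} \<and> b < A \<and> b \<noteq> \<sigma> \<and> maw_at (x @ x) p b}"
  have letters: "set (x @ x) \<subseteq> {..<A}" using x A by auto
  have "circ_maws {..<\<sigma>} x = {z \<in> ?f ` ?D. length z \<le> Suc (length x)}"
    unfolding circ_maws_eq[OF x] maws_block[OF letters] ..
  also have "\<dots> = ?f ` {pb \<in> ?D. length (?f pb) \<le> Suc (length x)}" by blast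
  also have "{pb \<in> ?D. length (?f pb) \<le> Suc (length x)} =
      {(p, b) \<in> {2..<n} \<times> {..<\<sigma>}. maw_at (x @ x) p b \<and> len (lnk p) \<le> length x}"
    using length_shortest A by auto
  finally show ?thesis .
qed

lemma (in suffix_automaton) LW_automaton:
  assumes A: "A = Suc \<sigma>" and x: "set x \<subseteq> {..<\<sigma>}" "set y \<subseteq> {..<\<sigma>}" and w: "w = x @ x @ [\<sigma>] @ y @ y"
  shows "LW (circ_maws {..<\<sigma>} x) (circ_maws {..<\<sigma>} y) = (\<Sum>p\<in>{2..<n}. \<Sum>b<\<sigma>.
    if (maw_at (x @ x) p b \<and> len (lnk p) \<le> length x) \<noteq> (maw_at (y @ y) p b \<and> len (lnk p) \<le> length y)
    then 1 / (of_nat (Suc (len (lnk p))))\<^sup>2 else 0)"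
proof -
  let ?f = "\<lambda>(p, b). shortest p @ [b]" and ?D = "{2..<n} \<times> {..<\<sigma>}"
  let ?c = "\<lambda>x p b. maw_at (x @ x) p b \<and> len (lnk p) \<le> length x"
  have mx: "circ_maws {..<\<sigma>} x = ?f ` {(p, b) \<in> ?D. ?c x p b}"
    by (rule circ_maws_automaton[of _ _ "[]" "[\<sigma>] @ y @ y"]) (use A x w in auto)
  have my: "circ_maws {..<\<sigma>} y = ?f ` {(p, b) \<in> ?D. ?c y p b}"
    by (rule circ_maws_automaton[of _ _ "x @ x @ [\<sigma>]" "[]"]) (use A x w in auto)
  have inj: "inj_on ?f ?D" using shortest_inj by (auto simp: inj_on_def)
  have "sym_diff (?f ` {(p, b) \<in> ?D. ?c x p b}) (?f ` {(p, b) \<in> ?D. ?c y p b}) =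
      ?f ` sym_diff {(p, b) \<in> ?D. ?c x p b} {(p, b) \<in> ?D. ?c y p b}"
    unfolding image_Un by (subst (1 2) inj_on_image_set_diff[OF inj]) auto
  also have "sym_diff {(p, b) \<in> ?D. ?c x p b} {(p, b) \<in> ?D. ?c y p b} = {pb \<in> ?D. ?c x (fst pb) (snd pb) \<noteq> ?c y (fst pb) (snd pb)}"
    by auto
  finally have sd: "sym_diff (circ_maws {..<\<sigma>} x) (circ_maws {..<\<sigma>} y) =
    ?f ` {pb \<in> ?D. ?c x (fst pb) (snd pb) \<noteq> ?c y (fst pb) (snd pb)}" unfolding mx my .
  have "LW (circ_maws {..<\<sigma>} x) (circ_maws {..<\<sigma>} y) =
    (\<Sum>pb\<in>{pb \<in> ?D. ?c x (fst pb) (snd pb) \<noteq> ?c y (fst pb) (snd pb)}. 1 / (of_nat (length (?f pb)))\<^sup>2)"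
    unfolding LW_def sd using inj_on_subset[OF inj] by (subst sum.reindex) (auto simp: o_def)
  also have "\<dots> = (\<Sum>pb\<in>{pb \<in> ?D. ?c x (fst pb) (snd pb) \<noteq> ?c y (fst pb) (snd pb)}. 1 / (of_nat (Suc (len (lnk (fst pb)))))\<^sup>2)"
    by (rule sum.cong) (auto simp: length_shortest)
  also have "\<dots> = (\<Sum>pb\<in>?D. if ?c x (fst pb) (snd pb) \<noteq> ?c y (fst pb) (snd pb) then 1 / (of_nat (Suc (len (lnk (fst pb)))))\<^sup>2 else 0)"
    by (rule sum.inter_filter) simp
  also have "\<dots> = (\<Sum>p\<in>{2..<n}. \<Sum>b<\<sigma>. if ?c x p b \<noteq> ?c y p b then 1 / (of_nat (Suc (len (lnk p))))\<^sup>2 else 0)"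
    unfolding sum.cartesian_product by (simp only: split_def)
  finally show ?thesis .
qed

section \<open>While programs with time credits\<close>

datatype exp = Num nat | Var nat | Add exp exp | Sub exp exp | Mul exp exp | Ld exp

datatype bexp = Lt exp exp | Eq exp exp

type_synonym assertion =
  "(nat \<Rightarrow> nat) \<Rightarrow> (nat \<Rightarrow> nat) \<Rightarrow> (nat \<Rightarrow> rat) \<Rightarrow> nat \<Rightarrow> bool"

datatype com = Asg nat exp | Sto exp exp | QOf nat exp | QOp rat_op nat nat nat
  | Seq com com (infixr \<open>;;\<close> 60) | If bexp com com | While bexp com

fun ev :: "(nat \<Rightarrow> nat) \<Rightarrow> (nat \<Rightarrow> nat) \<Rightarrow> exp \<Rightarrow> nat" where
  "ev V M (Num k) = k"
| "ev V M (Var i) = V i"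
| "ev V M (Add e1 e2) = ev V M e1 + ev V M e2"
| "ev V M (Sub e1 e2) = ev V M e1 - ev V M e2"
| "ev V M (Mul e1 e2) = ev V M e1 * ev V M e2"
| "ev V M (Ld e) = M (ev V M e)"

fun safe :: "nat \<Rightarrow> (nat \<Rightarrow> nat) \<Rightarrow> (nat \<Rightarrow> nat) \<Rightarrow> exp \<Rightarrow> bool" where
  "safe S V M (Num k) \<longleftrightarrow> k < S"
| "safe S V M (Var i) \<longleftrightarrow> i < 32"
| "safe S V M (Add e1 e2) \<longleftrightarrow> safe S V M e1 \<and> safe S V M e2 \<and> ev V M e1 + ev V M e2 < S"
| "safe S V M (Sub e1 e2) \<longleftrightarrow> safe S V M e1 \<and> safe S V M e2 \<and> ev V M e2 \<le> ev V M e1 \<and> ev V M e1 < S"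
| "safe S V M (Mul e1 e2) \<longleftrightarrow> safe S V M e1 \<and> safe S V M e2 \<and> ev V M e1 * ev V M e2 < S"
| "safe S V M (Ld e) \<longleftrightarrow> safe S V M e \<and> ev V M e < S"

fun bval :: "(nat \<Rightarrow> nat) \<Rightarrow> (nat \<Rightarrow> nat) \<Rightarrow> bexp \<Rightarrow> bool" where
  "bval V M (Lt e1 e2) \<longleftrightarrow> ev V M e1 < ev V M e2"
| "bval V M (Eq e1 e2) \<longleftrightarrow> ev V M e1 = ev V M e2"

fun bsafe :: "nat \<Rightarrow> (nat \<Rightarrow> nat) \<Rightarrow> (nat \<Rightarrow> nat) \<Rightarrow> bexp \<Rightarrow> bool" where
  "bsafe S V M (Lt e1 e2) \<longleftrightarrow> safe S V M e1 \<and> safe S V M e2"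
| "bsafe S V M (Eq e1 e2) \<longleftrightarrow> safe S V M e1 \<and> safe S V M e2"

text \<open>Variables live in registers below \<open>32\<close>, temporaries above. A register is copied by
  or-ing it with itself.\<close>

fun asm_exp :: "nat \<Rightarrow> exp \<Rightarrow> instr list" where
  "asm_exp k (Num c) = [Const k c]"
| "asm_exp k (Var i) = [WordOp WOr k i i]"
| "asm_exp k (Add e1 e2) = asm_exp k e1 @ asm_exp (Suc k) e2 @ [WordOp WAdd k k (Suc k)]"
| "asm_exp k (Sub e1 e2) = asm_exp k e1 @ asm_exp (Suc k) e2 @ [WordOp WSub k k (Suc k)]"
| "asm_exp k (Mul e1 e2) = asm_exp k e1 @ asm_exp (Suc k) e2 @ [WordOp WMul k k (Suc k)]"
| "asm_exp k (Ld e) = asm_exp k e @ [Load k k]"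

fun asm_bexp :: "nat \<Rightarrow> bexp \<Rightarrow> instr list" where
  "asm_bexp l (Lt e1 e2) = asm_exp 32 e1 @ asm_exp 33 e2 @ [JumpLess 32 33 l]"
| "asm_bexp l (Eq e1 e2) = asm_exp 32 e1 @ asm_exp 33 e2 @ [JumpEq 32 33 l]"

definition blen :: "bexp \<Rightarrow> nat" where "blen e = length (asm_bexp 0 e)"

lemma length_asm_bexp: "length (asm_bexp l e) = blen e"
  by (cases e) (simp_all add: blen_def)

fun clen :: "com \<Rightarrow> nat" where
  "clen (Asg d e) = length (asm_exp 32 e) + 1"
| "clen (Sto e1 e2) = length (asm_exp 32 e1) + length (asm_exp 33 e2) + 1"
| "clen (QOf d e) = length (asm_exp 32 e) + 1"
| "clen (QOp f d i j) = 1"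
| "clen (Seq c1 c2) = clen c1 + clen c2"
| "clen (If e c1 c2) = blen e + clen c2 + 1 + clen c1"
| "clen (While e c) = blen e + 1 + clen c + 1"

fun asm :: "nat \<Rightarrow> com \<Rightarrow> instr list" where
  "asm o1 (Asg d e) = asm_exp 32 e @ [WordOp WOr d 32 32]"
| "asm o1 (Sto e1 e2) = asm_exp 32 e1 @ asm_exp 33 e2 @ [Store 32 33]"
| "asm o1 (QOf d e) = asm_exp 32 e @ [RatOfWord d 32]"
| "asm o1 (QOp f d i j) = [RatOp f d i j]"
| "asm o1 (Seq c1 c2) = asm o1 c1 @ asm (o1 + clen c1) c2"
| "asm o1 (If e c1 c2) =
     asm_bexp (o1 + blen e + clen c2 + 1) e @ asm (o1 + blen e) c2
     @ [Jump (o1 + blen e + clen c2 + 1 + clen c1)] @ asm (o1 + blen e + clen c2 + 1) c1"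
| "asm o1 (While e c) =
     asm_bexp (o1 + blen e + 1) e @ [Jump (o1 + blen e + 1 + clen c + 1)]
     @ asm (o1 + blen e + 1) c @ [Jump o1]"

lemma length_asm: "length (asm o1 c) = clen c"
  by (induction c arbitrary: o1) (simp_all add: length_asm_bexp)

definition code_at :: "program \<Rightarrow> nat \<Rightarrow> instr list \<Rightarrow> bool" where
  "code_at P o1 c \<longleftrightarrow> (\<exists>p r. P = p @ c @ r \<and> length p = o1)"

lemma code_at_append: "code_at P o1 (c1 @ c2) \<Longrightarrow> code_at P o1 c1 \<and> code_at P (o1 + length c1) c2"
  unfolding code_at_def by (metis append.assoc length_append)

lemma code_at_single: "code_at P o1 [i] \<Longrightarrow> o1 < length P \<and> P ! o1 = i"
  by (auto simp: code_at_def)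

lemma code_at_length: "code_at P o1 c \<Longrightarrow> o1 + length c \<le> length P"
  by (auto simp: code_at_def)

definition runs :: "nat \<Rightarrow> nat \<Rightarrow> program \<Rightarrow> ram_state \<Rightarrow> nat \<Rightarrow> ram_state \<Rightarrow> bool" where
  "runs b S P s t s' \<longleftrightarrow> (step b P ^^ t) s = s' \<and> (\<forall>i<t. accessed P ((step b P ^^ i) s) \<subseteq> {..<S})"

lemma runs_trans:
  assumes "runs b S P s t s'" "runs b S P s' u s''" shows "runs b S P s (t + u) s''"
proof -
  have eq: "(step b P ^^ (t + i)) s = (step b P ^^ i) s'" for i
    using assms(1) by (simp add: runs_def funpow_add add.commute[of t])
  have "accessed P ((step b P ^^ i) s) \<subseteq> {..<S}" if "i < t + u" for i
    using assms that eq[of "i - t"] by (cases "i < t") (auto simp: runs_def)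
  then show ?thesis using assms eq[of u] by (simp add: runs_def)
qed

lemma runs_step:
  assumes "code_at P (pc s) [i]" "\<And>d j. i = Load d j \<Longrightarrow> reg s j < S" "\<And>k j. i = Store k j \<Longrightarrow> reg s k < S"
  shows "runs b S P s 1 (exec_instr b i s)"
proof -
  have "\<not> halted P s" "P ! pc s = i" using code_at_single[OF assms(1)] by (auto simp: halted_def)
  then show ?thesis using assms(2,3) by (auto simp: runs_def step_def accessed_def split: instr.split)
qed

locale ram =
  fixes b S :: nat
  assumes S_le: "S \<le> 2 ^ b"
begin

lemma apply_word_op_exact:
  "x + y < S \<Longrightarrow> apply_word_op b WAdd x y = x + y"
  "x * y < S \<Longrightarrow> apply_word_op b WMul x y = x * y"
  "y \<le> x \<Longrightarrow> x < S \<Longrightarrow> apply_word_op b WSub x y = x - y"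
  "apply_word_op b WOr x x = x"
proof -
  show "apply_word_op b WSub x y = x - y" if "y \<le> x" "x < S"
  proof -
    have "x + (2 ^ b - y) = (x - y) + 2 ^ b" using that S_le by simp
    then have "apply_word_op b WSub x y = ((x - y) + 2 ^ b) mod 2 ^ b" by (simp only: apply_word_op.simps)
    then show ?thesis using that S_le by (simp only: mod_add_self2) simp
  qed
qed (use S_le in simp_all)

definition exp_post where
  "exp_post P s k v t s' \<longleftrightarrow> runs b S P s t s' \<and> pc s' = pc s + t \<and> mem s' = mem s \<and>
     qreg s' = qreg s \<and> reg s' k = v \<and> (\<forall>i<k. reg s' i = reg s i)"

lemma asm_binop_correct:
  assumes code: "code_at P (pc s) (asm_exp k e1 @ asm_exp (Suc k) e2 @ [WordOp f k k (Suc k)])"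
    and s: "32 \<le> k" "\<forall>i<32. reg s i = V i" "mem s = M"
    and e1: "\<And>s k. code_at P (pc s) (asm_exp k e1) \<Longrightarrow> 32 \<le> k \<Longrightarrow> \<forall>i<32. reg s i = V i \<Longrightarrow> mem s = M \<Longrightarrow>
      \<exists>s'. exp_post P s k v1 (length (asm_exp k e1)) s'"
    and e2: "\<And>s k. code_at P (pc s) (asm_exp k e2) \<Longrightarrow> 32 \<le> k \<Longrightarrow> \<forall>i<32. reg s i = V i \<Longrightarrow> mem s = M \<Longrightarrow>
      \<exists>s'. exp_post P s k v2 (length (asm_exp k e2)) s'"
    and f: "apply_word_op b f v1 v2 = v"
  shows "\<exists>s'. exp_post P s k v (length (asm_exp k e1) + (length (asm_exp (Suc k) e2) + 1)) s'"
proof -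
  let ?i = "WordOp f k k (Suc k)"
  note c = code_at_append[OF code]
  obtain s1 where s1: "exp_post P s k v1 (length (asm_exp k e1)) s1" using e1[of s k] s c by auto
  have c2: "code_at P (pc s1) (asm_exp (Suc k) e2)" "code_at P (pc s1 + length (asm_exp (Suc k) e2)) [?i]"
    using s1 code_at_append[OF conjunct2[OF c]] by (auto simp: exp_post_def)
  have "\<forall>i<32. reg s1 i = V i" "mem s1 = M" using s1 s by (auto simp: exp_post_def)
  then obtain s2 where s2: "exp_post P s1 (Suc k) v2 (length (asm_exp (Suc k) e2)) s2"
    using e2[of s1 "Suc k"] s c2 by auto
  have 3: "runs b S P s2 1 (exec_instr b ?i s2)"
    using c2 s2 by (intro runs_step) (auto simp: exp_post_def)
  have "runs b S P s (length (asm_exp k e1) + length (asm_exp (Suc k) e2) + 1) (exec_instr b ?i s2)"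
    by (rule runs_trans[OF runs_trans 3]) (use s1 s2 in \<open>auto simp: exp_post_def\<close>)
  then show ?thesis using s1 s2 f
    by (intro exI[of _ "exec_instr b ?i s2"]) (simp add: exp_post_def add.assoc)
qed

lemma asm_exp_correct:
  assumes "code_at P (pc s) (asm_exp k e)" "32 \<le> k" "\<forall>i<32. reg s i = V i" "mem s = M" "safe S V M e"
  shows "\<exists>s'. exp_post P s k (ev V M e) (length (asm_exp k e)) s'"
  using assms
proof (induction e arbitrary: s k)
  case (Num c)
  then show ?case using runs_step[of P s "Const k c" S b] S_le by (auto simp: exp_post_def)
next
  case (Var i)
  then show ?case using runs_step[of P s "WordOp WOr k i i" S b] S_le
    by (auto simp: exp_post_def)
next
  case (Ld e)
  note c = code_at_append[OF Ld.prems(1)[unfolded asm_exp.simps]]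
  obtain s' where s': "exp_post P s k (ev V M e) (length (asm_exp k e)) s'"
    using Ld.IH[of s k] Ld.prems c by auto
  then have "runs b S P s' 1 (exec_instr b (Load k k) s')"
    using c Ld.prems by (intro runs_step) (auto simp: exp_post_def)
  then have "runs b S P s (length (asm_exp k e) + 1) (exec_instr b (Load k k) s')"
    using s' runs_trans unfolding exp_post_def by blast
  then show ?case using s' Ld.prems
    by (intro exI[of _ "exec_instr b (Load k k) s'"]) (simp add: exp_post_def)
next
  case (Add e1 e2)
  then show ?case using asm_binop_correct[of P s k e1 e2 WAdd V M "ev V M e1" "ev V M e2"]
    by (simp add: apply_word_op_exact del: apply_word_op.simps)
next
  case (Sub e1 e2)
  then show ?case using asm_binop_correct[of P s k e1 e2 WSub V M "ev V M e1" "ev V M e2"]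
    by (simp add: apply_word_op_exact del: apply_word_op.simps)
next
  case (Mul e1 e2)
  then show ?case using asm_binop_correct[of P s k e1 e2 WMul V M "ev V M e1" "ev V M e2"]
    by (simp add: apply_word_op_exact del: apply_word_op.simps)
qed

lemma asm_exp_pair_correct:
  assumes "code_at P (pc s) (asm_exp 32 e1 @ asm_exp 33 e2 @ [i])" "\<forall>i<32. reg s i = V i"
    "mem s = M" "safe S V M e1" "safe S V M e2" and t: "t = length (asm_exp 32 e1) + length (asm_exp 33 e2)"
  shows "\<exists>s'. runs b S P s t s' \<and> pc s' = pc s + t \<and> mem s' = mem s \<and> qreg s' = qreg s \<and>
     reg s' 32 = ev V M e1 \<and> reg s' 33 = ev V M e2 \<and> (\<forall>i<32. reg s' i = reg s i) \<and> code_at P (pc s') [i]"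
proof -
  note c = code_at_append[OF assms(1)]
  obtain s1 where s1: "exp_post P s 32 (ev V M e1) (length (asm_exp 32 e1)) s1"
    using asm_exp_correct[of P s 32 e1 V M] assms c by auto
  have c2: "code_at P (pc s1) (asm_exp 33 e2)" "code_at P (pc s1 + length (asm_exp 33 e2)) [i]"
    using s1 code_at_append[OF conjunct2[OF c]] by (auto simp: exp_post_def)
  obtain s2 where s2: "exp_post P s1 33 (ev V M e2) (length (asm_exp 33 e2)) s2"
    using asm_exp_correct[of P s1 33 e2 V M] assms c2 s1 by (auto simp: exp_post_def)
  have "runs b S P s t s2" using s1 s2 runs_trans unfolding t exp_post_def by blast
  then show ?thesis using s1 s2 c2 t by (intro exI[of _ s2]) (auto simp: exp_post_def)
qed

lemma asm_bexp_correct: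
  assumes "code_at P (pc s) (asm_bexp l e)" "\<forall>i<32. reg s i = V i" "mem s = M" "bsafe S V M e"
  shows "\<exists>s'. runs b S P s (blen e) s' \<and> pc s' = (if bval V M e then l else pc s + blen e) \<and>
    mem s' = mem s \<and> qreg s' = qreg s \<and> (\<forall>i<32. reg s' i = reg s i)"
proof -
  obtain e1 e2 i where i: "asm_bexp l e = asm_exp 32 e1 @ asm_exp 33 e2 @ [i]"
      "safe S V M e1" "safe S V M e2" "i = JumpLess 32 33 l \<and> e = Lt e1 e2 \<or> i = JumpEq 32 33 l \<and> e = Eq e1 e2"
    using assms(4) by (cases e) auto
  let ?t = "length (asm_exp 32 e1) + length (asm_exp 33 e2)"
  obtain s' where s': "runs b S P s ?t s'" "pc s' = pc s + ?t" "mem s' = mem s" "qreg s' = qreg s"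
     "reg s' 32 = ev V M e1" "reg s' 33 = ev V M e2" "\<forall>i<32. reg s' i = reg s i" "code_at P (pc s') [i]"
    using asm_exp_pair_correct[of P s e1 e2 i V M ?t] assms i by auto
  have "runs b S P s' 1 (exec_instr b i s')" using s'(8) i(4) by (intro runs_step) auto
  from runs_trans[OF s'(1) this] have "runs b S P s (blen e) (exec_instr b i s')"
    using i(4) by (auto simp: blen_def)
  moreover have "blen e = Suc ?t" using i(4) by (auto simp: blen_def)
  ultimately show ?thesis using i(4) s' by (intro exI[of _ "exec_instr b i s'"]) auto
qed

text \<open>Since the program counter increases except for the
  jump at the end of a loop body, between two such jumps at most \<open>length P\<close> instructions are
  executed; hence only loop iterations have to be paid for.\<close>

definition reaches :: "program \<Rightarrow> ram_state \<Rightarrow> com \<Rightarrow>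
    assertion \<Rightarrow> nat \<Rightarrow> bool" where
  "reaches P s c Q n \<longleftrightarrow> (\<exists>t s' V' n'. runs b S P s t s' \<and> pc s' = pc s + clen c \<and> (\<forall>i<32. reg s' i = V' i) \<and>
     Q V' (mem s') (qreg s') n' \<and> t + Suc (length P) * n' + pc s \<le> Suc (length P) * n + pc s')"

definition wp :: "com \<Rightarrow> assertion \<Rightarrow>
    assertion" where
  "wp c Q V M R n \<longleftrightarrow> (\<forall>P s. code_at P (pc s) (asm (pc s) c) \<longrightarrow> (\<forall>i<32. reg s i = V i) \<longrightarrow>
     mem s = M \<longrightarrow> qreg s = R \<longrightarrow>
     reaches P s c Q n)"

lemma wpI:
  assumes "\<And>P s. code_at P (pc s) (asm (pc s) c) \<Longrightarrow> \<forall>i<32. reg s i = V i \<Longrightarrow> mem s = M \<Longrightarrow> qreg s = R \<Longrightarrow>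
    reaches P s c Q n"
  shows "wp c Q V M R n"
  using assms unfolding wp_def by blast

lemma wpE:
  assumes "wp c Q V M R n" "code_at P (pc s) (asm (pc s) c)" "\<forall>i<32. reg s i = V i" "mem s = M" "qreg s = R"
  obtains t s' V' n' where "runs b S P s t s'" "pc s' = pc s + clen c" "\<forall>i<32. reg s' i = V' i"
        "Q V' (mem s') (qreg s') n'" "t + Suc (length P) * n' + pc s \<le> Suc (length P) * n + pc s'"
  using assms unfolding wp_def reaches_def by blast

lemma wp_mono:
  assumes "wp c Q V M R n" "\<And>V M R n. Q V M R n \<Longrightarrow> Q' V M R n" shows "wp c Q' V M R n"
proof (rule wpI)
  fix P :: program and s :: ram_state
  assume *: "code_at P (pc s) (asm (pc s) c)" "\<forall>i<32. reg s i = V i" "mem s = M" "qreg s = R"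
  show "reaches P s c Q' n" unfolding reaches_def
    by (rule wpE[OF assms(1) *]) (use assms(2) in blast)
qed

lemma wp_Asg:
  assumes "d < 32" "safe S V M e" "Q (V(d := ev V M e)) M R n" shows "wp (Asg d e) Q V M R n"
proof (rule wpI)
  fix P :: program and s :: ram_state assume *: "code_at P (pc s) (asm (pc s) (Asg d e))" "\<forall>i<32. reg s i = V i" "mem s = M" "qreg s = R"
  note c = code_at_append[OF *(1)[unfolded asm.simps]]
  let ?t = "length (asm_exp 32 e)" and ?i = "WordOp WOr d 32 32"
  obtain s' where s': "exp_post P s 32 (ev V M e) ?t s'" using asm_exp_correct[of P s 32 e V M] assms c * by auto
  have "runs b S P s' 1 (exec_instr b ?i s')" using c s' by (intro runs_step) (auto simp: exp_post_def)
  from runs_trans[OF _ this, of s ?t] have "runs b S P s (?t + 1) (exec_instr b ?i s')"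
    using s' by (simp add: exp_post_def)
  then show "reaches P s (Asg d e) Q n" unfolding reaches_def
    using s' * assms by (intro exI[of _ "?t + 1"] exI[of _ "exec_instr b ?i s'"] exI[of _ "V(d := ev V M e)"] exI[of _ n])
      (auto simp: exp_post_def apply_word_op_exact simp del: apply_word_op.simps)
qed

lemma wp_QOf:
  assumes "safe S V M e" "Q V M (R(d := of_nat (ev V M e))) n" shows "wp (QOf d e) Q V M R n"
proof (rule wpI)
  fix P :: program and s :: ram_state assume *: "code_at P (pc s) (asm (pc s) (QOf d e))" "\<forall>i<32. reg s i = V i" "mem s = M" "qreg s = R"
  note c = code_at_append[OF *(1)[unfolded asm.simps]]
  let ?t = "length (asm_exp 32 e)" and ?i = "RatOfWord d 32"
  obtain s' where s': "exp_post P s 32 (ev V M e) ?t s'" using asm_exp_correct[of P s 32 e V M] assms c * by auto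
  have "runs b S P s' 1 (exec_instr b ?i s')" using c s' by (intro runs_step) (auto simp: exp_post_def)
  from runs_trans[OF _ this, of s ?t] have "runs b S P s (?t + 1) (exec_instr b ?i s')"
    using s' by (simp add: exp_post_def)
  then show "reaches P s (QOf d e) Q n" unfolding reaches_def
    using s' * assms by (intro exI[of _ "?t + 1"] exI[of _ "exec_instr b ?i s'"] exI[of _ V] exI[of _ n])
      (auto simp: exp_post_def)
qed

lemma wp_QOp:
  assumes "Q V M (R(d := apply_rat_op f (R i) (R j))) n" shows "wp (QOp f d i j) Q V M R n"
proof (rule wpI)
  fix P :: program and s :: ram_state assume *: "code_at P (pc s) (asm (pc s) (QOp f d i j))" "\<forall>i<32. reg s i = V i" "mem s = M" "qreg s = R"
  let ?i = "RatOp f d i j"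
  have "runs b S P s 1 (exec_instr b ?i s)" using * by (intro runs_step) auto
  then show "reaches P s (QOp f d i j) Q n" unfolding reaches_def
    using * assms by (intro exI[of _ 1] exI[of _ "exec_instr b ?i s"] exI[of _ V] exI[of _ n]) auto
qed

lemma wp_Sto:
  assumes "safe S V M e1" "safe S V M e2" "ev V M e1 < S" "Q V (M(ev V M e1 := ev V M e2)) R n"
  shows "wp (Sto e1 e2) Q V M R n"
proof (rule wpI)
  fix P :: program and s :: ram_state assume *: "code_at P (pc s) (asm (pc s) (Sto e1 e2))" "\<forall>i<32. reg s i = V i" "mem s = M" "qreg s = R"
  let ?t = "length (asm_exp 32 e1) + length (asm_exp 33 e2)" and ?i = "Store 32 33"
  obtain s' where s': "runs b S P s ?t s'" "pc s' = pc s + ?t" "mem s' = mem s" "qreg s' = qreg s"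
     "reg s' 32 = ev V M e1" "reg s' 33 = ev V M e2" "\<forall>i<32. reg s' i = reg s i" "code_at P (pc s') [?i]"
    using asm_exp_pair_correct[of P s e1 e2 ?i V M ?t] assms * by auto
  have "runs b S P s' 1 (exec_instr b ?i s')" using s' assms by (intro runs_step) auto
  from runs_trans[OF s'(1) this] show "reaches P s (Sto e1 e2) Q n" unfolding reaches_def
    using s' * assms by (intro exI[of _ "?t + 1"] exI[of _ "exec_instr b ?i s'"] exI[of _ V] exI[of _ n]) auto
qed

lemma wp_Seq:
  assumes "wp c1 (wp c2 Q) V M R n" shows "wp (c1 ;; c2) Q V M R n"
proof (rule wpI)
  fix P :: program and s :: ram_state assume *: "code_at P (pc s) (asm (pc s) (c1 ;; c2))" "\<forall>i<32. reg s i = V i" "mem s = M" "qreg s = R"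
  note c = code_at_append[OF *(1)[unfolded asm.simps]]
  obtain t1 s1 V1 n1 where 1: "runs b S P s t1 s1" "pc s1 = pc s + clen c1" "\<forall>i<32. reg s1 i = V1 i"
        "wp c2 Q V1 (mem s1) (qreg s1) n1" "t1 + Suc (length P) * n1 + pc s \<le> Suc (length P) * n + pc s1"
    by (rule wpE[OF assms, of P s]) (use c * in auto)
  obtain t2 s2 V2 n2 where 2: "runs b S P s1 t2 s2" "pc s2 = pc s1 + clen c2" "\<forall>i<32. reg s2 i = V2 i"
        "Q V2 (mem s2) (qreg s2) n2" "t2 + Suc (length P) * n2 + pc s1 \<le> Suc (length P) * n1 + pc s2"
    by (rule wpE[OF 1(4), of P s1]) (use c 1 in \<open>auto simp: length_asm\<close>)
  show "reaches P s (c1 ;; c2) Q n" unfolding reaches_def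
    using 1 2 runs_trans[OF 1(1) 2(1)]
    by (intro exI[of _ "t1 + t2"] exI[of _ s2] exI[of _ V2] exI[of _ n2]) auto
qed

lemma wp_If:
  assumes "bsafe S V M e" "bval V M e \<Longrightarrow> wp c1 Q V M R n" "\<not> bval V M e \<Longrightarrow> wp c2 Q V M R n"
  shows "wp (If e c1 c2) Q V M R n"
proof (rule wpI)
  fix P :: program and s :: ram_state assume *: "code_at P (pc s) (asm (pc s) (If e c1 c2))" "\<forall>i<32. reg s i = V i" "mem s = M" "qreg s = R"
  let ?end = "pc s + blen e + clen c2 + 1 + clen c1" and ?l = "pc s + blen e + clen c2 + 1"
  have ca: "code_at P (pc s) (asm_bexp ?l e)" and c: "code_at P (pc s + blen e) (asm (pc s + blen e) c2 @ [Jump ?end] @ asm ?l c1)"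
    using code_at_append[OF *(1)[unfolded asm.simps]] by (auto simp: length_asm_bexp)
  have cb: "code_at P (pc s + blen e) (asm (pc s + blen e) c2)" "code_at P (pc s + blen e + clen c2) ([Jump ?end] @ asm ?l c1)"
    using code_at_append[OF c] by (auto simp: length_asm)
  have cc: "code_at P (pc s + blen e + clen c2) [Jump ?end]" "code_at P ?l (asm ?l c1)"
    using code_at_append[OF cb(2)] by auto
  obtain s1 where 1: "runs b S P s (blen e) s1" "pc s1 = (if bval V M e then ?l else pc s + blen e)"
     "mem s1 = mem s" "qreg s1 = qreg s" "\<forall>i<32. reg s1 i = reg s i"
    using asm_bexp_correct[OF ca *(2,3) assms(1)] by auto
  show "reaches P s (If e c1 c2) Q n"
  proof (cases "bval V M e")
    case True
    obtain t2 s2 V2 n2 where 2: "runs b S P s1 t2 s2" "pc s2 = pc s1 + clen c1" "\<forall>i<32. reg s2 i = V2 i"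
        "Q V2 (mem s2) (qreg s2) n2" "t2 + Suc (length P) * n2 + pc s1 \<le> Suc (length P) * n + pc s2"
      by (rule wpE[OF assms(2)[OF True], of P s1]) (use True cc 1 * in auto)
    show ?thesis unfolding reaches_def using True 1 2 runs_trans[OF 1(1) 2(1)]
      by (intro exI[of _ "blen e + t2"] exI[of _ s2] exI[of _ V2] exI[of _ n2]) auto
  next
    case False
    obtain t2 s2 V2 n2 where 2: "runs b S P s1 t2 s2" "pc s2 = pc s1 + clen c2" "\<forall>i<32. reg s2 i = V2 i"
        "Q V2 (mem s2) (qreg s2) n2" "t2 + Suc (length P) * n2 + pc s1 \<le> Suc (length P) * n + pc s2"
      by (rule wpE[OF assms(3)[OF False], of P s1]) (use False cb 1 * in auto)
    have 3: "runs b S P s2 1 (exec_instr b (Jump ?end) s2)" using 1 2 False cc by (intro runs_step) auto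
    show ?thesis unfolding reaches_def using False 1 2 runs_trans[OF runs_trans[OF 1(1) 2(1)] 3]
      by (intro exI[of _ "blen e + t2 + 1"] exI[of _ "exec_instr b (Jump ?end) s2"] exI[of _ V2] exI[of _ n2]) auto
  qed
qed

lemma wp_While:
  assumes "I V M R n"
    and safe: "\<And>V M R n. I V M R n \<Longrightarrow> bsafe S V M e"
    and body: "\<And>V M R n. I V M R n \<Longrightarrow> bval V M e \<Longrightarrow> 0 < n \<and> wp c I V M R (n - 1)"
    and exit: "\<And>V M R n. I V M R n \<Longrightarrow> \<not> bval V M e \<Longrightarrow> Q V M R n"
  shows "wp (While e c) Q V M R n"
  using assms(1)
proof (induction n arbitrary: V M R rule: less_induct)
  case (less n)
  show ?case
  proof (rule wpI)
    fix P :: program and s :: ram_state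
    assume *: "code_at P (pc s) (asm (pc s) (While e c))" "\<forall>i<32. reg s i = V i" "mem s = M" "qreg s = R"
    let ?end = "pc s + blen e + 1 + clen c + 1" and ?l = "pc s + blen e + 1"
    let ?G = "\<lambda>s n. \<exists>t s' V' n'. runs b S P s t s' \<and> pc s' = ?end \<and> (\<forall>i<32. reg s' i = V' i) \<and>
        Q V' (mem s') (qreg s') n' \<and> t + Suc (length P) * n' + pc s \<le> Suc (length P) * n + pc s'"
    have cb: "code_at P (pc s) (asm_bexp ?l e)" and
      c': "code_at P (pc s + blen e) ([Jump ?end] @ asm ?l c @ [Jump (pc s)])"
      using code_at_append[OF *(1)[unfolded asm.simps]] by (auto simp: length_asm_bexp)
    have cc: "code_at P (pc s + blen e) [Jump ?end]" and c'': "code_at P ?l (asm ?l c @ [Jump (pc s)])"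
      using code_at_append[OF c'] by auto
    have cd: "code_at P ?l (asm ?l c)" "code_at P (?l + clen c) [Jump (pc s)]"
      using code_at_append[OF c''] by (auto simp: length_asm)
    have lP: "?end \<le> length P" using code_at_length[OF cd(2)] by simp
    obtain s2 where 2: "runs b S P s (blen e) s2" "pc s2 = (if bval V M e then ?l else pc s + blen e)"
       "mem s2 = M" "qreg s2 = R" "\<forall>i<32. reg s2 i = V i"
      using asm_bexp_correct[OF cb *(2,3) safe[OF less.prems]] * by auto
    have "?G s n"
    proof (cases "bval V M e")
      case False
      have 3: "runs b S P s2 1 (exec_instr b (Jump ?end) s2)" using 2 False cc by (intro runs_step) auto
      show ?thesis using False 2 runs_trans[OF 2(1) 3] exit[OF less.prems False]
        by (intro exI[of _ "blen e + 1"] exI[of _ "exec_instr b (Jump ?end) s2"] exI[of _ V] exI[of _ n]) auto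
    next
      case True
      then have n1: "0 < n" "wp c I V M R (n - 1)" using body[OF less.prems] by auto
      obtain t3 s3 V3 n3 where 3: "runs b S P s2 t3 s3" "pc s3 = pc s2 + clen c" "\<forall>i<32. reg s3 i = V3 i"
        "I V3 (mem s3) (qreg s3) n3" "t3 + Suc (length P) * n3 + pc s2 \<le> Suc (length P) * (n - 1) + pc s3"
        by (rule wpE[OF n1(2), of P s2]) (use True cd 2 in auto)
      let ?s4 = "exec_instr b (Jump (pc s)) s3"
      have 4: "runs b S P s3 1 ?s4" using 2 3 True cd by (intro runs_step) auto
      have time: "Suc (length P) * n = Suc (length P) * (n - 1) + Suc (length P)"
        using n1(1) by (cases n) auto
      let ?t = "blen e + t3 + 1"
      have bound: "?t + Suc (length P) * n3 + pc s \<le> Suc (length P) * n + pc ?s4"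
        using 2(2) 3(2,5) True time lP by simp
      then have "Suc (length P) * n3 < Suc (length P) * n" by simp
      then have "n3 < n" by (meson mult_less_cancel1)
      from less.IH[OF this 3(4)] have "wp (While e c) Q V3 (mem s3) (qreg s3) n3" .
      then obtain t5 s5 V5 n5 where 5: "runs b S P ?s4 t5 s5" "pc s5 = pc ?s4 + clen (While e c)" "\<forall>i<32. reg s5 i = V5 i"
        "Q V5 (mem s5) (qreg s5) n5" "t5 + Suc (length P) * n5 + pc ?s4 \<le> Suc (length P) * n3 + pc s5"
        by (rule wpE[of _ _ _ _ _ _ P ?s4]) (use * 3 in auto)
      have r5: "runs b S P s (?t + t5) s5" using runs_trans[OF runs_trans[OF runs_trans[OF 2(1) 3(1)] 4] 5(1)] .
      have "pc s5 = ?end" using 5(2) by simp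
      moreover have "?t + t5 + Suc (length P) * n5 + pc s \<le> Suc (length P) * n + pc s5"
        using 5(5) bound by linarith
      ultimately show ?thesis using r5 5(3,4) by blast
    qed
    then show "reaches P s (While e c) Q n" unfolding reaches_def
      by (simp add: add.assoc)
  qed
qed

theorem wp_ram_computes:
  assumes "wp c (\<lambda>V M R n. R 0 = v) (reg s) (mem s) (qreg s) n" "pc s = 0"
  shows "ram_computes b (asm 0 c) s (Suc (clen c) * n + clen c) S v"
proof -
  have "code_at (asm 0 c) (pc s) (asm (pc s) c)" using assms(2) unfolding code_at_def
    by (intro exI[of _ "[]"]) simp
  then obtain t s' n' where "runs b S (asm 0 c) s t s'" "pc s' = pc s + clen c" "qreg s' 0 = v"
      "t + Suc (length (asm 0 c)) * n' + pc s \<le> Suc (length (asm 0 c)) * n + pc s'"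
    by (rule wpE[OF assms(1)]) auto
  then show ?thesis using assms(2) unfolding ram_computes_def runs_def halted_def
    by (intro exI[of _ t]) (auto simp: length_asm)
qed

end

section \<open>The program and its memory layout\<close>

text \<open>
  State \<open>p\<close> is a record of \<open>\<sigma> + 5\<close> cells following the input: the transitions for the letters
  \<open>0, \<dots>, \<sigma>\<close> (the last one being the separator), the suffix link, the shifted length, and two marks telling
  whether the state occurs in \<open>x x\<close> and in \<open>y y\<close>.

  Variables: \<open>0\<close>, \<open>1\<close> lengths of \<open>x\<close> and \<open>y\<close>; \<open>2\<close> address of the records; \<open>3\<close> position in the text;
  \<open>4\<close> letter; \<open>5\<close> last state; \<open>6\<close> number of states; \<open>12\<close> length of the text.
\<close>

definition fld :: "nat \<Rightarrow> exp \<Rightarrow> exp \<Rightarrow> exp" where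
  "fld \<sigma> e f = Ld (Add (Var 2) (Add (Mul (Num (\<sigma> + 5)) e) f))"

definition set_fld :: "nat \<Rightarrow> exp \<Rightarrow> exp \<Rightarrow> exp \<Rightarrow> com" where
  "set_fld \<sigma> e f v = Sto (Add (Var 2) (Add (Mul (Num (\<sigma> + 5)) e) f)) v"

abbreviation "inc i \<equiv> Asg i (Add (Var i) (Num 1))"

definition read_letter :: "nat \<Rightarrow> com" where
  "read_letter \<sigma> =
    If (Lt (Var 3) (Var 0)) (Asg 4 (Ld (Add (Num 2) (Var 3))))
   (If (Lt (Var 3) (Add (Var 0) (Var 0))) (Asg 4 (Ld (Add (Num 2) (Sub (Var 3) (Var 0)))))
   (If (Eq (Var 3) (Add (Var 0) (Var 0))) (Asg 4 (Num \<sigma>))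
   (If (Lt (Var 3) (Add (Var 0) (Add (Var 0) (Add (Num 1) (Var 1)))))
      (Asg 4 (Ld (Add (Num 2) (Sub (Var 3) (Add (Var 0) (Num 1))))))
      (Asg 4 (Ld (Add (Num 2) (Sub (Var 3) (Add (Var 0) (Add (Num 1) (Var 1))))))))))"

definition add_transitions :: "nat \<Rightarrow> com" where
  "add_transitions \<sigma> = While (Eq (fld \<sigma> (Var 7) (Var 4)) (Num 0))
     (set_fld \<sigma> (Var 7) (Var 4) (Var 6) ;; Asg 7 (fld \<sigma> (Var 7) (Num (\<sigma> + 1))))"

definition copy_transitions :: "nat \<Rightarrow> com" where
  "copy_transitions \<sigma> = While (Lt (Var 9) (Num (\<sigma> + 1)))
     (set_fld \<sigma> (Var 11) (Var 9) (fld \<sigma> (Var 8) (Var 9)) ;; inc 9)"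

definition redirect_transitions :: "nat \<Rightarrow> com" where
  "redirect_transitions \<sigma> = While (Eq (fld \<sigma> (Var 7) (Var 4)) (Var 8))
     (set_fld \<sigma> (Var 7) (Var 4) (Var 11) ;; Asg 7 (fld \<sigma> (Var 7) (Num (\<sigma> + 1))))"

definition split_state :: "nat \<Rightarrow> com" where
  "split_state \<sigma> =
     Asg 11 (Add (Var 6) (Num 1)) ;;
     Asg 9 (Num 0) ;;
     copy_transitions \<sigma> ;;
     set_fld \<sigma> (Var 11) (Num (\<sigma> + 2)) (Add (Var 10) (Num 1)) ;;
     set_fld \<sigma> (Var 11) (Num (\<sigma> + 1)) (fld \<sigma> (Var 8) (Num (\<sigma> + 1))) ;;
     set_fld \<sigma> (Var 8) (Num (\<sigma> + 1)) (Var 11) ;;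
     set_fld \<sigma> (Var 6) (Num (\<sigma> + 1)) (Var 11) ;;
     redirect_transitions \<sigma> ;;
     Asg 6 (Add (Var 6) (Num 2))"

definition extend :: "nat \<Rightarrow> com" where
  "extend \<sigma> =
     set_fld \<sigma> (Var 6) (Num (\<sigma> + 2)) (Add (fld \<sigma> (Var 5) (Num (\<sigma> + 2))) (Num 1)) ;;
     Asg 7 (Var 5) ;;
     add_transitions \<sigma> ;;
     Asg 8 (fld \<sigma> (Var 7) (Var 4)) ;;
     Asg 10 (fld \<sigma> (Var 7) (Num (\<sigma> + 2))) ;;
     Asg 5 (Var 6) ;;
     If (Eq (fld \<sigma> (Var 8) (Num (\<sigma> + 2))) (Add (Var 10) (Num 1)))
       (set_fld \<sigma> (Var 6) (Num (\<sigma> + 1)) (Var 8) ;; inc 6)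
       (split_state \<sigma>)"

locale lw_program = ram +
  fixes \<sigma> :: nat and x y :: "nat list"
  assumes letters: "set x \<subseteq> {..<\<sigma>}" "set y \<subseteq> {..<\<sigma>}"
    and S_ge: "2 + length x + length y + (\<sigma> + 5) * (2 + 2 * (2 * length x + 2 * length y + 1)) \<le> S"
begin

definition base where "base = 2 + length x + length y"
definition word where "word = x @ x @ [\<sigma>] @ y @ y"
definition max_states where "max_states = 2 + 2 * length word"

lemma length_word: "length word = 2 * length x + 2 * length y + 1"
  by (simp add: word_def)

lemma S_bound: "base + (\<sigma> + 5) * max_states \<le> S"
  using S_ge by (simp add: base_def max_states_def length_word)

lemma small: "k < max_states \<Longrightarrow> k < S" "k \<le> max_states \<Longrightarrow> Suc k < S" "k \<le> \<sigma> + 5 \<Longrightarrow> k < S"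
  "k \<le> base \<Longrightarrow> k < S" "k \<le> length word \<Longrightarrow> k < S"
proof -
  have m: "max_states \<ge> 2" "length word \<le> max_states" by (simp_all add: max_states_def)
  have "(\<sigma> + 5) * max_states \<ge> 5 * max_states" "(\<sigma> + 5) * max_states \<ge> (\<sigma> + 5) * 2"
    using m by (simp_all only: mult_le_mono1 mult_le_mono2)
  moreover have "(\<sigma> + 5) * 2 = 2 * \<sigma> + 10" by simp
  ultimately have *: "base + 5 * max_states \<le> S" "2 * \<sigma> + 10 \<le> S" using S_bound by linarith+
  have "base \<ge> 2" by (simp add: base_def)
  then show "k < max_states \<Longrightarrow> k < S" "k \<le> max_states \<Longrightarrow> Suc k < S" "k \<le> \<sigma> + 5 \<Longrightarrow> k < S"
    "k \<le> base \<Longrightarrow> k < S" "k \<le> length word \<Longrightarrow> k < S"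
    using * m by simp_all
qed

definition hp :: "(nat \<Rightarrow> nat) \<Rightarrow> nat \<Rightarrow> nat \<Rightarrow> nat" where
  "hp M p f = M (base + ((\<sigma> + 5) * p + f))"

abbreviation "slink M p \<equiv> hp M p (\<sigma> + 1)"
abbreviation "slen M p \<equiv> hp M p (\<sigma> + 2)"

definition hupd :: "(nat \<Rightarrow> nat) \<Rightarrow> nat \<Rightarrow> nat \<Rightarrow> nat \<Rightarrow> nat \<Rightarrow> nat" where
  "hupd M p f v = M(base + ((\<sigma> + 5) * p + f) := v)"

lemma address_eq_iff:
  assumes "f < \<sigma> + 5" "f' < \<sigma> + 5"
  shows "(\<sigma> + 5) * p + f = (\<sigma> + 5) * p' + f' \<longleftrightarrow> p = p' \<and> f = f'"
proof
  assume eq: "(\<sigma> + 5) * p + f = (\<sigma> + 5) * p' + f'"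
  have "((\<sigma> + 5) * p + f) div (\<sigma> + 5) = p" "((\<sigma> + 5) * p' + f') div (\<sigma> + 5) = p'"
    using assms by (simp_all only: div_mult_self4[of "\<sigma> + 5"]) auto
  then have "p = p'" using eq by simp
  with eq show "p = p' \<and> f = f'" by simp
qed simp

lemma hp_hupd: "f < \<sigma> + 5 \<Longrightarrow> f' < \<sigma> + 5 \<Longrightarrow> hp (hupd M p f v) p' f' = (if p' = p \<and> f' = f then v else hp M p' f')"
  using address_eq_iff[of f' f p' p] by (simp add: hp_def hupd_def)

lemma hupd_below: "i < base \<Longrightarrow> hupd M p f v i = M i"
  by (simp add: hupd_def)

lemma address_less: "p < max_states \<Longrightarrow> f < \<sigma> + 5 \<Longrightarrow> base + ((\<sigma> + 5) * p + f) < S"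
proof -
  assume "p < max_states" "f < \<sigma> + 5"
  then have "(\<sigma> + 5) * Suc p \<le> (\<sigma> + 5) * max_states" by (intro mult_le_mono2) simp
  then show ?thesis using S_bound \<open>f < \<sigma> + 5\<close> by simp
qed

lemma ev_fld: "V 2 = base \<Longrightarrow> ev V M (fld \<sigma> e f) = hp M (ev V M e) (ev V M f)"
  by (simp add: fld_def hp_def)

lemma safe_fld:
  assumes "V 2 = base" "safe S V M e" "safe S V M f" "ev V M e < max_states" "ev V M f < \<sigma> + 5"
  shows "safe S V M (fld \<sigma> e f)"
  using assms address_less[OF assms(4,5)] small(3)[of "\<sigma> + 5"] by (simp add: fld_def)

lemma wp_set_fld:
  assumes "V 2 = base" "safe S V M e" "safe S V M f" "safe S V M v" "ev V M e < max_states" "ev V M f < \<sigma> + 5"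
    "Q V (hupd M (ev V M e) (ev V M f) (ev V M v)) R k"
  shows "wp (set_fld \<sigma> e f v) Q V M R k"
  unfolding set_fld_def
  by (rule wp_Sto) (use assms address_less[OF assms(5,6)] small(3)[of "\<sigma> + 5"] in \<open>simp_all add: hupd_def\<close>)

definition input_ok where
  "input_ok V M \<longleftrightarrow> V 0 = length x \<and> V 1 = length y \<and> V 2 = base \<and> (\<forall>i<length x + length y. M (2 + i) = (x @ y) ! i)"

lemma wp_read_letter:
  assumes ok: "input_ok V M" and i: "V 3 < length word" and Q: "Q (V(4 := word ! V 3)) M R k"
  shows "wp (read_letter \<sigma>) Q V M R k"
proof -
  have V: "V 0 = length x" "V 1 = length y" and M: "\<And>i. i < length x + length y \<Longrightarrow> M (Suc (Suc i)) = (x @ y) ! i"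
    using ok by (simp_all add: input_ok_def)
  have sm: "Suc (Suc (length x + length y)) < S" "\<sigma> < S" "Suc (length x + (length x + length y)) < S" "V 3 < S"
    using small(4)[of base] small(3)[of \<sigma>] small(5)[of "length word"] i small(5)[of "V 3"] 
    by (simp_all add: base_def length_word)
  have lt: "V 3 < 2 * length x + 2 * length y + 1" using i by (simp add: length_word)
  show ?thesis unfolding read_letter_def
    by (intro wp_If wp_Asg) (use Q V M sm lt in \<open>auto simp: word_def nth_append ac_simps split: if_splits\<close>)
qed

abbreviation aut where
  "aut M u n lst T \<equiv> suffix_automaton (Suc \<sigma>) u n lst T (slink M) (slen M) (hp M)"

abbreviation "aut_extend M u n lst T \<equiv> suffix_automaton_extend (Suc \<sigma>) u n lst T (slink M) (slen M) (hp M)"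
abbreviation "aut_split M u n lst T \<equiv> suffix_automaton_split (Suc \<sigma>) u n lst T (slink M) (slen M) (hp M)"

lemma aut_cong:
  assumes "aut M u n lst T" "\<And>p f. p < n \<Longrightarrow> f < \<sigma> + 3 \<Longrightarrow> hp M' p f = hp M p f"
  shows "aut M' u n lst T"
proof -
  interpret suffix_automaton "Suc \<sigma>" u n lst T "slink M" "slen M" "hp M" by fact
  have eq: "slink M' p = slink M p" "slen M' p = slen M p"
    "a < Suc \<sigma> \<Longrightarrow> hp M' p a = hp M p a" if "p < n" for p a
    using that by (simp_all add: assms(2))
  show ?thesis
  proof
    show "bij_betw T {1..<n} (nodes u)" "1 < n" "T 1 = []" "lst \<in> {1..<n}" "T lst = u"
      by (fact bij n_gt S_root lst S_lst)+
    show "slen M' p = Suc (length (T p))" if "p \<in> {1..<n}" for p using len[OF that] eq(2)[of p] that by simp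
    show "slen M' 0 = 0" "slink M' 0 = 0" "slink M' 1 = 0"
      using eq(1)[of 0] eq(2)[of 0] eq(1)[of 1] n_gt len_0 lnk_0 lnk_root by simp_all
    show "slink M' p \<in> {1..<n} \<and> parent u (T p) (T (slink M' p))" if "p \<in> {2..<n}" for p
      using lnk[OF that] eq(1)[of p] that by simp
    show "hp M' 0 a = 1" if "a < Suc \<sigma>" for a using delta_0[OF that] eq(3)[of 0 a] that n_gt by simp
    show "hp M' p a \<in> {1..<n} \<and> class_top u (T p @ [a]) (T (hp M' p a))"
      if "p \<in> {1..<n}" "a < Suc \<sigma>" "sublist (T p @ [a]) u" for p a
      using delta[OF that] eq(3)[of p a] that by simp
    show "hp M' p a = 0" if "p \<in> {1..<n}" "a < Suc \<sigma>" "\<not> sublist (T p @ [a]) u" for p a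
      using delta_undef[OF that] eq(3)[of p a] that by simp
  qed
qed

lemma wp_add_transitions:
  assumes aut: "aut M u n lst T" and c: "c < Suc \<sigma>" and n: "n < max_states"
    and V: "V 2 = base" "V 4 = c" "V 6 = n" "V 7 = lst"
    and k: "X + Suc (slen M (slink M lst)) \<le> k"
  shows "wp (add_transitions \<sigma>) (\<lambda>V' M' R' k'. \<exists>p. V' = V(7 := p) \<and>
      aut_extend M u n lst T c p \<and>
      (\<forall>v f. f < \<sigma> + 5 \<longrightarrow> hp M' v f = (if f = c \<and> 1 \<le> v \<and> v < n \<and> suffix (T v) u \<and>
         slen M p < slen M v then n else hp M v f)) \<and>
      (\<forall>i<base. M' i = M i) \<and> R' = R \<and> X + slen M p \<le> k') V M R k"
proof -
  interpret suffix_automaton "Suc \<sigma>" u n lst T "slink M" "slen M" "hp M" by fact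
  let ?len = "slen M" and ?lnk = "slink M"
  define I where "I = (\<lambda>V' M' R' k'. \<exists>p. V' = V(7 := p) \<and> p < n \<and> (p \<noteq> 0 \<longrightarrow> suffix (T p) u) \<and>
    (\<forall>v. v \<in> {1..<n} \<longrightarrow> suffix (T v) u \<longrightarrow> ?len p < ?len v \<longrightarrow> \<not> sublist (T v @ [c]) u) \<and>
    (\<forall>v f. f < \<sigma> + 5 \<longrightarrow> hp M' v f = (if f = c \<and> 1 \<le> v \<and> v < n \<and> suffix (T v) u \<and> ?len p < ?len v then n else hp M v f)) \<and>
    (\<forall>i<base. M' i = M i) \<and> R' = R \<and> X + min (?len p) (Suc (?len (?lnk lst))) \<le> k')"
  show ?thesis
    unfolding add_transitions_def
  proof (rule wp_While[where I = I])
    have "\<not> ?len lst < ?len v" if "v \<in> {1..<n}" "suffix (T v) u" for v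
      using suffix_len_le[OF that(1) lst that(2)] S_lst that(2) by simp
    then show "I V M R k" unfolding I_def using V k lst S_lst
      by (intro exI[of _ lst]) (auto simp: fun_upd_idem)
  next
    fix V' M' R' k' assume "I V' M' R' k'"
    then obtain p where V': "V' = V(7 := p)" and p: "p < n" "p \<noteq> 0 \<longrightarrow> suffix (T p) u"
      and above: "\<forall>v. v \<in> {1..<n} \<longrightarrow> suffix (T v) u \<longrightarrow> ?len p < ?len v \<longrightarrow> \<not> sublist (T v @ [c]) u"
      and M': "\<And>v f. f < \<sigma> + 5 \<Longrightarrow> hp M' v f = (if f = c \<and> 1 \<le> v \<and> v < n \<and> suffix (T v) u \<and> ?len p < ?len v then n else hp M v f)"
      and rest: "\<forall>i<base. M' i = M i" "R' = R" "X + min (?len p) (Suc (?len (?lnk lst))) \<le> k'"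
      unfolding I_def by blast
    have V'_simps: "V' 2 = base" "V' 4 = c" "V' 6 = n" "V' 7 = p" using V V' by simp_all
    have safe: "safe S V' M' (fld \<sigma> (Var 7) (Var 4))"
      by (rule safe_fld) (use V'_simps p n c in auto)
    then show "bsafe S V' M' (Eq (fld \<sigma> (Var 7) (Var 4)) (Num 0))" using small(3)[of 0] by simp
    have cond: "bval V' M' (Eq (fld \<sigma> (Var 7) (Var 4)) (Num 0)) \<longleftrightarrow> hp M p c = 0"
      using V'_simps M'[of c p] c by (simp add: ev_fld)
    show "0 < k' \<and> wp (set_fld \<sigma> (Var 7) (Var 4) (Var 6) ;; Asg 7 (fld \<sigma> (Var 7) (Num (\<sigma> + 1)))) I V' M' R' (k' - 1)"
      if "bval V' M' (Eq (fld \<sigma> (Var 7) (Var 4)) (Num 0))"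
    proof
      from that cond have pc: "hp M p c = 0" by simp
      then have p0: "p \<noteq> 0" using delta_0[OF c] by (cases "p = 0") auto
      then have pn: "p \<in> {1..<n}" using p by simp
      have ns: "\<not> sublist (T p @ [c]) u" using delta[OF pn c] pc by auto
      have pu: "suffix (T p) u" using p p0 by simp
      let ?M = "hupd M' p c n"
      have lnkM: "slink ?M p = ?lnk p" using c M'[of "\<sigma> + 1" p] by (simp add: hp_hupd)
      have dec: "?len (?lnk p) < ?len p" using len_lnk_less[OF pn] .
      have dec2: "?len (?lnk p) \<le> ?len (?lnk lst)"
        using len_lnk_mono[OF pn lst] pu S_lst by simp
      show "0 < k'" using rest(3) dec by simp
      have I: "I (V(7 := ?lnk p)) ?M R' (k' - 1)"
        unfolding I_def
      proof (intro exI conjI allI impI)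
        show "?lnk p < n" using lnk_less[OF p(1)] .
        show "suffix (T (?lnk p)) u" if "?lnk p \<noteq> 0"
          using suffix_lnk[OF pn that] pu suffix_order.trans by blast
        show "\<not> sublist (T v @ [c]) u" if "v \<in> {1..<n}" "suffix (T v) u" "?len (?lnk p) < ?len v" for v
          using chain_step[OF pn that(1) pu that(2,3)] above that ns by blast
        show "hp ?M v f = (if f = c \<and> 1 \<le> v \<and> v < n \<and> suffix (T v) u \<and> ?len (?lnk p) < ?len v then n else hp M v f)"
          if "f < \<sigma> + 5" for v f
          using chain_step[OF pn _ pu, of v] that c M'[OF that, of v] dec pn pu by (auto simp: hp_hupd)
        show "?M i = M i" if "i < base" for i using rest(1) that by (simp add: hupd_below)
        show "X + min (?len (?lnk p)) (Suc (?len (?lnk lst))) \<le> k' - 1" using rest(3) dec dec2 by simp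
      qed (use rest in simp_all)
      show "wp (set_fld \<sigma> (Var 7) (Var 4) (Var 6) ;; Asg 7 (fld \<sigma> (Var 7) (Num (\<sigma> + 1)))) I V' M' R' (k' - 1)"
        by (intro wp_Seq wp_set_fld wp_Asg safe_fld)
          (use I V'_simps V' lnkM p n c small(3)[of "\<sigma> + 1"] in \<open>simp_all add: ev_fld\<close>)
    qed
    show "\<exists>p. V' = V(7 := p) \<and> aut_extend M u n lst T c p \<and>
      (\<forall>v f. f < \<sigma> + 5 \<longrightarrow> hp M' v f = (if f = c \<and> 1 \<le> v \<and> v < n \<and> suffix (T v) u \<and> ?len p < ?len v then n else hp M v f)) \<and>
      (\<forall>i<base. M' i = M i) \<and> R' = R \<and> X + ?len p \<le> k'"
      if "\<not> bval V' M' (Eq (fld \<sigma> (Var 7) (Var 4)) (Num 0))"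
    proof -
      from that cond have pc: "hp M p c \<noteq> 0" by simp
      have ext: "aut_extend M u n lst T c p"
      proof
        show "suffix (T p) u \<and> sublist (T p @ [c]) u" if "p \<noteq> 0"
          using p that delta_undef[of p c] c pc by auto
      qed (use c p above in auto)
      have "?len p \<le> ?len (?lnk lst)" using suffix_automaton_extend.p_le_lnk_lst(2)[OF ext] .
      then have "X + ?len p \<le> k'" using rest(3) by simp
      then show ?thesis using V' ext M' rest by auto
    qed
  qed
qed

section \<open>Appending a letter\<close>

lemma wp_copy_transitions:
  assumes V: "V 2 = base" "V 8 = q" "V 11 = cl" "V 9 = 0" and q: "q < max_states" "cl < max_states" "q \<noteq> cl"
    and k: "X + (\<sigma> + 1) \<le> k"
  shows "wp (copy_transitions \<sigma>) (\<lambda>V' M' R' k'. V' = V(9 := \<sigma> + 1) \<and>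
      (\<forall>v f. f < \<sigma> + 5 \<longrightarrow> hp M' v f = (if v = cl \<and> f < \<sigma> + 1 then hp M q f else hp M v f)) \<and>
      (\<forall>i<base. M' i = M i) \<and> R' = R \<and> X \<le> k') V M R k"
proof -
  define I where "I = (\<lambda>V' M' R' k'. \<exists>j. V' = V(9 := j) \<and> j \<le> \<sigma> + 1 \<and>
      (\<forall>v f. f < \<sigma> + 5 \<longrightarrow> hp M' v f = (if v = cl \<and> f < j then hp M q f else hp M v f)) \<and>
      (\<forall>i<base. M' i = M i) \<and> R' = R \<and> X + (\<sigma> + 1 - j) \<le> k')"
  show ?thesis unfolding copy_transitions_def
  proof (rule wp_While[where I = I])
    show "I V M R k" unfolding I_def using V k by (intro exI[of _ 0]) (auto simp: fun_upd_idem)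
  next
    fix V' M' R' k' assume "I V' M' R' k'"
    then obtain j where V': "V' = V(9 := j)" and j: "j \<le> \<sigma> + 1"
      and M': "\<And>v f. f < \<sigma> + 5 \<Longrightarrow> hp M' v f = (if v = cl \<and> f < j then hp M q f else hp M v f)"
      and rest: "\<forall>i<base. M' i = M i" "R' = R" "X + (\<sigma> + 1 - j) \<le> k'"
      unfolding I_def by blast
    have V'_simps: "V' 2 = base" "V' 8 = q" "V' 11 = cl" "V' 9 = j" using V V' by simp_all
    have sm: "Suc \<sigma> < S" "Suc 0 < S" "Suc j < S" using small(3)[of "Suc \<sigma>"] small(3)[of 1] small(3)[of "Suc j"] j by simp_all
    show "bsafe S V' M' (Lt (Var 9) (Num (\<sigma> + 1)))" using sm by simp
    show "0 < k' \<and> wp (set_fld \<sigma> (Var 11) (Var 9) (fld \<sigma> (Var 8) (Var 9)) ;; inc 9) I V' M' R' (k' - 1)"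
      if "bval V' M' (Lt (Var 9) (Num (\<sigma> + 1)))"
    proof
      have j': "j < \<sigma> + 1" using that V'_simps by simp
      then show "0 < k'" using rest(3) by simp
      have "I (V(9 := Suc j)) (hupd M' cl j (hp M' q j)) R' (k' - 1)"
        unfolding I_def using rest j' q M'
        by (intro exI[of _ "Suc j"]) (auto simp: hp_hupd hupd_below less_Suc_eq)
      then show "wp (set_fld \<sigma> (Var 11) (Var 9) (fld \<sigma> (Var 8) (Var 9)) ;; inc 9) I V' M' R' (k' - 1)"
        by (intro wp_Seq wp_set_fld wp_Asg safe_fld) (use V'_simps V' q j' sm in \<open>simp_all add: ev_fld\<close>)
    qed
    show "V' = V(9 := \<sigma> + 1) \<and>
      (\<forall>v f. f < \<sigma> + 5 \<longrightarrow> hp M' v f = (if v = cl \<and> f < \<sigma> + 1 then hp M q f else hp M v f)) \<and>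
      (\<forall>i<base. M' i = M i) \<and> R' = R \<and> X \<le> k'" if "\<not> bval V' M' (Lt (Var 9) (Num (\<sigma> + 1)))"
    proof -
      have "j = \<sigma> + 1" using that V'_simps j by simp
      then show ?thesis using V' M' rest by simp
    qed
  qed
qed

lemma wp_redirect_transitions:
  assumes ext: "aut_extend M u n lst T c p"
    and q: "q = hp M p c" and neq: "slen M q \<noteq> Suc (slen M p)" and n: "Suc n < max_states"
    and V: "V 2 = base" "V 4 = c" "V 7 = p" "V 8 = q" "V 11 = Suc n"
    and Ma: "\<And>v. v < n \<Longrightarrow> hp Ma v c = (if 1 \<le> v \<and> suffix (T v) u \<and> slen M p < slen M v then n else hp M v c)"
      "\<And>v. v < n \<Longrightarrow> v \<noteq> q \<Longrightarrow> slink Ma v = slink M v"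
    and k: "X + Suc (slen M (slink M (slink M lst))) \<le> k"
  shows "wp (redirect_transitions \<sigma>) (\<lambda>V' M' R' k'. \<exists>p2. V' = V(7 := p2) \<and>
      aut_split M u n lst T c p p2 \<and>
      (\<forall>v f. f < \<sigma> + 5 \<longrightarrow> hp M' v f = (if f = c \<and> 1 \<le> v \<and> v < n \<and> suffix (T v) (T p) \<and>
         slen M p2 < slen M v then Suc n else hp Ma v f)) \<and>
      (\<forall>i<base. M' i = Ma i) \<and> R' = R \<and>
      X + min (slen M p2) (Suc (slen M (slink M (slink M lst)))) \<le> k') V Ma R k"
proof -
  let ?len = "slen M" and ?lnk = "slink M"
  interpret E: suffix_automaton_extend "Suc \<sigma>" u n lst T ?lnk ?len "hp M" c p by fact
  note c = E.c
  have Eq: "E.q = q" by (simp add: E.q_def q)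
  have qn: "q \<in> {1..<n}" using E.q(1) Eq by simp
  have p0: "p \<noteq> 0"
  proof
    assume p0: "p = 0"
    then have "q = 1" using E.delta_0[OF c] q by simp
    then show False using neq E.len[of 1] E.n_gt E.S_root E.len_0 p0 by simp
  qed
  then have pn: "p \<in> {1..<n}" using E.p_less by simp
  have q1: "q \<noteq> 1"
  proof
    assume "q = 1"
    then have "?len q = 1" using E.len[of 1] E.n_gt E.S_root by simp
    moreover have "?len p < ?len q" using E.len_p_less_q Eq by simp
    ultimately show False using neq by simp
  qed
  let ?\<Phi> = "Suc (?len (?lnk (?lnk lst)))"
  define I where "I = (\<lambda>V' M' R' k'. \<exists>r. V' = V(7 := r) \<and> r < n \<and> (r \<noteq> 0 \<longrightarrow> suffix (T r) (T p)) \<and>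
    (\<forall>v. v \<in> {1..<n} \<longrightarrow> suffix (T v) (T p) \<longrightarrow> ?len r < ?len v \<longrightarrow> hp M v c = q) \<and>
    (\<forall>v f. f < \<sigma> + 5 \<longrightarrow> hp M' v f = (if f = c \<and> 1 \<le> v \<and> v < n \<and> suffix (T v) (T p) \<and> ?len r < ?len v then Suc n else hp Ma v f)) \<and>
    (\<forall>i<base. M' i = Ma i) \<and> R' = R \<and> X + min (?len r) ?\<Phi> \<le> k')"
  show ?thesis
    unfolding redirect_transitions_def
  proof (rule wp_While[where I = I])
    have "\<not> ?len p < ?len v" if "v \<in> {1..<n}" "suffix (T v) (T p)" for v
      using E.suffix_len_le[OF that(1) pn that(2)] that(2) by simp
    then show "I V Ma R k" unfolding I_def using V k pn
      by (intro exI[of _ p]) (auto simp: fun_upd_idem)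
  next
    fix V' M' R' k' assume "I V' M' R' k'"
    then obtain r where V': "V' = V(7 := r)" and r: "r < n" "r \<noteq> 0 \<longrightarrow> suffix (T r) (T p)"
      and above: "\<forall>v. v \<in> {1..<n} \<longrightarrow> suffix (T v) (T p) \<longrightarrow> ?len r < ?len v \<longrightarrow> hp M v c = q"
      and M': "\<And>v f. f < \<sigma> + 5 \<Longrightarrow> hp M' v f = (if f = c \<and> 1 \<le> v \<and> v < n \<and> suffix (T v) (T p) \<and> ?len r < ?len v then Suc n else hp Ma v f)"
      and rest: "\<forall>i<base. M' i = Ma i" "R' = R" "X + min (?len r) ?\<Phi> \<le> k'"
      unfolding I_def by blast
    have V'_simps: "V' 2 = base" "V' 4 = c" "V' 7 = r" "V' 8 = q" "V' 11 = Suc n" using V V' by simp_all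
    have safe: "safe S V' M' (fld \<sigma> (Var 7) (Var 4))"
      by (rule safe_fld) (use V'_simps r n c in auto)
    then show "bsafe S V' M' (Eq (fld \<sigma> (Var 7) (Var 4)) (Var 8))" by simp
    have le: "?len r \<le> ?len p"
      using r E.suffix_len_le[of r p "T p"] pn E.len_0 by (cases "r = 0") auto
    have "hp M' r c = hp M r c" using M'[of c r] Ma(1)[OF r(1)] le c by simp
    then have cond: "bval V' M' (Eq (fld \<sigma> (Var 7) (Var 4)) (Var 8)) \<longleftrightarrow> hp M r c = q"
      using V'_simps by (simp add: ev_fld)
    show "0 < k' \<and> wp (set_fld \<sigma> (Var 7) (Var 4) (Var 11) ;; Asg 7 (fld \<sigma> (Var 7) (Num (\<sigma> + 1)))) I V' M' R' (k' - 1)"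
      if "bval V' M' (Eq (fld \<sigma> (Var 7) (Var 4)) (Var 8))"
    proof
      from that cond have rc: "hp M r c = q" by simp
      then have r0: "r \<noteq> 0" using E.delta_0[OF c] q1 by (cases "r = 0") auto
      then have rn: "r \<in> {1..<n}" and rp: "suffix (T r) (T p)" using r by simp_all
      let ?M = "hupd M' r c (Suc n)"
      have "r \<noteq> q" using le E.len_p_less_q Eq by auto
      then have lnkM: "slink ?M r = ?lnk r" using c M'[of "\<sigma> + 1" r] Ma(2)[OF r(1)] by (simp add: hp_hupd)
      have dec: "?len (?lnk r) < ?len r" using E.len_lnk_less[OF rn] .
      have "?len (?lnk r) \<le> ?len (?lnk p)" using E.len_lnk_mono[OF rn pn rp] .
      also have "\<dots> \<le> ?len (?lnk (?lnk lst))"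
        using E.len_lnk_mono[OF pn, of "?lnk lst"] E.p_le_lnk_lst(1)[OF p0] by blast
      finally have dec2: "?len (?lnk r) \<le> ?len (?lnk (?lnk lst))" .
      show "0 < k'" using rest(3) dec by simp
      have I: "I (V(7 := ?lnk r)) ?M R' (k' - 1)"
        unfolding I_def
      proof (intro exI conjI allI impI)
        show "?lnk r < n" using E.lnk_less[OF r(1)] .
        show "suffix (T (?lnk r)) (T p)" if "?lnk r \<noteq> 0"
          using E.suffix_lnk[OF rn that] rp suffix_order.trans by blast
        show "hp M v c = q" if "v \<in> {1..<n}" "suffix (T v) (T p)" "?len (?lnk r) < ?len v" for v
          using E.chain_step[OF rn that(1) rp that(2,3)] above that rc by blast
        show "hp ?M v f = (if f = c \<and> 1 \<le> v \<and> v < n \<and> suffix (T v) (T p) \<and> ?len (?lnk r) < ?len v then Suc n else hp Ma v f)"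
          if "f < \<sigma> + 5" for v f
          using E.chain_step[OF rn _ rp, of v] that c M'[OF that, of v] dec rn rp by (auto simp: hp_hupd)
        show "?M i = Ma i" if "i < base" for i using rest(1) that by (simp add: hupd_below)
        show "X + min (?len (?lnk r)) ?\<Phi> \<le> k' - 1" using rest(3) dec dec2 by simp
      qed (use rest in simp_all)
      show "wp (set_fld \<sigma> (Var 7) (Var 4) (Var 11) ;; Asg 7 (fld \<sigma> (Var 7) (Num (\<sigma> + 1)))) I V' M' R' (k' - 1)"
        by (intro wp_Seq wp_set_fld wp_Asg safe_fld)
          (use I V'_simps V' lnkM r n c small(3)[of "\<sigma> + 1"] in \<open>simp_all add: ev_fld\<close>)
    qed
    show "\<exists>p2. V' = V(7 := p2) \<and> aut_split M u n lst T c p p2 \<and>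
      (\<forall>v f. f < \<sigma> + 5 \<longrightarrow> hp M' v f = (if f = c \<and> 1 \<le> v \<and> v < n \<and> suffix (T v) (T p) \<and> ?len p2 < ?len v then Suc n else hp Ma v f)) \<and>
      (\<forall>i<base. M' i = Ma i) \<and> R' = R \<and> X + min (?len p2) ?\<Phi> \<le> k'"
      if "\<not> bval V' M' (Eq (fld \<sigma> (Var 7) (Var 4)) (Var 8))"
    proof -
      have "aut_split M u n lst T c p r"
        by unfold_locales (use neq Eq r that cond above in auto)
      then show ?thesis using V' M' rest by auto
    qed
  qed
qed

definition extend_post :: "nat \<Rightarrow> (nat \<Rightarrow> nat) \<Rightarrow> (nat \<Rightarrow> nat) \<Rightarrow> (nat \<Rightarrow> rat) \<Rightarrow> nat list \<Rightarrow> nat \<Rightarrow>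
    assertion" where
  "extend_post X V M R u n V' M' R' k' \<longleftrightarrow>
     (\<forall>i. i \<notin> {5..11} \<longrightarrow> V' i = V i) \<and> (\<exists>T. aut M' u (V' 6) (V' 5) T) \<and> V' 6 \<le> n + 2 \<and>
     (\<forall>v f. V' 6 \<le> v \<longrightarrow> f < \<sigma> + 3 \<longrightarrow> hp M' v f = 0) \<and>
     (\<forall>v f. \<sigma> + 3 \<le> f \<longrightarrow> f < \<sigma> + 5 \<longrightarrow> hp M' v f = hp M v f) \<and> (\<forall>i<base. M' i = M i) \<and> R' = R \<and>
     X + slen M' (slink M' (V' 5)) + slen M' (slink M' (slink M' (V' 5))) \<le> k'"

context
  fixes M M1 M2 V :: "nat \<Rightarrow> nat" and u :: "nat list" and n lst c p q X k :: nat and T :: "nat \<Rightarrow> nat list"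
  assumes ext: "aut_extend M1 u n lst T c p"
    and n: "Suc n < max_states" and len_u: "length u < length word" and q: "q = hp M1 p c"
    and fresh: "\<And>v f. n \<le> v \<Longrightarrow> f < \<sigma> + 3 \<Longrightarrow> hp M v f = 0"
    and M1: "\<And>v f. f < \<sigma> + 5 \<Longrightarrow> hp M1 v f = (if v = n \<and> f = \<sigma> + 2 then Suc (slen M1 lst) else hp M v f)"
    and M2: "\<And>v f. f < \<sigma> + 5 \<Longrightarrow> hp M2 v f = (if f = c \<and> 1 \<le> v \<and> v < n \<and> suffix (T v) u \<and>
         slen M1 p < slen M1 v then n else hp M1 v f)"
    and M2_below: "\<And>i. i < base \<Longrightarrow> M2 i = M i"
    and V: "V 2 = base" "V 4 = c" "V 6 = n" "V 7 = p" "V 5 = n" "V 8 = q" "V 10 = slen M1 p"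
begin

interpretation E: suffix_automaton_extend "Suc \<sigma>" u n lst T "slink M1" "slen M1" "hp M1" c p
  by (fact ext)

lemma Eq: "E.q = q"
  by (simp add: E.q_def q)

lemma len_M1_less: "v < n \<Longrightarrow> slen M1 v \<le> max_states"
  using E.len[of v] E.len_0 sublist_length_le[OF nodes_sublist[OF E.S_node, of v]] len_u
  by (cases "v = 0") (auto simp: max_states_def)

lemma M2_fields: "slink M2 v = slink M1 v" "slen M2 v = slen M1 v"
  using E.c by (simp_all add: M2)

lemma M2_delta: "v < n \<Longrightarrow> a < Suc \<sigma> \<Longrightarrow> hp M2 v a = E.\<delta>1 v a"
  unfolding E.\<delta>1_def by (simp add: M2)

lemma wp_extend_solid:
  assumes eq: "slen M1 q = Suc (slen M1 p)"
    and k: "X + slen M1 p + slen M1 (slink M1 (slink M1 lst)) + 2 \<le> k"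
  shows "wp (set_fld \<sigma> (Var 6) (Num (\<sigma> + 1)) (Var 8) ;; inc 6) (extend_post X V M R (u @ [c]) n) V M2 R k"
proof -
  let ?M = "hupd M2 n (\<sigma> + 1) q"
  have qn: "q < n" "q \<in> {1..<n}" using E.q(1) Eq by auto
  have M3: "hp ?M v f = (if v = n \<and> f = \<sigma> + 1 then q else hp M2 v f)" if "f < \<sigma> + 5" for v f
    using that by (simp add: hp_hupd)
  have "aut ?M (u @ [c]) (Suc n) n (T(n := u @ [c]))"
  proof (rule E.extend_solid)
    show "hp M1 E.q (\<sigma> + 2) = Suc (slen M1 p)" using eq Eq by simp
    show "hp ?M v a = E.\<delta>1 v a" if "v < n" "a < Suc \<sigma>" for v a using that M2_delta M3[of a v] by simp
    show "hp ?M n a = 0" if "a < Suc \<sigma>" for a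
      using that M3[of a n] M2[of a n] M1[of a n] fresh[of n a] by simp
    show "slen ?M n = Suc (slen M1 lst)" using M3[of "\<sigma> + 2" n] M2_fields(2)[of n] M1[of "\<sigma> + 2" n] by simp
    show "slen ?M v = slen M1 v" if "v < n" for v
      using M3[of "\<sigma> + 2" v] M2_fields(2)[of v] by simp
    show "slink ?M v = slink M1 v" if "v < n" for v
      using that M3[of "\<sigma> + 1" v] M2_fields(1)[of v] by simp
    show "slink ?M n = E.q" using M3[of "\<sigma> + 1" n] Eq by simp
  qed auto
  moreover have "hp ?M v f = 0" if "Suc n \<le> v" "f < \<sigma> + 3" for v f
    using that M3[of f v] M2[of f v] M1[of f v] fresh[of v f] by simp
  moreover have "hp ?M v f = hp M v f" if "\<sigma> + 3 \<le> f" "f < \<sigma> + 5" for v f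
    using that E.c M3[of f v] M2[of f v] M1[of f v] by simp
  moreover have "?M i = M i" if "i < base" for i using that M2_below by (simp add: hupd_below)
  moreover have "slink ?M n = q" "slen ?M q = Suc (slen M1 p)"
    "slen ?M (slink ?M q) = slen M1 (slink M1 q)"
    using M3[of "\<sigma> + 1" n] M3[of "\<sigma> + 2" q] M3[of "\<sigma> + 1" q] M3[of "\<sigma> + 2" "slink M1 q"] M2_fields qn eq by auto
  moreover have "slen M1 (slink M1 q) \<le> Suc (slen M1 (slink M1 (slink M1 lst)))"
    using E.len_lnk_q_le Eq by simp
  ultimately have "extend_post X V M R (u @ [c]) n (V(6 := Suc n)) ?M R k"
    unfolding extend_post_def using V k by auto
  then show ?thesis
    by (intro wp_Seq wp_set_fld wp_Asg safe_fld)
      (use V qn n small(1)[of "Suc n"] small(3)[of "Suc \<sigma>"] small(3)[of 1] in \<open>simp_all add: ev_fld\<close>)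
qed

lemma wp_extend_split:
  assumes neq: "slen M1 q \<noteq> Suc (slen M1 p)"
    and k: "X + slen M1 p + slen M1 (slink M1 (slink M1 lst)) + \<sigma> + 6 \<le> k"
  shows "wp (split_state \<sigma>) (extend_post X V M R (u @ [c]) n) V M2 R k"
proof -
  have qn: "q < n" "q \<in> {1..<n}" using E.q(1) Eq by auto
  have pn: "p < n" by (rule E.p_less)
  have sm: "Suc n < S" "Suc (Suc n) < S" "Suc \<sigma> < S" "Suc (Suc \<sigma>) < S" "0 < S" "Suc 0 < S" "2 < S" "Suc (slen M1 p) < S"
    using small(1)[of "Suc n"] small(2)[of "Suc n"] n small(3)[of "Suc \<sigma>"] small(3)[of "Suc (Suc \<sigma>)"] small(3)[of 0] small(3)[of 1]
      small(3)[of 2] small(2)[OF len_M1_less[OF pn]] by simp_all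
  let ?V1 = "V(11 := Suc n, 9 := 0)"
  let ?X2 = "X + slen M1 p + 2" and ?\<Phi> = "Suc (slen M1 (slink M1 (slink M1 lst)))"
  let ?rest = "set_fld \<sigma> (Var 11) (Num (\<sigma> + 2)) (Add (Var 10) (Num 1)) ;;
        set_fld \<sigma> (Var 11) (Num (\<sigma> + 1)) (fld \<sigma> (Var 8) (Num (\<sigma> + 1))) ;;
        set_fld \<sigma> (Var 8) (Num (\<sigma> + 1)) (Var 11) ;;
        set_fld \<sigma> (Var 6) (Num (\<sigma> + 1)) (Var 11) ;;
        redirect_transitions \<sigma> ;;
        Asg 6 (Add (Var 6) (Num 2))"
  have "wp (copy_transitions \<sigma>) (wp ?rest (extend_post X V M R (u @ [c]) n)) ?V1 M2 R k"
  proof (rule wp_mono[OF wp_copy_transitions[of _ q "Suc n" "?X2 + ?\<Phi>"]])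
    fix V3 M3 R3 k3
    assume *: "V3 = ?V1(9 := \<sigma> + 1) \<and>
       (\<forall>v f. f < \<sigma> + 5 \<longrightarrow> hp M3 v f = (if v = Suc n \<and> f < \<sigma> + 1 then hp M2 q f else hp M2 v f)) \<and>
       (\<forall>i<base. M3 i = M2 i) \<and> R3 = R \<and> ?X2 + ?\<Phi> \<le> k3"
    then have M3: "\<And>v f. f < \<sigma> + 5 \<Longrightarrow> hp M3 v f = (if v = Suc n \<and> f < \<sigma> + 1 then hp M2 q f else hp M2 v f)" by blast
    have V3: "V3 2 = base" "V3 4 = c" "V3 7 = p" "V3 8 = q" "V3 11 = Suc n" "V3 6 = n" "V3 10 = slen M1 p" using * V by simp_all
    define M4 where "M4 = hupd (hupd (hupd (hupd M3 (Suc n) (\<sigma> + 2) (Suc (slen M1 p))) (Suc n) (\<sigma> + 1) (slink M1 q))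
       q (\<sigma> + 1) (Suc n)) n (\<sigma> + 1) (Suc n)"
    have M4: "hp M4 v f = (if f = \<sigma> + 1 \<and> (v = n \<or> v = q) then Suc n else if f = \<sigma> + 1 \<and> v = Suc n then slink M1 q
        else if f = \<sigma> + 2 \<and> v = Suc n then Suc (slen M1 p) else if f < \<sigma> + 1 \<and> v = Suc n then hp M2 q f else hp M2 v f)"
      if "f < \<sigma> + 5" for v f using that qn M3[OF that, of v] unfolding M4_def
      by (cases "f = \<sigma> + 1"; cases "f = \<sigma> + 2"; cases "v = n"; cases "v = q"; simp add: hp_hupd)
    have lnk3: "slink (hupd M3 (Suc n) (\<sigma> + 2) (Suc (slen M1 p))) q = slink M1 q"
      using M3[of "\<sigma> + 1" q] M2_fields(1)[of q] qn by (simp add: hp_hupd)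
    have "wp (redirect_transitions \<sigma>) (wp (Asg 6 (Add (Var 6) (Num 2))) (extend_post X V M R (u @ [c]) n)) V3 M4 R k3"
    proof (rule wp_mono[OF wp_redirect_transitions[OF ext q neq n]])
      fix V5 M5 R5 k5
      assume **: "\<exists>p2. V5 = V3(7 := p2) \<and>
         aut_split M1 u n lst T c p p2 \<and>
         (\<forall>v f. f < \<sigma> + 5 \<longrightarrow> hp M5 v f = (if f = c \<and> 1 \<le> v \<and> v < n \<and> suffix (T v) (T p) \<and>
            slen M1 p2 < slen M1 v then Suc n else hp M4 v f)) \<and>
         (\<forall>i<base. M5 i = M4 i) \<and> R5 = R \<and> ?X2 + min (slen M1 p2) ?\<Phi> \<le> k5"
      then obtain p2 where V5: "V5 = V3(7 := p2)" and R5: "R5 = R"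
        and split: "aut_split M1 u n lst T c p p2"
        and M5: "\<And>v f. f < \<sigma> + 5 \<Longrightarrow> hp M5 v f = (if f = c \<and> 1 \<le> v \<and> v < n \<and> suffix (T v) (T p) \<and>
            slen M1 p2 < slen M1 v then Suc n else hp M4 v f)"
        and below: "\<And>i. i < base \<Longrightarrow> M5 i = M4 i" and k5: "?X2 + min (slen M1 p2) ?\<Phi> \<le> k5" by blast
      interpret D: suffix_automaton_split "Suc \<sigma>" u n lst T "slink M1" "slen M1" "hp M1" c p p2 by fact
      have fields: "slink M5 v = (if v = n \<or> v = q then Suc n else if v = Suc n then slink M1 q else slink M1 v)"
        "slen M5 v = (if v = Suc n then Suc (slen M1 p) else slen M1 v)" for v
        using M5[of "\<sigma> + 1" v] M5[of "\<sigma> + 2" v] M4[of "\<sigma> + 1" v] M4[of "\<sigma> + 2" v] M2_fields[of v] E.c by auto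
      have "aut M5 (u @ [c]) (Suc (Suc n)) n (T(n := u @ [c], Suc n := E.z))"
      proof (rule D.extend_split)
        show "hp M5 v a = D.\<delta>2 v a" if "v < n" "a < Suc \<sigma>" for v a
          using that M5[of a v] M4[of a v] unfolding D.\<delta>2_def M2_delta[OF that, symmetric] by simp
        show "hp M5 n a = 0" if "a < Suc \<sigma>" for a
          using that M5[of a n] M4[of a n] M2[of a n] M1[of a n] fresh[of n a] by simp
        show "hp M5 (Suc n) a = E.\<delta>1 E.q a" if "a < Suc \<sigma>" for a
          using that M5[of a "Suc n"] M4[of a "Suc n"] M2_delta[OF qn(1) that] Eq by simp
        show "slen M5 n = Suc (slen M1 lst)" using fields(2)[of n] M1[of "\<sigma> + 2" n] by simp
      qed (use qn Eq fields in auto)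
      moreover have "hp M5 v f = 0" if "Suc (Suc n) \<le> v" "f < \<sigma> + 3" for v f
        using that qn M5[of f v] M4[of f v] M2[of f v] M1[of f v] fresh[of v f] by simp
      moreover have "hp M5 v f = hp M v f" if "\<sigma> + 3 \<le> f" "f < \<sigma> + 5" for v f
        using that E.c M5[of f v] M4[of f v] M2[of f v] M1[of f v] by simp
      moreover have "M5 i = M i" if "i < base" for i using that below * M2_below by (simp add: hupd_below M4_def)
      moreover have "slink M5 n = Suc n" "slen M5 (Suc n) = Suc (slen M1 p)"
        "slen M5 (slink M5 (Suc n)) = slen M1 (slink M1 q)"
        using fields qn E.lnk_less[OF qn(1)] by auto
      moreover have "slen M1 (slink M1 q) \<le> ?\<Phi>" "slen M1 (slink M1 q) \<le> Suc (slen M1 p2)"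
        using E.len_lnk_q_le D.len_lnk_q_le' Eq by simp_all
      moreover have "\<forall>i. i \<notin> {5..11} \<longrightarrow> (V5(6 := Suc (Suc n))) i = V i" "V5 5 = n" using V5 * V by auto
      ultimately have "extend_post X V M R (u @ [c]) n (V5(6 := Suc (Suc n))) M5 R5 k5"
        unfolding extend_post_def using k5 R5 by auto
      then show "wp (Asg 6 (Add (Var 6) (Num 2))) (extend_post X V M R (u @ [c]) n) V5 M5 R5 k5"
        by (intro wp_Asg) (use V5 V3 sm in simp_all)
    next
      show "hp M4 v c = (if 1 \<le> v \<and> suffix (T v) u \<and> slen M1 p < slen M1 v then n else hp M1 v c)" if "v < n" for v
        using that E.c M4[of c v] M2[of c v] by simp
      show "slink M4 v = slink M1 v" if "v < n" "v \<noteq> q" for v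
        using that M4[of "\<sigma> + 1" v] M2_fields(1)[of v] by simp
    qed (use V3 * in auto)
    then show "wp ?rest (extend_post X V M R (u @ [c]) n) V3 M3 R3 k3"
      by (intro wp_Seq wp_set_fld safe_fld)
        (use V3 * qn n sm lnk3 E.c in \<open>simp_all add: ev_fld M4_def\<close>)
  qed (use V qn n k in auto)
  then show ?thesis unfolding split_state_def
    by (intro wp_Seq wp_Asg) (use V sm in simp_all)
qed

end

lemma wp_extend:
  assumes aut: "aut M u n lst T" and c: "c < Suc \<sigma>" and n: "Suc n < max_states" and u: "length u < length word"
    and fresh: "\<And>v f. n \<le> v \<Longrightarrow> f < \<sigma> + 3 \<Longrightarrow> hp M v f = 0"
    and V: "V 2 = base" "V 4 = c" "V 5 = lst" "V 6 = n"
    and k: "X + slen M (slink M lst) + slen M (slink M (slink M lst)) + \<sigma> + 7 \<le> k"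
  shows "wp (extend \<sigma>) (extend_post X V M R (u @ [c]) n) V M R k"
proof -
  interpret suffix_automaton "Suc \<sigma>" u n lst T "slink M" "slen M" "hp M" by fact
  have len_lst: "slen M lst = Suc (length u)" using len[OF lst] S_lst by simp
  define M1 where "M1 = hupd M n (\<sigma> + 2) (Suc (slen M lst))"
  have lstn: "lst < n" using lst by simp
  have M1: "hp M1 v f = (if v = n \<and> f = \<sigma> + 2 then Suc (slen M1 lst) else hp M v f)" if "f < \<sigma> + 5" for v f
    using that lstn by (simp add: M1_def hp_hupd)
  have lnk1: "slink M1 lst = slink M lst"
    "slen M1 (slink M lst) = slen M (slink M lst)"
    "slen M1 (slink M1 (slink M1 lst)) = slen M (slink M (slink M lst))"
    using lnk_less[OF lstn] lnk_less[OF lnk_less[OF lstn]] M1[of "\<sigma> + 1"] M1[of "\<sigma> + 2"] by simp_all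
  have aut1: "aut M1 u n lst T" by (rule aut_cong[OF aut]) (simp add: M1)
  let ?\<Phi> = "slen M (slink M (slink M lst))"
  let ?X = "X + ?\<Phi> + \<sigma> + 6"
  have sm: "Suc \<sigma> < S" "Suc (Suc \<sigma>) < S" "Suc 0 < S"
    using small(3)[of "Suc \<sigma>"] small(3)[of "Suc (Suc \<sigma>)"] small(3)[of 1] by simp_all
  let ?solid = "set_fld \<sigma> (Var 6) (Num (\<sigma> + 1)) (Var 8) ;; inc 6"
  let ?rest = "Asg 8 (fld \<sigma> (Var 7) (Var 4)) ;;
     Asg 10 (fld \<sigma> (Var 7) (Num (\<sigma> + 2))) ;;
     Asg 5 (Var 6) ;;
     If (Eq (fld \<sigma> (Var 8) (Num (\<sigma> + 2))) (Add (Var 10) (Num 1))) ?solid (split_state \<sigma>)"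
  have "wp (add_transitions \<sigma>) (wp ?rest (extend_post X V M R (u @ [c]) n)) (V(7 := lst)) M1 R k"
  proof (rule wp_mono[OF wp_add_transitions[OF aut1 c, where X = ?X]])
    fix V2 M2 R2 k2
    assume "\<exists>p. V2 = (V(7 := lst))(7 := p) \<and>
      aut_extend M1 u n lst T c p \<and>
      (\<forall>v f. f < \<sigma> + 5 \<longrightarrow> hp M2 v f = (if f = c \<and> 1 \<le> v \<and> v < n \<and> suffix (T v) u \<and>
         slen M1 p < slen M1 v then n else hp M1 v f)) \<and>
      (\<forall>i<base. M2 i = M1 i) \<and> R2 = R \<and> ?X + slen M1 p \<le> k2"
    then obtain p where V2: "V2 = V(7 := p)" and R2: "R2 = R" and k2: "?X + slen M1 p \<le> k2"
      and ext: "aut_extend M1 u n lst T c p"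
      and M2: "\<And>v f. f < \<sigma> + 5 \<Longrightarrow> hp M2 v f = (if f = c \<and> 1 \<le> v \<and> v < n \<and> suffix (T v) u \<and>
         slen M1 p < slen M1 v then n else hp M1 v f)"
      and below: "\<And>i. i < base \<Longrightarrow> M2 i = M1 i" by auto
    interpret E: suffix_automaton_extend "Suc \<sigma>" u n lst T "slink M1" "slen M1" "hp M1" c p by fact
    define q where "q = hp M1 p c"
    have qn: "q < n" using E.q(1) by (simp add: E.q_def q_def)
    have M2q: "hp M2 p c = q" "slen M2 p = slen M1 p" "slen M2 q = slen M1 q"
      using M2[of c p] M2[of "\<sigma> + 2" p] M2[of "\<sigma> + 2" q] c by (simp_all add: q_def)
    have below': "M2 i = M i" if "i < base" for i using below[OF that] that by (simp add: M1_def hupd_below)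
    let ?V = "V(7 := p, 8 := q, 10 := slen M1 p, 5 := n)"
    have V': "?V 2 = base" "?V 4 = c" "?V 6 = n" "?V 7 = p" "?V 5 = n" "?V 8 = q" "?V 10 = slen M1 p"
      using V by simp_all
    have post: "extend_post X ?V M R (u @ [c]) n = extend_post X V M R (u @ [c]) n"
      by (intro HOL.ext) (auto simp: extend_post_def)
    note ctx = ext n u q_def fresh M1 M2 below' V'
    have lp: "Suc (slen M1 p) < S"
      using small(2)[OF len_M1_less[OF ctx E.p_less]] .
    have "wp ?solid (extend_post X V M R (u @ [c]) n) ?V M2 R k2" if "slen M1 q = Suc (slen M1 p)"
      unfolding post[symmetric] by (rule wp_extend_solid[OF ctx that]) (use k2 lnk1 in auto)
    moreover have "wp (split_state \<sigma>) (extend_post X V M R (u @ [c]) n) ?V M2 R k2" if "slen M1 q \<noteq> Suc (slen M1 p)"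
      unfolding post[symmetric] by (rule wp_extend_split[OF ctx that]) (use k2 lnk1 in auto)
    ultimately have "wp (If (Eq (fld \<sigma> (Var 8) (Num (\<sigma> + 2))) (Add (Var 10) (Num 1))) ?solid (split_state \<sigma>))
       (extend_post X V M R (u @ [c]) n) ?V M2 R k2"
      by (intro wp_If) (use V' M2q qn n sm lp in \<open>auto simp: ev_fld intro!: safe_fld\<close>)
    then show "wp ?rest (extend_post X V M R (u @ [c]) n) V2 M2 R2 k2"
      by (intro wp_Seq wp_Asg safe_fld) (use V V2 R2 M2q E.p_less n c sm in \<open>simp_all add: ev_fld\<close>)
  qed (use V n k lnk1 in auto)
  then show ?thesis unfolding extend_def
    by (intro wp_Seq wp_set_fld wp_Asg)
      (use V n sm lstn u len_lst small(5)[of "Suc (length u)"] small(2)[of "length u"] small(2)[of "Suc (length u)"] in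
        \<open>auto simp: ev_fld M1_def max_states_def intro!: safe_fld\<close>)
qed

end

section \<open>Building the automaton\<close>

definition initialise :: "nat \<Rightarrow> com" where
  "initialise \<sigma> =
     Asg 0 (Ld (Num 0)) ;; Asg 1 (Ld (Num 1)) ;; Asg 2 (Add (Num 2) (Add (Var 0) (Var 1))) ;;
     Asg 12 (Add (Num 1) (Add (Add (Var 0) (Var 0)) (Add (Var 1) (Var 1)))) ;;
     Asg 9 (Num 0) ;;
     While (Lt (Var 9) (Num (\<sigma> + 1))) (set_fld \<sigma> (Num 0) (Var 9) (Num 1) ;; inc 9) ;;
     set_fld \<sigma> (Num 1) (Num (\<sigma> + 2)) (Num 1) ;;
     set_fld \<sigma> (Num 1) (Num (\<sigma> + 3)) (Num 1) ;;
     set_fld \<sigma> (Num 1) (Num (\<sigma> + 4)) (Num 1) ;;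
     Asg 5 (Num 1) ;; Asg 6 (Num 2) ;; Asg 3 (Num 0)"

definition build :: "nat \<Rightarrow> com" where
  "build \<sigma> = While (Lt (Var 3) (Var 12)) (read_letter \<sigma> ;; extend \<sigma> ;; inc 3)"

context lw_program
begin

definition build_inv :: "nat \<Rightarrow> assertion" where
  "build_inv X V M R k \<longleftrightarrow> V 3 \<le> length word \<and> input_ok V M \<and> V 12 = length word \<and>
     (\<exists>T. aut M (take (V 3) word) (V 6) (V 5) T) \<and> V 6 \<le> 2 + 2 * V 3 \<and>
     (\<forall>v f. V 6 \<le> v \<longrightarrow> f < \<sigma> + 3 \<longrightarrow> hp M v f = 0) \<and>
     (\<forall>v f. \<sigma> + 3 \<le> f \<longrightarrow> f < \<sigma> + 5 \<longrightarrow> hp M v f = of_bool (v = 1)) \<and> R = (\<lambda>_. 0) \<and>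
     X + slen M (slink M (V 5)) + slen M (slink M (slink M (V 5)))
       + (length word - V 3) * (\<sigma> + 8) \<le> k"

definition built :: "nat \<Rightarrow> assertion" where
  "built X V M R k \<longleftrightarrow> input_ok V M \<and> (\<exists>T lst. aut M word (V 6) lst T) \<and> V 6 \<le> max_states \<and>
     (\<forall>v f. \<sigma> + 3 \<le> f \<longrightarrow> f < \<sigma> + 5 \<longrightarrow> hp M v f = of_bool (v = 1)) \<and> R = (\<lambda>_. 0) \<and> X \<le> k"

lemma word_letter: "i < length word \<Longrightarrow> word ! i < Suc \<sigma>"
proof -
  assume "i < length word"
  then have "word ! i \<in> set word" by simp
  then show ?thesis using letters by (auto simp: word_def less_Suc_eq)
qed

lemma wp_build: assumes "build_inv X V M R k" shows "wp (build \<sigma>) (built X) V M R k"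
  unfolding build_def
proof (rule wp_While[where I = "build_inv X", OF assms])
  fix V M R k assume inv: "build_inv X V M R k"
  show "bsafe S V M (Lt (Var 3) (Var 12))" by simp
  show "built X V M R k" if "\<not> bval V M (Lt (Var 3) (Var 12))"
  proof -
    have "V 3 = length word" using that inv by (simp add: build_inv_def)
    then show ?thesis using inv by (auto simp: build_inv_def built_def max_states_def)
  qed
  show "0 < k \<and> wp (read_letter \<sigma> ;; extend \<sigma> ;; inc 3) (build_inv X) V M R (k - 1)"
    if "bval V M (Lt (Var 3) (Var 12))"
  proof
    define i where "i = V 3"
    have i: "i < length word" "V 12 = length word" using that inv by (simp_all add: build_inv_def i_def)
    have ok: "input_ok V M" using inv by (simp add: build_inv_def)
    obtain T where T: "aut M (take i word) (V 6) (V 5) T" using inv by (auto simp: build_inv_def i_def)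
    let ?\<Phi> = "\<lambda>M l. slen M (slink M l) + slen M (slink M (slink M l))"
    let ?X = "X + (length word - Suc i) * (\<sigma> + 8)"
    have "length word - i = Suc (length word - Suc i)" using i by simp
    then have mul: "(length word - i) * (\<sigma> + 8) = (length word - Suc i) * (\<sigma> + 8) + (\<sigma> + 8)" by simp
    have k: "?X + ?\<Phi> M (V 5) + (\<sigma> + 8) \<le> k"
      using inv mul unfolding build_inv_def i_def[symmetric] by linarith
    then show "0 < k" by linarith
    have n: "V 6 \<le> 2 + 2 * i" using inv by (simp add: build_inv_def i_def)
    let ?V = "V(4 := word ! i)"
    have "wp (extend \<sigma>) (wp (inc 3) (build_inv X)) ?V M R (k - 1)"
    proof (rule wp_mono[OF wp_extend[where X = ?X, OF T word_letter[OF i(1)]]])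
      fix V' M' R' k' assume post: "extend_post ?X ?V M R (take i word @ [word ! i]) (V 6) V' M' R' k'"
      have tk: "take i word @ [word ! i] = take (Suc i) word" using take_Suc_conv_app_nth[OF i(1)] by simp
      have V': "V' j = ?V j" if "j \<notin> {5..11}" for j using post that by (simp add: extend_post_def)
      have V'_simps: "V' 3 = i" "V' 12 = length word" "V' 0 = V 0" "V' 1 = V 1" "V' 2 = V 2"
        using V'[of 3] V'[of 12] V'[of 0] V'[of 1] V'[of 2] i by (simp_all add: i_def)
      have "input_ok V' M'" using ok post V'_simps by (auto simp: input_ok_def extend_post_def base_def)
      then have "build_inv X (V'(3 := Suc i)) M' R' k'"
        using post i n inv V'_simps unfolding build_inv_def extend_post_def tk i_def[symmetric]
        by (auto simp: input_ok_def)
      then show "wp (inc 3) (build_inv X) V' M' R' k'"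
        by (intro wp_Asg) (use V'_simps i small(3)[of 1] small(5)[of "Suc i"] in simp_all)
    next
      show "Suc (V 6) < max_states" using n i by (simp add: max_states_def)
      show "?X + slen M (slink M (V 5)) + slen M (slink M (slink M (V 5))) + \<sigma> + 7 \<le> k - 1"
        using k by simp
    qed (use ok i inv in \<open>auto simp: input_ok_def build_inv_def\<close>)
    then have "wp (extend \<sigma>) (wp (inc 3) (build_inv X)) (V(4 := word ! V 3)) M R (k - 1)" by (simp add: i_def)
    then show "wp (read_letter \<sigma> ;; extend \<sigma> ;; inc 3) (build_inv X) V M R (k - 1)"
      by (intro wp_Seq wp_read_letter) (use ok i in \<open>simp_all add: i_def\<close>)
  qed
qed

lemma aut_initial:
  assumes "\<And>v f. f < \<sigma> + 3 \<Longrightarrow> hp M v f = of_bool (v = 0 \<and> f < \<sigma> + 1 \<or> v = 1 \<and> f = \<sigma> + 2)"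
  shows "aut M [] 2 1 (\<lambda>_. [])"
proof
  have "nodes ([] :: nat list) = {[]}" by (auto simp: nodes_def)
  moreover have "{1..<2} = {1 :: nat}" by auto
  ultimately show "bij_betw (\<lambda>_. []) {1..<2 :: nat} (nodes ([] :: nat list))" by (simp add: bij_betw_def)
  show "slen M p = Suc (length ([] :: nat list))" if "p \<in> {1..<2}" for p
    using assms[of "\<sigma> + 2" p] that by auto
  show "slen M 0 = 0" "slink M 0 = 0" "slink M 1 = 0"
    using assms[of "\<sigma> + 2" 0] assms[of "\<sigma> + 1" 0] assms[of "\<sigma> + 1" 1] by simp_all
  show "hp M 0 a = 1" if "a < Suc \<sigma>" for a using assms[of a 0] that by simp
  show "hp M p a = 0" if "p \<in> {1..<2}" "a < Suc \<sigma>" for p a using assms[of a p] that by simp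
qed simp_all

lemma wp_initialise:
  assumes M: "M 0 = length x" "M 1 = length y" "\<And>i. i < length x + length y \<Longrightarrow> M (2 + i) = (x @ y) ! i"
    "\<And>i. base \<le> i \<Longrightarrow> M i = 0"
    and k: "X + (\<sigma> + 1) + length word * (\<sigma> + 8) \<le> k"
  shows "wp (initialise \<sigma>) (build_inv X) V M (\<lambda>_. 0) k"
proof -
  let ?V = "V(0 := length x, 1 := length y, 2 := base, 12 := length word, 9 := 0)"
  let ?X = "X + length word * (\<sigma> + 8)"
  let ?rest = "set_fld \<sigma> (Num 1) (Num (\<sigma> + 2)) (Num 1) ;;
     set_fld \<sigma> (Num 1) (Num (\<sigma> + 3)) (Num 1) ;;
     set_fld \<sigma> (Num 1) (Num (\<sigma> + 4)) (Num 1) ;;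
     Asg 5 (Num 1) ;; Asg 6 (Num 2) ;; Asg 3 (Num 0)"
  have sm: "0 < S" "Suc 0 < S" "2 < S" "Suc \<sigma> < S" "Suc (Suc \<sigma>) < S" "\<sigma> + 3 < S" "\<sigma> + 4 < S"
    "Suc (Suc (length x + length y)) < S" "Suc (length x + length x + (length y + length y)) < S"
    using small(3)[of 0] small(3)[of 1] small(3)[of 2] small(3)[of "Suc \<sigma>"] small(3)[of "Suc (Suc \<sigma>)"]
      small(3)[of "\<sigma> + 3"] small(3)[of "\<sigma> + 4"] small(4)[of base] small(5)[of "length word"]
    by (simp_all add: base_def length_word)
  have ms: "2 \<le> max_states" by (simp add: max_states_def)
  have hpM: "hp M v f = 0" for v f using M(4) by (simp add: hp_def)
  define I where "I = (\<lambda>V' M' R' k'. \<exists>j. V' = ?V(9 := j) \<and> j \<le> \<sigma> + 1 \<and>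
      (\<forall>v f. f < \<sigma> + 5 \<longrightarrow> hp M' v f = of_bool (v = 0 \<and> f < j)) \<and>
      (\<forall>i<base. M' i = M i) \<and> R' = (\<lambda>_ :: nat. 0 :: rat) \<and> ?X + (\<sigma> + 1 - j) \<le> k')"
  have "wp (While (Lt (Var 9) (Num (\<sigma> + 1))) (set_fld \<sigma> (Num 0) (Var 9) (Num 1) ;; inc 9))
    (wp ?rest (build_inv X)) ?V M (\<lambda>_. 0) k"
  proof (rule wp_While[where I = I])
    show "I ?V M (\<lambda>_. 0) k" unfolding I_def using k hpM by (intro exI[of _ 0]) (auto simp: fun_upd_idem)
  next
    fix V' M' R' k' assume "I V' M' R' k'"
    then obtain j where V': "V' = ?V(9 := j)" and j: "j \<le> \<sigma> + 1"
      and M': "\<And>v f. f < \<sigma> + 5 \<Longrightarrow> hp M' v f = of_bool (v = 0 \<and> f < j)"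
      and rest: "\<forall>i<base. M' i = M i" "R' = (\<lambda>_. 0)" "?X + (\<sigma> + 1 - j) \<le> k'"
      unfolding I_def by blast
    show "bsafe S V' M' (Lt (Var 9) (Num (\<sigma> + 1)))" using sm by simp
    show "0 < k' \<and> wp (set_fld \<sigma> (Num 0) (Var 9) (Num 1) ;; inc 9) I V' M' R' (k' - 1)"
      if "bval V' M' (Lt (Var 9) (Num (\<sigma> + 1)))"
    proof
      have j': "j < \<sigma> + 1" using that V' by simp
      then show "0 < k'" using rest(3) by simp
      have "I (?V(9 := Suc j)) (hupd M' 0 j 1) R' (k' - 1)"
        unfolding I_def using rest j' M'
        by (intro exI[of _ "Suc j"]) (auto simp: hp_hupd hupd_below less_Suc_eq)
      then show "wp (set_fld \<sigma> (Num 0) (Var 9) (Num 1) ;; inc 9) I V' M' R' (k' - 1)"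
        by (intro wp_Seq wp_set_fld wp_Asg) (use V' j' sm ms small(3)[of "Suc j"] in simp_all)
    qed
    show "wp ?rest (build_inv X) V' M' R' k'" if "\<not> bval V' M' (Lt (Var 9) (Num (\<sigma> + 1)))"
    proof -
      have j': "j = \<sigma> + 1" using that V' j by simp
      let ?M = "hupd (hupd (hupd M' 1 (\<sigma> + 2) 1) 1 (\<sigma> + 3) 1) 1 (\<sigma> + 4) 1"
      have hpM': "hp ?M v f = of_bool (v = 0 \<and> f < \<sigma> + 1 \<or> v = 1 \<and> f \<ge> \<sigma> + 2)" if "f < \<sigma> + 5" for v f
        using that M'[OF that, of v] j' by (auto simp: hp_hupd)
      have "aut ?M [] 2 1 (\<lambda>_. [])" 
      proof (rule aut_initial)
        fix v f assume "f < \<sigma> + 3"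
        then show "hp ?M v f = of_bool (v = 0 \<and> f < \<sigma> + 1 \<or> v = 1 \<and> f = \<sigma> + 2)"
          using hpM'[of f v] by (cases "v = 0 \<and> f < \<sigma> + 1"; cases "v = 1 \<and> f \<ge> \<sigma> + 2") auto
      qed
      moreover have "input_ok (V'(5 := 1, 6 := 2, 3 := 0)) ?M"
        using V' M rest(1) by (auto simp: input_ok_def hupd_below base_def)
      moreover have "slen ?M (slink ?M 1) = 0" "slen ?M (slink ?M (slink ?M 1)) = 0"
        using hpM'[of "\<sigma> + 1"] hpM'[of "\<sigma> + 2"] by simp_all
      moreover have "hp ?M v f = 0" if "2 \<le> v" "f < \<sigma> + 3" for v f using that hpM'[of f v] by simp
      moreover have "hp ?M v f = of_bool (v = 1)" if "\<sigma> + 3 \<le> f" "f < \<sigma> + 5" for v f using that hpM'[of f v] by simp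
      ultimately have "build_inv X (V'(5 := 1, 6 := 2, 3 := 0)) ?M R' k'"
        unfolding build_inv_def using V' rest by auto
      then show ?thesis
        by (intro wp_Seq wp_set_fld wp_Asg) (use V' sm ms in simp_all)
    qed
  qed
  then show ?thesis unfolding initialise_def
    by (intro wp_Seq wp_Asg) (use M sm in \<open>simp_all add: base_def length_word add.assoc mult_2\<close>)
qed

end

section \<open>Marking the factors of a block\<close>

context suffix_automaton
begin

lemma suffix_shortest_mono: "p \<in> {1..<n} \<Longrightarrow> q \<in> {1..<n} \<Longrightarrow> suffix (S p) (S q) \<Longrightarrow> suffix (shortest p) (shortest q)"
  using suffix_shorter[OF suffix_order.trans[OF suffix_shortest] suffix_shortest, of p q] len_lnk_mono[of p q] by (simp add: length_shortest)

lemma suffix_top_if_suffix_shortest: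
  "class_top w v (S q) \<Longrightarrow> p \<in> {1..<n} \<Longrightarrow> suffix (shortest p) v \<Longrightarrow> q \<in> {1..<n} \<Longrightarrow> suffix (S p) (S q)"
  using class_top_shortest[of p] S_node[of q] suffix_order.trans[of "shortest p" v "S q"] by (simp add: class_top_def)

lemma occurs_in_snoc:
  "occurs_in (X @ [a]) p \<longleftrightarrow> occurs_in X p \<or> p \<in> {1..<n} \<and> suffix (shortest p) (X @ [a])"
  unfolding occurs_in_def by (metis sublist_snoc_iff)

lemma occurs_in_Nil: "occurs_in [] p \<longleftrightarrow> p = 1"
proof -
  have "lnk p = 0 \<longleftrightarrow> p = 1" if "p \<in> {1..<n}"
    using lnk[of p] lnk_root that by (cases "p = 1") auto
  moreover have "len (lnk p) = 0 \<longleftrightarrow> lnk p = 0" if "p \<in> {1..<n}"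
    using len[of "lnk p"] lnk_less[of p] that len_0 by (cases "lnk p = 0") auto
  ultimately show ?thesis using length_shortest[of p] n_gt unfolding occurs_in_def by auto
qed

lemma occurs_in_root: "occurs_in X 1"
  using n_gt shortest_root by (simp add: occurs_in_def)

end

definition mark_up :: "nat \<Rightarrow> nat \<Rightarrow> com" where
  "mark_up \<sigma> f = While (Eq (fld \<sigma> (Var 8) (Num f)) (Num 0))
     (set_fld \<sigma> (Var 8) (Num f) (Num 1) ;; Asg 8 (fld \<sigma> (Var 8) (Num (\<sigma> + 1))))"

definition mark :: "nat \<Rightarrow> nat \<Rightarrow> exp \<Rightarrow> exp \<Rightarrow> com" where
  "mark \<sigma> f s e = Asg 3 s ;; Asg 13 e ;; Asg 7 (Num 1) ;;
     While (Lt (Var 3) (Var 13))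
      (read_letter \<sigma> ;; Asg 7 (fld \<sigma> (Var 7) (Var 4)) ;; Asg 8 (Var 7) ;; mark_up \<sigma> f ;; inc 3)"

context lw_program
begin

context
  fixes M :: "nat \<Rightarrow> nat" and n lst :: nat and T :: "nat \<Rightarrow> nat list" and f :: nat
  assumes aut: "aut M word n lst T" and n: "n \<le> max_states" and f: "f = \<sigma> + 3 \<or> f = \<sigma> + 4"
begin

interpretation A: suffix_automaton "Suc \<sigma>" word n lst T "slink M" "slen M" "hp M"
  by (fact aut)

definition unmarked where "unmarked P = card {v \<in> {1..<n}. \<not> P v}"

lemma wp_mark_up:
  fixes V Y X a p
  assumes p: "p \<in> {1..<n}" and top: "class_top word (Y @ [a]) (T p)"
    and V: "V 2 = base" "V 8 = p"
    and Ma: "\<And>v. hp Ma v f = of_bool (A.occurs_in Y v)"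
      "\<And>v g. g < \<sigma> + 5 \<Longrightarrow> g \<noteq> f \<Longrightarrow> hp Ma v g = hp M v g" "\<And>i. i < base \<Longrightarrow> Ma i = M i"
    and k: "X + unmarked (A.occurs_in Y) \<le> k"
  shows "wp (mark_up \<sigma> f) (\<lambda>V' M' R' k'. \<exists>t. V' = V(8 := t) \<and>
      (\<forall>v. hp M' v f = of_bool (A.occurs_in (Y @ [a]) v)) \<and>
      (\<forall>v g. g < \<sigma> + 5 \<longrightarrow> g \<noteq> f \<longrightarrow> hp M' v g = hp M v g) \<and> (\<forall>i<base. M' i = M i) \<and> R' = R \<and>
      X + unmarked (A.occurs_in (Y @ [a])) \<le> k') V Ma R k"
proof -
  let ?len = "slen M" and ?lnk = "slink M"
  define P where "P = (\<lambda>t v. A.occurs_in Y v \<or> v \<in> {1..<n} \<and> suffix (A.shortest v) (Y @ [a]) \<and> ?len t < ?len v)"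
  have f5: "f < \<sigma> + 5" "f \<noteq> \<sigma> + 1" "f \<noteq> \<sigma> + 2" using f by auto
  have sm: "f < S" "0 < S" "Suc 0 < S" "Suc \<sigma> < S" using small(3)[of f] small(3)[of 0] small(3)[of 1] small(3)[of "Suc \<sigma>"] f5 by simp_all
  have comparable: "suffix (T v) (T p)" if "v \<in> {1..<n}" "suffix (A.shortest v) (Y @ [a])" for v
    using A.suffix_top_if_suffix_shortest[OF top that p] .
  define I where "I = (\<lambda>V' M' R' k'. \<exists>t. V' = V(8 := t) \<and> t \<in> {1..<n} \<and> suffix (A.shortest t) (Y @ [a]) \<and>
    (\<forall>v. hp M' v f = of_bool (P t v)) \<and> (\<forall>v g. g < \<sigma> + 5 \<longrightarrow> g \<noteq> f \<longrightarrow> hp M' v g = hp M v g) \<and>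
    (\<forall>i<base. M' i = M i) \<and> R' = R \<and> X + unmarked (P t) \<le> k')"
  show ?thesis unfolding mark_up_def
  proof (rule wp_While[where I = I])
    have "\<not> ?len p < ?len v" if "v \<in> {1..<n}" "suffix (A.shortest v) (Y @ [a])" for v
      using A.suffix_len_le[OF that(1) p comparable[OF that]] comparable[OF that] by simp
    then have "P p = A.occurs_in Y" by (auto simp: P_def fun_eq_iff)
    then show "I V Ma R k" unfolding I_def using V k p Ma A.suffix_shortest_if_class_top[OF p top]
      by (intro exI[of _ p]) (auto simp: fun_upd_idem)
  next
    fix V' M' R' k' assume "I V' M' R' k'"
    then obtain t where V': "V' = V(8 := t)" and t: "t \<in> {1..<n}" "suffix (A.shortest t) (Y @ [a])"
      and M': "\<And>v. hp M' v f = of_bool (P t v)" "\<And>v g. g < \<sigma> + 5 \<Longrightarrow> g \<noteq> f \<Longrightarrow> hp M' v g = hp M v g"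
      and rest: "\<forall>i<base. M' i = M i" "R' = R" "X + unmarked (P t) \<le> k'"
      unfolding I_def by blast
    have V'_simps: "V' 2 = base" "V' 8 = t" using V V' by simp_all
    have "safe S V' M' (fld \<sigma> (Var 8) (Num f))"
      by (rule safe_fld) (use V'_simps t n f5 sm in auto)
    then show "bsafe S V' M' (Eq (fld \<sigma> (Var 8) (Num f)) (Num 0))" using sm by simp
    have cond: "bval V' M' (Eq (fld \<sigma> (Var 8) (Num f)) (Num 0)) \<longleftrightarrow> \<not> A.occurs_in Y t"
      using V'_simps M'(1)[of t] by (simp add: ev_fld P_def)
    have tp: "suffix (T t) (T p)" using comparable[OF t] .
    show "0 < k' \<and> wp (set_fld \<sigma> (Var 8) (Num f) (Num 1) ;; Asg 8 (fld \<sigma> (Var 8) (Num (\<sigma> + 1)))) I V' M' R' (k' - 1)"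
      if "bval V' M' (Eq (fld \<sigma> (Var 8) (Num f)) (Num 0))"
    proof
      from that cond have nt: "\<not> A.occurs_in Y t" by simp
      then have "t \<noteq> 1" using A.occurs_in_root by auto
      then have t2: "t \<in> {2..<n}" using t by auto
      have l: "?lnk t \<in> {1..<n}" "parent word (T t) (T (?lnk t))" using A.lnk[OF t2] by auto
      have "suffix (T (?lnk t)) (T t)" using l(2) by (simp add: parent_def strict_suffix_def)
      then have lsh: "suffix (A.shortest (?lnk t)) (Y @ [a])"
        using A.suffix_shortest_mono[OF l(1) t(1)] t(2) suffix_order.trans by blast
      have Pt: "P (?lnk t) v \<longleftrightarrow> P t v \<or> v = t" for v
      proof (cases "v \<in> {1..<n} \<and> suffix (A.shortest v) (Y @ [a])")
        case True
        then show ?thesis using A.chain_step[OF t(1) _ tp, of v] comparable[of v] A.len_lnk_less[OF t(1)]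
          unfolding P_def by auto
      qed (use t in \<open>auto simp: P_def\<close>)
      have "{v \<in> {1..<n}. \<not> P t v} = insert t {v \<in> {1..<n}. \<not> P (?lnk t) v}"
        using Pt nt t by (auto simp: P_def)
      moreover have "t \<notin> {v \<in> {1..<n}. \<not> P (?lnk t) v}" using Pt by simp
      ultimately have card: "unmarked (P t) = Suc (unmarked (P (?lnk t)))"
        by (simp add: unmarked_def)
      then show "0 < k'" using rest(3) by simp
      let ?M = "hupd M' t f 1"
      have "hp ?M v f = of_bool (P (?lnk t) v)" for v using f5 M'(1)[of v] Pt[of v] by (simp add: hp_hupd)
      moreover have "hp ?M v g = hp M v g" if "g < \<sigma> + 5" "g \<noteq> f" for v g
        using f5 that M'(2)[OF that, of v] by (simp add: hp_hupd)
      ultimately have I: "I (V(8 := ?lnk t)) ?M R' (k' - 1)"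
        unfolding I_def using l(1) lsh rest card by (intro exI[of _ "?lnk t"]) (auto simp: hupd_below)
      have "slink ?M t = ?lnk t" using M'(2)[of "\<sigma> + 1" t] f5 by (simp add: hp_hupd)
      then show "wp (set_fld \<sigma> (Var 8) (Num f) (Num 1) ;; Asg 8 (fld \<sigma> (Var 8) (Num (\<sigma> + 1)))) I V' M' R' (k' - 1)"
        by (intro wp_Seq wp_set_fld wp_Asg safe_fld) (use I V'_simps V' t n sm f5 in \<open>simp_all add: ev_fld\<close>)
    qed
    show "\<exists>t. V' = V(8 := t) \<and> (\<forall>v. hp M' v f = of_bool (A.occurs_in (Y @ [a]) v)) \<and>
      (\<forall>v g. g < \<sigma> + 5 \<longrightarrow> g \<noteq> f \<longrightarrow> hp M' v g = hp M v g) \<and> (\<forall>i<base. M' i = M i) \<and> R' = R \<and>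
      X + unmarked (A.occurs_in (Y @ [a])) \<le> k'" if "\<not> bval V' M' (Eq (fld \<sigma> (Var 8) (Num f)) (Num 0))"
    proof -
      from that cond have ot: "A.occurs_in Y t" by simp
      have "A.occurs_in Y v" if v: "v \<in> {1..<n}" "suffix (A.shortest v) (Y @ [a])" "\<not> ?len t < ?len v" for v
      proof -
        have "suffix (T v) (T t)" using A.suffix_len_le[OF v(1) t(1) comparable[OF v(1,2)] tp] v(3) by simp
        then have "suffix (A.shortest v) (A.shortest t)" using A.suffix_shortest_mono[OF v(1) t(1)] by blast
        then show ?thesis using ot v(1) sublist_suffixD unfolding A.occurs_in_def by blast
      qed
      then have "P t = A.occurs_in (Y @ [a])" unfolding P_def fun_eq_iff A.occurs_in_snoc by blast
      then show ?thesis using V' M' rest by auto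
    qed
  qed
qed

lemma wp_mark:
  fixes V X Y \<alpha> \<beta> s e
  assumes w: "word = \<alpha> @ Y @ \<beta>" and ok: "input_ok V Ma"
    and s: "safe S V Ma s" "ev V Ma s = length \<alpha>"
    and e: "safe S (V(3 := length \<alpha>)) Ma e" "ev (V(3 := length \<alpha>)) Ma e = length \<alpha> + length Y"
    and Ma: "\<And>v. hp Ma v f = of_bool (v = 1)"
      "\<And>v g. g < \<sigma> + 5 \<Longrightarrow> g \<noteq> f \<Longrightarrow> hp Ma v g = hp M v g" "\<And>i. i < base \<Longrightarrow> Ma i = M i"
    and k: "X + length Y + n \<le> k"
  shows "wp (mark \<sigma> f s e) (\<lambda>V' M' R' k'. (\<forall>i. i \<notin> {3, 4, 7, 8, 13} \<longrightarrow> V' i = V i) \<and>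
      (\<forall>v. hp M' v f = of_bool (A.occurs_in Y v)) \<and>
      (\<forall>v g. g < \<sigma> + 5 \<longrightarrow> g \<noteq> f \<longrightarrow> hp M' v g = hp M v g) \<and> (\<forall>i<base. M' i = M i) \<and> R' = R \<and>
      X \<le> k') V Ma R k"
proof -
  define I where "I = (\<lambda>V' M' R' k'. \<exists>j. V' 3 = length \<alpha> + j \<and> j \<le> length Y \<and> V' 13 = length \<alpha> + length Y \<and>
      V' 7 \<in> {1..<n} \<and> class_top word (take j Y) (T (V' 7)) \<and>
      (\<forall>i. i \<notin> {3, 4, 7, 8, 13} \<longrightarrow> V' i = V i) \<and> (\<forall>v. hp M' v f = of_bool (A.occurs_in (take j Y) v)) \<and>
      (\<forall>v g. g < \<sigma> + 5 \<longrightarrow> g \<noteq> f \<longrightarrow> hp M' v g = hp M v g) \<and> (\<forall>i<base. M' i = M i) \<and> R' = R \<and>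
      X + (length Y - j) + unmarked (A.occurs_in (take j Y)) \<le> k')"
  have lw: "length \<alpha> + length Y \<le> length word" by (simp add: w)
  have sm: "0 < S" "Suc 0 < S" "length \<alpha> + length Y < S" using small(3)[of 0] small(3)[of 1] small(5)[OF lw] by simp_all
  let ?V = "V(3 := length \<alpha>, 13 := length \<alpha> + length Y, 7 := 1)"
  have "wp (While (Lt (Var 3) (Var 13))
      (read_letter \<sigma> ;; Asg 7 (fld \<sigma> (Var 7) (Var 4)) ;; Asg 8 (Var 7) ;; mark_up \<sigma> f ;; inc 3))
      (\<lambda>V' M' R' k'. (\<forall>i. i \<notin> {3, 4, 7, 8, 13} \<longrightarrow> V' i = V i) \<and>
      (\<forall>v. hp M' v f = of_bool (A.occurs_in Y v)) \<and>
      (\<forall>v g. g < \<sigma> + 5 \<longrightarrow> g \<noteq> f \<longrightarrow> hp M' v g = hp M v g) \<and> (\<forall>i<base. M' i = M i) \<and> R' = R \<and>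
      X \<le> k') ?V Ma R k"
  proof (rule wp_While[where I = I])
    have "unmarked (A.occurs_in []) \<le> card {1..<n}" unfolding unmarked_def by (intro card_mono) auto
    then have "unmarked (A.occurs_in []) \<le> n" by simp
    moreover have "class_top word [] (T 1)" using A.S_root class_top_refl[of "[]" word] by simp
    ultimately show "I ?V Ma R k" unfolding I_def using k Ma A.occurs_in_Nil A.n_gt
      by (intro exI[of _ 0]) auto
  next
    fix V' M' R' k' assume "I V' M' R' k'"
    then obtain j where j: "V' 3 = length \<alpha> + j" "j \<le> length Y" "V' 13 = length \<alpha> + length Y"
      and p: "V' 7 \<in> {1..<n}" "class_top word (take j Y) (T (V' 7))"
      and V': "\<forall>i. i \<notin> {3, 4, 7, 8, 13} \<longrightarrow> V' i = V i" and M': "\<And>v. hp M' v f = of_bool (A.occurs_in (take j Y) v)"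
      "\<And>v g. g < \<sigma> + 5 \<Longrightarrow> g \<noteq> f \<Longrightarrow> hp M' v g = hp M v g" "\<And>i. i < base \<Longrightarrow> M' i = M i" and R': "R' = R"
      and k': "X + (length Y - j) + unmarked (A.occurs_in (take j Y)) \<le> k'"
      unfolding I_def by blast
    show "bsafe S V' M' (Lt (Var 3) (Var 13))" by simp
    show "(\<forall>i. i \<notin> {3, 4, 7, 8, 13} \<longrightarrow> V' i = V i) \<and> (\<forall>v. hp M' v f = of_bool (A.occurs_in Y v)) \<and>
      (\<forall>v g. g < \<sigma> + 5 \<longrightarrow> g \<noteq> f \<longrightarrow> hp M' v g = hp M v g) \<and> (\<forall>i<base. M' i = M i) \<and> R' = R \<and> X \<le> k'"
      if "\<not> bval V' M' (Lt (Var 3) (Var 13))"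
    proof -
      have "j = length Y" using that j by simp
      then show ?thesis using V' M' R' k' by simp
    qed
    show "0 < k' \<and> wp (read_letter \<sigma> ;; Asg 7 (fld \<sigma> (Var 7) (Var 4)) ;; Asg 8 (Var 7) ;; mark_up \<sigma> f ;; inc 3) I V' M' R' (k' - 1)"
      if "bval V' M' (Lt (Var 3) (Var 13))"
    proof
      have jY: "j < length Y" using that j by simp
      then show "0 < k'" using k' by simp
      define a where "a = Y ! j"
      have wa: "word ! (length \<alpha> + j) = a" using jY by (simp add: w nth_append a_def)
      have lt: "length \<alpha> + j < length word" using jY lw by simp
      have a: "a < Suc \<sigma>" using word_letter[OF lt] wa by simp
      have tk: "take (Suc j) Y = take j Y @ [a]" using take_Suc_conv_app_nth[OF jY] by (simp add: a_def)
      have "sublist (take (Suc j) Y) word" unfolding w by (metis sublist_appendI sublist_take sublist_order.order_trans)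
      then have sub: "sublist (take j Y @ [a]) word" by (simp add: tk)
      define p' where "p' = hp M (V' 7) a"
      have p': "p' \<in> {1..<n}" "class_top word (take j Y @ [a]) (T p')"
        using A.delta_class_top[OF p a sub] by (simp_all add: p'_def)
      have ok': "input_ok V' M'" using ok V' M'(3) Ma(3) by (simp add: input_ok_def base_def)
      have V'2: "V' 2 = base" using ok' by (simp add: input_ok_def)
      have hpa: "hp M' (V' 7) a = p'" using M'(2)[of a "V' 7"] a f by (auto simp: p'_def)
      let ?V = "V'(4 := a, 7 := p', 8 := p')"
      have "wp (mark_up \<sigma> f) (wp (inc 3) I) ?V M' R' (k' - 1)"
      proof (rule wp_mono[OF wp_mark_up[OF p', where X = "X + (length Y - Suc j)"]])
        fix V2 M2 R2 k2
        assume "\<exists>t. V2 = ?V(8 := t) \<and> (\<forall>v. hp M2 v f = of_bool (A.occurs_in (take j Y @ [a]) v)) \<and>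
           (\<forall>v g. g < \<sigma> + 5 \<longrightarrow> g \<noteq> f \<longrightarrow> hp M2 v g = hp M v g) \<and> (\<forall>i<base. M2 i = M i) \<and> R2 = R' \<and>
           X + (length Y - Suc j) + unmarked (A.occurs_in (take j Y @ [a])) \<le> k2"
        then obtain t where V2: "V2 = ?V(8 := t)" and M2: "\<forall>v. hp M2 v f = of_bool (A.occurs_in (take j Y @ [a]) v)"
           "\<forall>v g. g < \<sigma> + 5 \<longrightarrow> g \<noteq> f \<longrightarrow> hp M2 v g = hp M v g" "\<forall>i<base. M2 i = M i" "R2 = R'"
           "X + (length Y - Suc j) + unmarked (A.occurs_in (take j Y @ [a])) \<le> k2" by blast
        have "I (V2(3 := length \<alpha> + Suc j)) M2 R2 k2" unfolding I_def
          using V2 M2 V' j jY p' R' by (intro exI[of _ "Suc j"]) (simp add: tk)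
        then show "wp (inc 3) I V2 M2 R2 k2"
          by (intro wp_Asg) (use V2 j jY sm in simp_all)
      next
        show "X + (length Y - Suc j) + unmarked (A.occurs_in (take j Y)) \<le> k' - 1" using k' jY by simp
      qed (use V'2 M' in auto)
      then show "wp (read_letter \<sigma> ;; Asg 7 (fld \<sigma> (Var 7) (Var 4)) ;; Asg 8 (Var 7) ;; mark_up \<sigma> f ;; inc 3) I V' M' R' (k' - 1)"
        by (intro wp_Seq wp_read_letter wp_Asg safe_fld)
          (use ok' j lt wa V'2 p n a hpa in \<open>simp_all add: ev_fld\<close>)
    qed
  qed
  then show ?thesis unfolding mark_def
    by (intro wp_Seq wp_Asg) (use s e sm in \<open>simp_all\<close>)
qed

end

end

section \<open>Summation\<close>

definition maw_flag :: "nat \<Rightarrow> nat \<Rightarrow> nat \<Rightarrow> nat \<Rightarrow> com" where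
  "maw_flag \<sigma> d f l = If (Lt (Var l) (fld \<sigma> (Var 8) (Num (\<sigma> + 2)))) (Asg d (Num 0))
     (Asg d (Mul (fld \<sigma> (Var 7) (Num f)) (Mul (fld \<sigma> (Var 11) (Num f)) (Sub (Num 1) (fld \<sigma> (Var 10) (Num f))))))"

definition accumulate :: "nat \<Rightarrow> com" where
  "accumulate \<sigma> =
     QOf 1 (Var 14) ;; QOf 2 (Var 15) ;; QOp QSub 1 1 2 ;; QOp QMul 1 1 1 ;;
     QOf 2 (Add (fld \<sigma> (Var 8) (Num (\<sigma> + 2))) (Num 1)) ;; QOp QMul 2 2 2 ;;
     QOp QDiv 1 1 2 ;; QOp QAdd 0 0 1 ;; inc 9"

definition add_term :: "nat \<Rightarrow> com" where
  "add_term \<sigma> =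
     Asg 10 (fld \<sigma> (Var 7) (Var 9)) ;; Asg 11 (fld \<sigma> (Var 8) (Var 9)) ;;
     maw_flag \<sigma> 14 (\<sigma> + 3) 0 ;; maw_flag \<sigma> 15 (\<sigma> + 4) 1 ;;
     accumulate \<sigma>"

definition sum_maws :: "nat \<Rightarrow> com" where
  "sum_maws \<sigma> = Asg 7 (Num 2) ;;
     While (Lt (Var 7) (Var 6))
      (Asg 8 (fld \<sigma> (Var 7) (Num (\<sigma> + 1))) ;; Asg 9 (Num 0) ;;
       While (Lt (Var 9) (Num \<sigma>)) (add_term \<sigma>) ;; inc 7)"

definition lw_com :: "nat \<Rightarrow> com" where
  "lw_com \<sigma> = initialise \<sigma> ;; build \<sigma> ;;
     mark \<sigma> (\<sigma> + 3) (Num 0) (Add (Var 0) (Var 0)) ;;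
     mark \<sigma> (\<sigma> + 4) (Add (Add (Var 0) (Var 0)) (Num 1)) (Add (Var 3) (Add (Var 1) (Var 1))) ;;
     sum_maws \<sigma>"

lemma (in suffix_automaton) delta_less: "p < n \<Longrightarrow> a < A \<Longrightarrow> \<delta> p a < n"
  using delta_0[of a] n_gt delta[of p a] delta_undef[of p a]
  by (cases "p = 0"; cases "sublist (S p @ [a]) w") auto

context lw_program
begin

definition frame :: "nat \<Rightarrow> (nat \<Rightarrow> nat) \<Rightarrow> bool" where
  "frame n V \<longleftrightarrow> V 0 = length x \<and> V 1 = length y \<and> V 2 = base \<and> V 6 = n"

context
  fixes M :: "nat \<Rightarrow> nat" and n lst :: nat and T :: "nat \<Rightarrow> nat list"
  assumes aut: "aut M word n lst T" and n: "n \<le> max_states"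
begin

interpretation A: suffix_automaton "Suc \<sigma>" word n lst T "slink M" "slen M" "hp M"
  by (fact aut)

lemma len_less: "p < n \<Longrightarrow> Suc (slen M p) < S"
  using A.len[of p] A.len_0 sublist_length_le[OF nodes_sublist[OF A.S_node, of p]]
    small(2)[of "Suc (length (T p))"] small(3)[of 1]
  by (cases "p = 0") (auto simp: max_states_def)

lemma wp_maw_flag:
  assumes occ: "\<And>v. hp M v f = of_bool (A.occurs_in Y v)" and f: "f < \<sigma> + 5" and dl: "d < 32" "l < 32"
    and V: "V 2 = base" "V 7 = p" "V 8 = slink M p" "V 10 = hp M p a" "V 11 = hp M (slink M p) a"
    and p: "p \<in> {2..<n}" "a < Suc \<sigma>"
    and Q: "Q (V(d := of_bool (A.maw_at Y p a \<and> slen M (slink M p) \<le> V l))) M R k"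
  shows "wp (maw_flag \<sigma> d f l) Q V M R k"
proof -
  have pn: "p < n" "slink M p < n" "hp M p a < n" "hp M (slink M p) a < n"
    using p A.lnk_less[of p] A.delta_less by auto
  have sm: "0 < S" "Suc 0 < S" "Suc (Suc \<sigma>) < S" "f < S"
    using small(3)[of 0] small(3)[of 1] small(3)[of "Suc (Suc \<sigma>)"] small(3)[of f] f by simp_all
  have safe: "safe S V M (fld \<sigma> (Var i) (Num g))" if "V i < n" "g < \<sigma> + 5" "i < 32" for i g
    by (rule safe_fld) (use that V n small(3)[of g] in auto)
  have flag: "hp M p f * (hp M (hp M (slink M p) a) f * (1 - hp M (hp M p a) f)) = of_bool (A.maw_at Y p a)"
    unfolding occ A.maw_at_def by simp
  show ?thesis unfolding maw_flag_def
  proof (intro wp_If wp_Asg)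
    show "bsafe S V M (Lt (Var l) (fld \<sigma> (Var 8) (Num (\<sigma> + 2))))" using safe[of 8 "\<sigma> + 2"] pn V dl by simp
  next
    assume "bval V M (Lt (Var l) (fld \<sigma> (Var 8) (Num (\<sigma> + 2))))"
    then show "Q (V(d := ev V M (Num 0))) M R k" using Q V by (simp add: ev_fld)
  next
    assume "\<not> bval V M (Lt (Var l) (fld \<sigma> (Var 8) (Num (\<sigma> + 2))))"
    then show "Q (V(d := ev V M (Mul (fld \<sigma> (Var 7) (Num f)) (Mul (fld \<sigma> (Var 11) (Num f)) (Sub (Num 1) (fld \<sigma> (Var 10) (Num f))))))) M R k"
      using Q V flag by (simp add: ev_fld)
  next
    show "safe S V M (Mul (fld \<sigma> (Var 7) (Num f)) (Mul (fld \<sigma> (Var 11) (Num f)) (Sub (Num 1) (fld \<sigma> (Var 10) (Num f)))))"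
      using safe[of 7 f] safe[of 10 f] safe[of 11 f] V pn f sm by (simp add: ev_fld occ)
  qed (use dl sm in simp_all)
qed

context
  assumes occ: "\<And>v. hp M v (\<sigma> + 3) = of_bool (A.occurs_in (x @ x) v)" "\<And>v. hp M v (\<sigma> + 4) = of_bool (A.occurs_in (y @ y) v)"
begin

definition lw_term :: "nat \<Rightarrow> nat \<Rightarrow> rat" where
  "lw_term p a = (let l = slen M (slink M p) in
     if (A.maw_at (x @ x) p a \<and> l \<le> length x) \<noteq> (A.maw_at (y @ y) p a \<and> l \<le> length y)
     then 1 / (of_nat (Suc l))\<^sup>2 else 0)"

lemma wp_add_term:
  assumes fr: "frame n V" and p: "p \<in> {2..<n}" "a < \<sigma>" and V: "V 7 = p" "V 8 = slink M p" "V 9 = a"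
    and Q: "\<And>V' R'. frame n V' \<Longrightarrow> V' 7 = p \<Longrightarrow> V' 8 = slink M p \<Longrightarrow> V' 9 = Suc a \<Longrightarrow> R' 0 = R 0 + lw_term p a \<Longrightarrow> Q V' M R' k"
  shows "wp (add_term \<sigma>) Q V M R k"
proof -
  let ?l = "slink M p"
  let ?fx = "A.maw_at (x @ x) p a \<and> slen M ?l \<le> length x" and ?fy = "A.maw_at (y @ y) p a \<and> slen M ?l \<le> length y"
  have pn: "p < n" "?l < n" using p A.lnk_less[of p] by auto
  have sm: "Suc 0 < S" "Suc (Suc \<sigma>) < S" "Suc a < S" "Suc (hp M ?l (Suc (Suc \<sigma>))) < S"
    using small(3)[of 1] small(3)[of "Suc (Suc \<sigma>)"] small(3)[of "Suc a"] p len_less[OF pn(2)] by simp_all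
  let ?V1 = "V(10 := hp M p a, 11 := hp M ?l a)"
  let ?V3 = "?V1(14 := of_bool ?fx, 15 := of_bool ?fy)"
  have V2: "V 2 = base" using fr by (simp add: frame_def)
  have tm: "(of_bool ?fx - of_bool ?fy) * (of_bool ?fx - of_bool ?fy) / (of_nat (Suc (slen M ?l)) * of_nat (Suc (slen M ?l))) = lw_term p a"
    unfolding lw_term_def Let_def power2_eq_square by auto
  have "Q (?V3(9 := Suc a)) M R' k" if "R' 0 = R 0 + lw_term p a" for R'
    by (rule Q) (use fr V that in \<open>auto simp: frame_def\<close>)
  then have q: "wp (accumulate \<sigma>) Q ?V3 M R k"
    unfolding accumulate_def by (intro wp_Seq wp_QOf wp_QOp wp_Asg) (use V V2 pn n sm tm in \<open>auto simp: ev_fld intro!: safe_fld\<close>)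
  let ?V2 = "?V1(14 := of_bool ?fx)"
  have eq: "?V1 0 = length x" "?V2 1 = length y" using fr by (simp_all add: frame_def)
  have 2: "wp (maw_flag \<sigma> 15 (\<sigma> + 4) 1) (wp (accumulate \<sigma>) Q) ?V2 M R k"
  proof (rule wp_maw_flag[OF occ(2), where p = p and a = a])
    show "wp (accumulate \<sigma>) Q (?V2(15 := of_bool (A.maw_at (y @ y) p a \<and> slen M (slink M p) \<le> ?V2 1))) M R k"
      using q unfolding eq .
  qed (use V V2 p in auto)
  have "wp (maw_flag \<sigma> 14 (\<sigma> + 3) 0) (wp (maw_flag \<sigma> 15 (\<sigma> + 4) 1 ;; accumulate \<sigma>) Q) ?V1 M R k"
  proof (rule wp_maw_flag[OF occ(1), where p = p and a = a])
    show "wp (maw_flag \<sigma> 15 (\<sigma> + 4) 1 ;; accumulate \<sigma>) Q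
       (?V1(14 := of_bool (A.maw_at (x @ x) p a \<and> slen M (slink M p) \<le> ?V1 0))) M R k"
      using wp_Seq[OF 2] unfolding eq .
  qed (use V V2 p in auto)
  from wp_Seq[OF this] have 3: "wp (maw_flag \<sigma> 14 (\<sigma> + 3) 0 ;; maw_flag \<sigma> 15 (\<sigma> + 4) 1 ;; accumulate \<sigma>) Q ?V1 M R k" .
  show ?thesis unfolding add_term_def
    by (rule wp_Seq, rule wp_Asg, simp, rule safe_fld)
      (use V V2 pn p n 3 in \<open>auto simp: ev_fld intro!: wp_Seq[OF wp_Asg[of 11]] safe_fld\<close>)
qed

lemma wp_sum_maws:
  assumes fr: "frame n V" and R: "R 0 = 0" and k: "n * (\<sigma> + 1) \<le> k"
  shows "wp (sum_maws \<sigma>) (\<lambda>V M R k. R 0 = LW (circ_maws {..<\<sigma>} x) (circ_maws {..<\<sigma>} y)) V M R k"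
proof -
  have LW: "LW (circ_maws {..<\<sigma>} x) (circ_maws {..<\<sigma>} y) = (\<Sum>p\<in>{2..<n}. \<Sum>a<\<sigma>. lw_term p a)"
    unfolding lw_term_def Let_def by (rule A.LW_automaton) (use letters in \<open>auto simp: word_def\<close>)
  have sm: "0 < S" "2 < S" "Suc \<sigma> < S" "\<sigma> < S" "Suc 0 < S"
    using small(3)[of 0] small(3)[of 2] small(3)[of "Suc \<sigma>"] small(3)[of \<sigma>] small(3)[of 1] by simp_all
  define I where "I = (\<lambda>V' M' (R' :: nat \<Rightarrow> rat) k'. frame n V' \<and> M' = M \<and> V' 7 \<in> {2..n} \<and> R' 0 = (\<Sum>p\<in>{2..<V' 7}. \<Sum>a<\<sigma>. lw_term p a) \<and>
    (n - V' 7) * (\<sigma> + 1) \<le> k')"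
  have "wp (While (Lt (Var 7) (Var 6))
      (Asg 8 (fld \<sigma> (Var 7) (Num (\<sigma> + 1))) ;; Asg 9 (Num 0) ;;
       While (Lt (Var 9) (Num \<sigma>)) (add_term \<sigma>) ;; inc 7))
     (\<lambda>V M R k. R 0 = LW (circ_maws {..<\<sigma>} x) (circ_maws {..<\<sigma>} y)) (V(7 := 2)) M R k"
  proof (rule wp_While[where I = I])
    have "(n - 2) * (\<sigma> + 1) \<le> n * (\<sigma> + 1)" by (intro mult_le_mono1) simp
    then have "(n - 2) * (\<sigma> + 1) \<le> k" using k by linarith
    then show "I (V(7 := 2)) M R k" unfolding I_def using fr R A.n_gt by (simp add: frame_def)
  next
    fix V' M' R' k' assume I: "I V' M' R' k'"
    show "bsafe S V' M' (Lt (Var 7) (Var 6))" by simp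
    show "R' 0 = LW (circ_maws {..<\<sigma>} x) (circ_maws {..<\<sigma>} y)" if "\<not> bval V' M' (Lt (Var 7) (Var 6))"
    proof -
      have "V' 7 = n" using that I by (simp add: I_def frame_def)
      then show ?thesis using I LW by (simp add: I_def)
    qed
    show "0 < k' \<and> wp (Asg 8 (fld \<sigma> (Var 7) (Num (\<sigma> + 1))) ;; Asg 9 (Num 0) ;;
       While (Lt (Var 9) (Num \<sigma>)) (add_term \<sigma>) ;; inc 7) I V' M' R' (k' - 1)" if "bval V' M' (Lt (Var 7) (Var 6))"
    proof
      define p where "p = V' 7"
      have M': "M' = M" and fr': "frame n V'" using I by (simp_all add: I_def)
      have p: "p \<in> {2..<n}" using that I by (simp add: I_def frame_def p_def)
      have R': "R' 0 = (\<Sum>p\<in>{2..<p}. \<Sum>a<\<sigma>. lw_term p a)" using I by (simp add: I_def p_def)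
      have "n - p = Suc (n - Suc p)" using p by auto
      then have mul: "(n - p) * (\<sigma> + 1) = (n - Suc p) * (\<sigma> + 1) + (\<sigma> + 1)" by simp
      have k': "(n - Suc p) * (\<sigma> + 1) + (\<sigma> + 1) \<le> k'" using I mul unfolding I_def p_def[symmetric] by linarith
      then show "0 < k'" by linarith
      define J where "J = (\<lambda>V' M' (R' :: nat \<Rightarrow> rat) k'. frame n V' \<and> M' = M \<and> V' 7 = p \<and> V' 8 = slink M p \<and> V' 9 \<le> \<sigma> \<and>
         R' 0 = (\<Sum>p\<in>{2..<p}. \<Sum>a<\<sigma>. lw_term p a) + (\<Sum>a<V' 9. lw_term p a) \<and> (n - Suc p) * (\<sigma> + 1) + (\<sigma> - V' 9) \<le> k')"
      have "wp (While (Lt (Var 9) (Num \<sigma>)) (add_term \<sigma>)) (wp (inc 7) I) (V'(8 := slink M p, 9 := 0)) M R' (k' - 1)"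
      proof (rule wp_While[where I = J])
        show "J (V'(8 := slink M p, 9 := 0)) M R' (k' - 1)" unfolding J_def using fr' k' R' p_def by (simp add: frame_def)
      next
        fix V2 M2 R2 k2 assume J: "J V2 M2 R2 k2"
        show "bsafe S V2 M2 (Lt (Var 9) (Num \<sigma>))" using sm by simp
        show "0 < k2 \<and> wp (add_term \<sigma>) J V2 M2 R2 (k2 - 1)" if "bval V2 M2 (Lt (Var 9) (Num \<sigma>))"
        proof
          have a: "V2 9 < \<sigma>" using that by simp
          then show "0 < k2" using J unfolding J_def by linarith
          have "wp (add_term \<sigma>) J V2 M R2 (k2 - 1)"
            by (rule wp_add_term[OF _ p a]) (use J a in \<open>auto simp: J_def\<close>)
          then show "wp (add_term \<sigma>) J V2 M2 R2 (k2 - 1)" using J by (simp add: J_def)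
        qed
        show "wp (inc 7) I V2 M2 R2 k2" if "\<not> bval V2 M2 (Lt (Var 9) (Num \<sigma>))"
        proof -
          have "V2 9 = \<sigma>" using that J by (simp add: J_def)
          then have "I (V2(7 := Suc p)) M2 R2 k2" using J p unfolding I_def J_def by (auto simp: frame_def)
          then show ?thesis
            by (intro wp_Asg) (use J p n sm small(1)[of "Suc p"] small(2)[of "Suc p"] small(2)[of p] in \<open>auto simp: J_def\<close>)
        qed
      qed
      then show "wp (Asg 8 (fld \<sigma> (Var 7) (Num (\<sigma> + 1))) ;; Asg 9 (Num 0) ;;
        While (Lt (Var 9) (Num \<sigma>)) (add_term \<sigma>) ;; inc 7) I V' M' R' (k' - 1)"
        by (intro wp_Seq wp_Asg safe_fld) (use fr' p n sm M' p_def in \<open>auto simp: ev_fld frame_def\<close>)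
    qed
  qed
  then show ?thesis unfolding sum_maws_def
    by (intro wp_Seq wp_Asg) (use sm in simp_all)
qed

end

end

definition credits where
  "credits = (\<sigma> + 1) + length word * (\<sigma> + 8) + (2 * length x + max_states) + (2 * length y + max_states) + max_states * (\<sigma> + 1)"

lemma wp_lw_com:
  assumes M: "M 0 = length x" "M 1 = length y" "\<And>i. i < length x + length y \<Longrightarrow> M (2 + i) = (x @ y) ! i"
    "\<And>i. base \<le> i \<Longrightarrow> M i = 0"
  shows "wp (lw_com \<sigma>) (\<lambda>V M R k. R 0 = LW (circ_maws {..<\<sigma>} x) (circ_maws {..<\<sigma>} y)) V M (\<lambda>_. 0) credits"
proof -
  let ?Q = "\<lambda>V M (R :: nat \<Rightarrow> rat) k. R 0 = LW (circ_maws {..<\<sigma>} x) (circ_maws {..<\<sigma>} y)"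
  let ?m1 = "mark \<sigma> (\<sigma> + 3) (Num 0) (Add (Var 0) (Var 0))"
  let ?m2 = "mark \<sigma> (\<sigma> + 4) (Add (Add (Var 0) (Var 0)) (Num 1)) (Add (Var 3) (Add (Var 1) (Var 1)))"
  let ?X = "(2 * length x + max_states) + (2 * length y + max_states) + max_states * (\<sigma> + 1)"
  have sm: "0 < S" "Suc 0 < S" "2 * length x < S" "Suc (2 * length x) < S" "Suc (2 * length x + 2 * length y) < S" "2 * length y < S"
    using small(3)[of 0] small(3)[of 1] small(5)[of "2 * length x"] small(5)[of "Suc (2 * length x)"]
      small(5)[of "Suc (2 * length x + 2 * length y)"] small(5)[of "2 * length y"] by (simp_all add: length_word)
  have marks: "wp (?m1 ;; ?m2 ;; sum_maws \<sigma>) ?Q V M R k" if built: "built ?X V M R k" for V M R k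
  proof -
    obtain T lst where aut: "aut M word (V 6) lst T" using built by (auto simp: built_def)
    have n: "V 6 \<le> max_states" and ok: "input_ok V M" and R0: "R = (\<lambda>_. 0)" and k: "?X \<le> k"
      and mk: "\<And>v f. \<sigma> + 3 \<le> f \<Longrightarrow> f < \<sigma> + 5 \<Longrightarrow> hp M v f = of_bool (v = 1)" using built by (auto simp: built_def)
    let ?occ = "\<lambda>M. suffix_automaton.occurs_in (V 6) T (slink M) (slen M)"
    have V: "V 0 = length x" "V 1 = length y" "V 2 = base" using ok by (simp_all add: input_ok_def)
    show ?thesis
    proof (rule wp_Seq, rule wp_mono[OF wp_mark[OF aut n, where \<alpha> = "[]" and Y = "x @ x" and \<beta> = "[\<sigma>] @ y @ y"
          and X = "2 * length y + max_states + max_states * (\<sigma> + 1)"]])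
      fix V1 M1 R1 k1
      assume *: "(\<forall>i. i \<notin> {3, 4, 7, 8, 13} \<longrightarrow> V1 i = V i) \<and> (\<forall>v. hp M1 v (\<sigma> + 3) = of_bool (?occ M (x @ x) v)) \<and>
        (\<forall>v g. g < \<sigma> + 5 \<longrightarrow> g \<noteq> \<sigma> + 3 \<longrightarrow> hp M1 v g = hp M v g) \<and> (\<forall>i<base. M1 i = M i) \<and> R1 = R \<and>
        2 * length y + max_states + max_states * (\<sigma> + 1) \<le> k1"
      then have M1: "\<And>v g. g < \<sigma> + 5 \<Longrightarrow> g \<noteq> \<sigma> + 3 \<Longrightarrow> hp M1 v g = hp M v g" by blast
      have fields: "(slink M1) = (slink M)" "(slen M1) = (slen M)"
        by (simp_all add: M1)
      have aut1: "aut M1 word (V 6) lst T" by (rule aut_cong[OF aut]) (simp add: M1)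
      have V1: "V1 0 = length x" "V1 1 = length y" "V1 2 = base" "V1 6 = V 6" using * V by simp_all
      have ok1: "input_ok V1 M1" using ok V1 * by (simp add: input_ok_def base_def)
      show "wp (?m2 ;; sum_maws \<sigma>) ?Q V1 M1 R1 k1"
      proof (rule wp_Seq, rule wp_mono[OF wp_mark[OF aut1 n, where \<alpha> = "x @ x @ [\<sigma>]" and Y = "y @ y" and \<beta> = "[]"
          and X = "max_states * (\<sigma> + 1)"]])
        fix V2 M2 R2 k2
        assume **: "(\<forall>i. i \<notin> {3, 4, 7, 8, 13} \<longrightarrow> V2 i = V1 i) \<and> (\<forall>v. hp M2 v (\<sigma> + 4) = of_bool (?occ M1 (y @ y) v)) \<and>
          (\<forall>v g. g < \<sigma> + 5 \<longrightarrow> g \<noteq> \<sigma> + 4 \<longrightarrow> hp M2 v g = hp M1 v g) \<and> (\<forall>i<base. M2 i = M1 i) \<and> R2 = R1 \<and>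
          max_states * (\<sigma> + 1) \<le> k2"
        then have M2: "\<And>v g. g < \<sigma> + 5 \<Longrightarrow> g \<noteq> \<sigma> + 4 \<Longrightarrow> hp M2 v g = hp M1 v g" by blast
        have fields2: "(slink M2) = (slink M)" "(slen M2) = (slen M)"
          using fields by (simp_all add: M2)
        have aut2: "aut M2 word (V 6) lst T" by (rule aut_cong[OF aut1]) (simp add: M2)
        have V2: "V2 0 = length x" "V2 1 = length y" "V2 2 = base" "V2 6 = V 6" using ** V1 by simp_all
        show "wp (sum_maws \<sigma>) ?Q V2 M2 R2 k2"
        proof (rule wp_sum_maws[OF aut2 n])
          show "hp M2 v (\<sigma> + 3) = of_bool (?occ M2 (x @ x) v)" for v
            unfolding fields2 using M2[of "\<sigma> + 3" v] * by simp
          show "hp M2 v (\<sigma> + 4) = of_bool (?occ M2 (y @ y) v)" for v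
            unfolding fields2 using ** unfolding fields by simp
          have "V 6 * (\<sigma> + 1) \<le> max_states * (\<sigma> + 1)" using n by (intro mult_le_mono1)
          then show "V 6 * (\<sigma> + 1) \<le> k2" using ** by linarith
        qed (use * ** R0 V2 in \<open>auto simp: frame_def\<close>)
      next
        show "hp M1 v (\<sigma> + 4) = of_bool (v = 1)" for v using M1[of "\<sigma> + 4" v] mk[of "\<sigma> + 4" v] by simp
        show "max_states * (\<sigma> + 1) + length (y @ y) + V 6 \<le> k1" using * n by simp
      qed (use V1 ok1 sm in \<open>auto simp: word_def\<close>)
    next
      show "2 * length y + max_states + max_states * (\<sigma> + 1) + length (x @ x) + V 6 \<le> k" using k n by simp
      show "hp M v (\<sigma> + 3) = of_bool (v = 1)" for v using mk[of "\<sigma> + 3" v] by simp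
    qed (use V ok sm in \<open>auto simp: word_def\<close>)
  qed
  have "wp (initialise \<sigma>) (build_inv ?X) V M (\<lambda>_. 0) credits"
    by (rule wp_initialise[OF M]) (simp_all add: credits_def)
  then have "wp (initialise \<sigma>) (wp (build \<sigma> ;; ?m1 ;; ?m2 ;; sum_maws \<sigma>) ?Q) V M (\<lambda>_. 0) credits"
    by (rule wp_mono) (intro wp_Seq wp_mono[OF wp_build] marks)
  then show ?thesis unfolding lw_com_def by (rule wp_Seq)
qed

end

lemma ram_computes_mono:
  "ram_computes b P s t S v \<Longrightarrow> t \<le> t' \<Longrightarrow> ram_computes b P s t' S v"
  unfolding ram_computes_def by (blast intro: le_trans)

lemma linear_bigo: "(\<lambda>k. real (a * (k + 1))) \<in> O(\<lambda>k. real k)"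
proof (rule bigoI[where c = "2 * real a"])
  have "norm (real (a * (k + 1))) \<le> 2 * real a * norm (real k)" if "1 \<le> k" for k
  proof -
    have "real (a * (k + 1)) \<le> real (a * (2 * k))" using that by (intro of_nat_mono mult_le_mono2) simp
    then show ?thesis by simp
  qed
  then show "\<forall>\<^sub>F k in sequentially. norm (real (a * (k + 1))) \<le> 2 * real a * norm (real k)"
    unfolding eventually_sequentially by blast
qed

lemma (in lw_program) ram_computes_LW:
  fixes s :: ram_state
  assumes M: "mem s 0 = length x" "mem s 1 = length y" "\<And>i. i < length x + length y \<Longrightarrow> mem s (2 + i) = (x @ y) ! i"
    "\<And>i. 2 + length x + length y \<le> i \<Longrightarrow> mem s i = 0" and s: "pc s = 0" "qreg s = (\<lambda>_. 0)"
  shows "ram_computes b (asm 0 (lw_com \<sigma>)) s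
    ((Suc (clen (lw_com \<sigma>)) * (10 * \<sigma> + 40) + clen (lw_com \<sigma>)) * (length x + length y + 1)) S
    (LW (circ_maws {..<\<sigma>} x) (circ_maws {..<\<sigma>} y))"
proof (rule ram_computes_mono[OF wp_ram_computes])
  show "wp (lw_com \<sigma>) (\<lambda>V M R k. R 0 = LW (circ_maws {..<\<sigma>} x) (circ_maws {..<\<sigma>} y)) (reg s) (mem s) (qreg s) credits"
    unfolding s(2) by (rule wp_lw_com) (use M in \<open>simp_all add: base_def\<close>)
  show "pc s = 0" by (fact s(1))
  have "credits \<le> (10 * \<sigma> + 40) * (length x + length y + 1)"
    by (simp add: credits_def length_word max_states_def algebra_simps)
  then have "Suc (clen (lw_com \<sigma>)) * credits \<le> Suc (clen (lw_com \<sigma>)) * ((10 * \<sigma> + 40) * (length x + length y + 1))"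
    by (rule mult_le_mono2)
  then show "Suc (clen (lw_com \<sigma>)) * credits + clen (lw_com \<sigma>)
    \<le> (Suc (clen (lw_com \<sigma>)) * (10 * \<sigma> + 40) + clen (lw_com \<sigma>)) * (length x + length y + 1)"
    by (simp only: add_mult_distrib mult.assoc) simp
qed

theorem theorem2:
  fixes \<Sigma> :: "'a set" and code :: "'a \<Rightarrow> nat"
  assumes "finite \<Sigma>" and "bij_betw code \<Sigma> {..<card \<Sigma>}"
  shows "\<exists>(P :: program) (c :: nat) (T :: nat \<Rightarrow> nat) (S :: nat \<Rightarrow> nat).
    (\<lambda>k. real (T k)) \<in> O(\<lambda>k. real k) \<and>
    (\<lambda>k. real (S k)) \<in> O(\<lambda>k. real k) \<and>
    (\<forall>x\<in>lists \<Sigma>. \<forall>y\<in>lists \<Sigma>. \<forall>b. c * (length x + length y + 1) \<le> 2 ^ b \<longrightarrow>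
       ram_computes b P (initial_state code x y)
         (T (length x + length y)) (S (length x + length y))
         (LW (circ_maws \<Sigma> x) (circ_maws \<Sigma> y)))"
proof -
  define \<sigma> where "\<sigma> = card \<Sigma>"
  define c where "c = 4 * \<sigma> + 22"
  define a where "a = Suc (clen (lw_com \<sigma>)) * (10 * \<sigma> + 40) + clen (lw_com \<sigma>)"
  have inj: "inj_on code \<Sigma>" and img: "code ` \<Sigma> = {..<\<sigma>}"
    using assms(2) by (simp_all add: bij_betw_def \<sigma>_def)
  have "ram_computes b (asm 0 (lw_com \<sigma>)) (initial_state code x y)
      (a * (length x + length y + 1)) (c * (length x + length y + 1)) (LW (circ_maws \<Sigma> x) (circ_maws \<Sigma> y))"
    if x: "x \<in> lists \<Sigma>" "y \<in> lists \<Sigma>" and b: "c * (length x + length y + 1) \<le> 2 ^ b" for x y b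
  proof -
    have sub: "set x \<subseteq> \<Sigma>" "set y \<subseteq> \<Sigma>" using x by auto
    interpret lw_program b "c * (length x + length y + 1)" \<sigma> "map code x" "map code y"
    proof
      show "set (map code x) \<subseteq> {..<\<sigma>}" "set (map code y) \<subseteq> {..<\<sigma>}" using sub img by auto
      show "2 + length (map code x) + length (map code y) +
          (\<sigma> + 5) * (2 + 2 * (2 * length (map code x) + 2 * length (map code y) + 1))
        \<le> c * (length x + length y + 1)" by (simp add: c_def algebra_simps)
    qed (fact b)
    have "ram_computes b (asm 0 (lw_com \<sigma>)) (initial_state code x y)
      ((Suc (clen (lw_com \<sigma>)) * (10 * \<sigma> + 40) + clen (lw_com \<sigma>)) * (length (map code x) + length (map code y) + 1))
      (c * (length x + length y + 1)) (LW (circ_maws {..<\<sigma>} (map code x)) (circ_maws {..<\<sigma>} (map code y)))"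
      by (rule ram_computes_LW) (auto simp: initial_state_def input_cells_def nth_append)
    then show ?thesis using LW_map[OF inj sub] by (simp add: img a_def)
  qed
  then show ?thesis
    by (intro exI[of _ "asm 0 (lw_com \<sigma>)"] exI[of _ c] exI[of _ "\<lambda>k. a * (k + 1)"] exI[of _ "\<lambda>k. c * (k + 1)"]
        conjI linear_bigo ballI allI impI)
qed

end
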